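(* The 2-category of 2-categories with strong duality involutions, duality 2-functors, and duality 2-natural transformations is 2-equivalent to the 2-category of 2-categories with contravariance in which every object has a strict opposite, 2-functors preserving contravariance, and 2-natural transformations respecting contravariance.
   Context: $\mathcal{A}^{\mathrm{co}}$ denotes reversal of 2-cells but not 1-cells. A **strong duality involution** on a 2-category $\mathcal{A}$ is a strict 2-functor $(-)^\circ:\mathcal{A}^{\mathrm{co}}\to\mathcal{A}$ with a strict 2-natural isomorphism $\mathfrak{y}_x:x\to x^{\circ\circ}$ such that $\mathfrak{y}_{x^\circ}=(\mathfrak{y}_x)^\circ$ for all $x$. A **duality 2-functor** $F:\mathcal{A}\to\mathcal{B}$ between such is a strict 2-functor with a strict 2-natural isomorphism $\mathfrak{i}_x:(Fx)^\circ\to F(x^\circ)$ such that $\mathfrak{i}_{x^\circ}\circ(\mathfrak{i}_x)^\circ\circ\mathfrak{y}_{Fx}=F(\mathfrak{y}_x)$. A **duality 2-natural transformation** $\alpha:(F,\mathfrak{i})\to(F',\mathfrak{i}')$ is a strict 2-natural transformation $\alpha:F\to F'$ such that $\alpha_{x^\circ}\circ\mathfrak{i}_x=\mathfrak{i}'_x\circ(\alpha_x)^\circ$ for all $x$. (Equivalently, these are the pseudo algebras with strict unit constraint, pseudo morphisms and algebra 2-cells for the 2-monad $T\mathcal{A}=\mathcal{A}+\mathcal{A}^{\mathrm{co}}$.) A **2-category with contravariance** $\underline{A}$ consists of a collection of objects; for each pair $x,y$ two categories $\underline{A}^+(x,y)$ and $\underline{A}^-(x,y)$ (of covariant and contravariant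 morphisms); an object $1_x\in\underline{A}^+(x,x)$ for each $x$; and composition functors $$\underline{A}^+(y,z)\times\underline{A}^+(x,y)\to\underline{A}^+(x,z),\qquad \underline{A}^-(y,z)\times\underline{A}^-(x,y)^{\mathrm{op}}\to\underline{A}^+(x,z),$$ $$\underline{A}^+(y,z)\times\underline{A}^-(x,y)\to\underline{A}^-(x,z),\qquad \underline{A}^-(y,z)\times\underline{A}^+(x,y)^{\mathrm{op}}\to\underline{A}^-(x,z),$$ which are strictly unital (left and right, for each variance) and strictly associative (for each of the eight triples of variances). A **2-functor preserving contravariance** $F:\underline{A}\to\underline{B}$ is a function on objects together with functors $\underline{A}^{\pm}(x,y)\to\underline{B}^{\pm}(Fx,Fy)$ strictly preserving units and all four compositions. A **2-natural transformation respecting contravariance** $\alpha:F\to F'$ consists of objects $\alpha_x\in\underline{B}^+(Fx,F'x)$ such that for each variance $\pm$ the functors $\underline{A}^\pm(x,y)\to\underline{B}^\pm(Fx,F'y)$ given by $f\mapsto\alpha_y\circ F(f)$ and $f\mapsto F'(f)\circ\alpha_x$ (on objects and morphisms) are equal. A **strict opposite** of an object $x$ of $\underline{A}$ is an object $x^\circ$ equipped with $\chi_x\in\underline{A}^-(x,x^\circ)$ such that for all $y$ precomposition with $\chi_x$ induces isomorphisms of categories $\underline{A}^+(x^\circ,y)\xrightarrow{\sim}\underline{A}^-(x,y)$ and $\underline{A}^-(x^\circ,y)\xrightarrow{\sim}\underline{A}^+(x,y)$. *)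

theory Defs
  imports Main
begin

text \<open>
  Sizes are handled by types: a 2-category has its objects, 1-cells and 2-cells in types
  \<open>'o\<close>, \<open>'m\<close>, \<open>'c\<close> (with explicit carriers), and the 2-categories of structures below
  collect all structures living in a fixed but arbitrary triple of types.

  Structure fields are constrained on the carriers only, so two structures that differ off their
  carriers are different objects, isomorphic by the identity. Maps between structures
  (2-functors, 2-natural transformations) are required to be \<open>undefined\<close> off the carriers, so
  that equality of maps is the mathematical one.
\<close>

section \<open>Categories\<close>

text \<open>\<open>Cmp C g f\<close> is the composite \<open>g \<circ> f\<close>.\<close>

record ('m, 'c) cat =
  Obj :: "'m set"
  Arr :: "'c set"
  Dom :: "'c \<Rightarrow> 'm"
  Cod :: "'c \<Rightarrow> 'm"
  Idn :: "'m \<Rightarrow> 'c"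
  Cmp :: "'c \<Rightarrow> 'c \<Rightarrow> 'c"

locale category =
  fixes C :: "('m, 'c) cat"
  assumes dom_obj: "f \<in> Arr C \<Longrightarrow> Dom C f \<in> Obj C"
    and cod_obj: "f \<in> Arr C \<Longrightarrow> Cod C f \<in> Obj C"
    and idn_arr: "a \<in> Obj C \<Longrightarrow> Idn C a \<in> Arr C"
    and dom_idn: "a \<in> Obj C \<Longrightarrow> Dom C (Idn C a) = a"
    and cod_idn: "a \<in> Obj C \<Longrightarrow> Cod C (Idn C a) = a"
    and cmp_arr: "\<lbrakk>f \<in> Arr C; g \<in> Arr C; Dom C g = Cod C f\<rbrakk> \<Longrightarrow> Cmp C g f \<in> Arr C"
    and dom_cmp: "\<lbrakk>f \<in> Arr C; g \<in> Arr C; Dom C g = Cod C f\<rbrakk> \<Longrightarrow> Dom C (Cmp C g f) = Dom C f"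
    and cod_cmp: "\<lbrakk>f \<in> Arr C; g \<in> Arr C; Dom C g = Cod C f\<rbrakk> \<Longrightarrow> Cod C (Cmp C g f) = Cod C g"
    and cmp_idn_left: "f \<in> Arr C \<Longrightarrow> Cmp C (Idn C (Cod C f)) f = f"
    and cmp_idn_right: "f \<in> Arr C \<Longrightarrow> Cmp C f (Idn C (Dom C f)) = f"
    and cmp_assoc: "\<lbrakk>f \<in> Arr C; g \<in> Arr C; h \<in> Arr C; Dom C g = Cod C f; Dom C h = Cod C g\<rbrakk>
      \<Longrightarrow> Cmp C (Cmp C h g) f = Cmp C h (Cmp C g f)"

definition op_cat :: "('m, 'c) cat \<Rightarrow> ('m, 'c) cat" where
  "op_cat C = \<lparr>Obj = Obj C, Arr = Arr C, Dom = Cod C, Cod = Dom C, Idn = Idn C,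
     Cmp = (\<lambda>g f. Cmp C f g)\<rparr>"

definition prod_cat :: "('m, 'c) cat \<Rightarrow> ('n, 'd) cat \<Rightarrow> ('m \<times> 'n, 'c \<times> 'd) cat" where
  "prod_cat C D = \<lparr>Obj = Obj C \<times> Obj D, Arr = Arr C \<times> Arr D,
     Dom = map_prod (Dom C) (Dom D), Cod = map_prod (Cod C) (Cod D),
     Idn = map_prod (Idn C) (Idn D),
     Cmp = (\<lambda>(g, k) (f, h). (Cmp C g f, Cmp D k h))\<rparr>"

locale cat_functor = source: category C + target: category D
  for C :: "('m, 'c) cat" and D :: "('n, 'd) cat" +
  fixes Fo :: "'m \<Rightarrow> 'n" and Fa :: "'c \<Rightarrow> 'd"
  assumes map_obj: "a \<in> Obj C \<Longrightarrow> Fo a \<in> Obj D"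
    and map_arr: "f \<in> Arr C \<Longrightarrow> Fa f \<in> Arr D"
    and map_dom: "f \<in> Arr C \<Longrightarrow> Dom D (Fa f) = Fo (Dom C f)"
    and map_cod: "f \<in> Arr C \<Longrightarrow> Cod D (Fa f) = Fo (Cod C f)"
    and map_idn: "a \<in> Obj C \<Longrightarrow> Fa (Idn C a) = Idn D (Fo a)"
    and map_cmp: "\<lbrakk>f \<in> Arr C; g \<in> Arr C; Dom C g = Cod C f\<rbrakk>
      \<Longrightarrow> Fa (Cmp C g f) = Cmp D (Fa g) (Fa f)"

definition cat_isomorphism ::
  "('m, 'c) cat \<Rightarrow> ('n, 'd) cat \<Rightarrow> ('m \<Rightarrow> 'n) \<Rightarrow> ('c \<Rightarrow> 'd) \<Rightarrow> bool" where
  "cat_isomorphism C D Fo Fa \<longleftrightarrow> cat_functor C D Fo Fa \<and>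
     (\<exists>Go Ga. cat_functor D C Go Ga \<and>
        (\<forall>a\<in>Obj C. Go (Fo a) = a) \<and> (\<forall>f\<in>Arr C. Ga (Fa f) = f) \<and>
        (\<forall>b\<in>Obj D. Fo (Go b) = b) \<and> (\<forall>g\<in>Arr D. Fa (Ga g) = g))"

section \<open>2-categories\<close>

text \<open>
  A strict 2-category, in its Cat-enriched form. The hom-categories need not be disjoint, so
  everything acting on cells is indexed by objects: \<open>CompO A x y z g f\<close> is the composite of
  1-cells \<open>f : x \<rightarrow> y\<close> and \<open>g : y \<rightarrow> z\<close>, and \<open>CompA A x y z \<beta> \<alpha>\<close> the horizontal
  composite of 2-cells.
\<close>

record ('o, 'm, 'c) twocat =
  Ob :: "'o set"
  Hom :: "'o \<Rightarrow> 'o \<Rightarrow> ('m, 'c) cat"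
  One :: "'o \<Rightarrow> 'm"
  CompO :: "'o \<Rightarrow> 'o \<Rightarrow> 'o \<Rightarrow> 'm \<Rightarrow> 'm \<Rightarrow> 'm"
  CompA :: "'o \<Rightarrow> 'o \<Rightarrow> 'o \<Rightarrow> 'c \<Rightarrow> 'c \<Rightarrow> 'c"

locale two_category =
  fixes A :: "('o, 'm, 'c) twocat"
  assumes hom_category: "\<lbrakk>x \<in> Ob A; y \<in> Ob A\<rbrakk> \<Longrightarrow> category (Hom A x y)"
    and one_obj: "x \<in> Ob A \<Longrightarrow> One A x \<in> Obj (Hom A x x)"
    and comp_functor: "\<lbrakk>x \<in> Ob A; y \<in> Ob A; z \<in> Ob A\<rbrakk> \<Longrightarrow>
      cat_functor (prod_cat (Hom A y z) (Hom A x y)) (Hom A x z)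
        (\<lambda>(g, f). CompO A x y z g f) (\<lambda>(\<beta>, \<alpha>). CompA A x y z \<beta> \<alpha>)"
    and unit_left_obj: "\<lbrakk>x \<in> Ob A; y \<in> Ob A; f \<in> Obj (Hom A x y)\<rbrakk> \<Longrightarrow>
      CompO A x y y (One A y) f = f"
    and unit_left_arr: "\<lbrakk>x \<in> Ob A; y \<in> Ob A; \<alpha> \<in> Arr (Hom A x y)\<rbrakk> \<Longrightarrow>
      CompA A x y y (Idn (Hom A y y) (One A y)) \<alpha> = \<alpha>"
    and unit_right_obj: "\<lbrakk>x \<in> Ob A; y \<in> Ob A; f \<in> Obj (Hom A x y)\<rbrakk> \<Longrightarrow>
      CompO A x x y f (One A x) = f"
    and unit_right_arr: "\<lbrakk>x \<in> Ob A; y \<in> Ob A; \<alpha> \<in> Arr (Hom A x y)\<rbrakk> \<Longrightarrow>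
      CompA A x x y \<alpha> (Idn (Hom A x x) (One A x)) = \<alpha>"
    and assoc_obj: "\<lbrakk>w \<in> Ob A; x \<in> Ob A; y \<in> Ob A; z \<in> Ob A;
      f \<in> Obj (Hom A w x); g \<in> Obj (Hom A x y); h \<in> Obj (Hom A y z)\<rbrakk> \<Longrightarrow>
      CompO A w x z (CompO A x y z h g) f = CompO A w y z h (CompO A w x y g f)"
    and assoc_arr: "\<lbrakk>w \<in> Ob A; x \<in> Ob A; y \<in> Ob A; z \<in> Ob A;
      \<alpha> \<in> Arr (Hom A w x); \<beta> \<in> Arr (Hom A x y); \<gamma> \<in> Arr (Hom A y z)\<rbrakk> \<Longrightarrow>
      CompA A w x z (CompA A x y z \<gamma> \<beta>) \<alpha> = CompA A w y z \<gamma> (CompA A w x y \<beta> \<alpha>)"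

definition co :: "('o, 'm, 'c) twocat \<Rightarrow> ('o, 'm, 'c) twocat" where
  "co A = A\<lparr>Hom := \<lambda>x y. op_cat (Hom A x y)\<rparr>"

record ('o, 'm, 'c, 'p, 'n, 'd) two_fun =
  FunO :: "'o \<Rightarrow> 'p"
  Fun1 :: "'o \<Rightarrow> 'o \<Rightarrow> 'm \<Rightarrow> 'n"
  Fun2 :: "'o \<Rightarrow> 'o \<Rightarrow> 'c \<Rightarrow> 'd"

locale two_functor = source: two_category A + target: two_category B
  for A :: "('o, 'm, 'c) twocat" and B :: "('p, 'n, 'd) twocat" +
  fixes F :: "('o, 'm, 'c, 'p, 'n, 'd) two_fun"
  assumes fun_ob: "x \<in> Ob A \<Longrightarrow> FunO F x \<in> Ob B"
    and fun_hom: "\<lbrakk>x \<in> Ob A; y \<in> Ob A\<rbrakk> \<Longrightarrow>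
      cat_functor (Hom A x y) (Hom B (FunO F x) (FunO F y)) (Fun1 F x y) (Fun2 F x y)"
    and fun_one: "x \<in> Ob A \<Longrightarrow> Fun1 F x x (One A x) = One B (FunO F x)"
    and fun_comp_obj: "\<lbrakk>x \<in> Ob A; y \<in> Ob A; z \<in> Ob A;
      f \<in> Obj (Hom A x y); g \<in> Obj (Hom A y z)\<rbrakk> \<Longrightarrow>
      Fun1 F x z (CompO A x y z g f) =
        CompO B (FunO F x) (FunO F y) (FunO F z) (Fun1 F y z g) (Fun1 F x y f)"
    and fun_comp_arr: "\<lbrakk>x \<in> Ob A; y \<in> Ob A; z \<in> Ob A;
      \<alpha> \<in> Arr (Hom A x y); \<beta> \<in> Arr (Hom A y z)\<rbrakk> \<Longrightarrow>
      Fun2 F x z (CompA A x y z \<beta> \<alpha>) =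
        CompA B (FunO F x) (FunO F y) (FunO F z) (Fun2 F y z \<beta>) (Fun2 F x y \<alpha>)"
    and ext_ob: "x \<notin> Ob A \<Longrightarrow> FunO F x = undefined"
    and ext_1: "\<not> (x \<in> Ob A \<and> y \<in> Ob A \<and> f \<in> Obj (Hom A x y)) \<Longrightarrow> Fun1 F x y f = undefined"
    and ext_2: "\<not> (x \<in> Ob A \<and> y \<in> Ob A \<and> \<alpha> \<in> Arr (Hom A x y)) \<Longrightarrow> Fun2 F x y \<alpha> = undefined"

definition id_two_fun :: "('o, 'm, 'c) twocat \<Rightarrow> ('o, 'm, 'c, 'o, 'm, 'c) two_fun" where
  "id_two_fun A = \<lparr>
     FunO = (\<lambda>x. if x \<in> Ob A then x else undefined),
     Fun1 = (\<lambda>x y f. if x \<in> Ob A \<and> y \<in> Ob A \<and> f \<in> Obj (Hom A x y) then f else undefined),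
     Fun2 = (\<lambda>x y \<alpha>. if x \<in> Ob A \<and> y \<in> Ob A \<and> \<alpha> \<in> Arr (Hom A x y) then \<alpha> else undefined)\<rparr>"

text \<open>The composite \<open>G \<circ> F\<close>; the argument \<open>A\<close> is the domain of \<open>F\<close>.\<close>

definition comp_two_fun ::
  "('o, 'm, 'c) twocat \<Rightarrow> ('p, 'n, 'd, 'q, 'k, 'e) two_fun \<Rightarrow>
   ('o, 'm, 'c, 'p, 'n, 'd) two_fun \<Rightarrow> ('o, 'm, 'c, 'q, 'k, 'e) two_fun" where
  "comp_two_fun A G F = \<lparr>
     FunO = (\<lambda>x. if x \<in> Ob A then FunO G (FunO F x) else undefined),
     Fun1 = (\<lambda>x y f. if x \<in> Ob A \<and> y \<in> Ob A \<and> f \<in> Obj (Hom A x y)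
       then Fun1 G (FunO F x) (FunO F y) (Fun1 F x y f) else undefined),
     Fun2 = (\<lambda>x y \<alpha>. if x \<in> Ob A \<and> y \<in> Ob A \<and> \<alpha> \<in> Arr (Hom A x y)
       then Fun2 G (FunO F x) (FunO F y) (Fun2 F x y \<alpha>) else undefined)\<rparr>"

locale two_natural = F: two_functor A B F + F': two_functor A B F'
  for A :: "('o, 'm, 'c) twocat" and B :: "('p, 'n, 'd) twocat" and F F' +
  fixes \<alpha> :: "'o \<Rightarrow> 'n"
  assumes cpt_obj: "x \<in> Ob A \<Longrightarrow> \<alpha> x \<in> Obj (Hom B (FunO F x) (FunO F' x))"
    and naturality_obj: "\<lbrakk>x \<in> Ob A; y \<in> Ob A; f \<in> Obj (Hom A x y)\<rbrakk> \<Longrightarrow>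
      CompO B (FunO F x) (FunO F y) (FunO F' y) (\<alpha> y) (Fun1 F x y f) =
      CompO B (FunO F x) (FunO F' x) (FunO F' y) (Fun1 F' x y f) (\<alpha> x)"
    and naturality_arr: "\<lbrakk>x \<in> Ob A; y \<in> Ob A; \<mu> \<in> Arr (Hom A x y)\<rbrakk> \<Longrightarrow>
      CompA B (FunO F x) (FunO F y) (FunO F' y)
        (Idn (Hom B (FunO F y) (FunO F' y)) (\<alpha> y)) (Fun2 F x y \<mu>) =
      CompA B (FunO F x) (FunO F' x) (FunO F' y)
        (Fun2 F' x y \<mu>) (Idn (Hom B (FunO F x) (FunO F' x)) (\<alpha> x))"
    and ext_cpt: "x \<notin> Ob A \<Longrightarrow> \<alpha> x = undefined"

definition is_isomorphism :: "('o, 'm, 'c) twocat \<Rightarrow> 'o \<Rightarrow> 'o \<Rightarrow> 'm \<Rightarrow> bool" where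
  "is_isomorphism A x y f \<longleftrightarrow> f \<in> Obj (Hom A x y) \<and>
     (\<exists>g\<in>Obj (Hom A y x). CompO A x y x g f = One A x \<and> CompO A y x y f g = One A y)"

definition two_natural_iso ::
  "('o, 'm, 'c) twocat \<Rightarrow> ('p, 'n, 'd) twocat \<Rightarrow> ('o, 'm, 'c, 'p, 'n, 'd) two_fun \<Rightarrow>
   ('o, 'm, 'c, 'p, 'n, 'd) two_fun \<Rightarrow> ('o \<Rightarrow> 'n) \<Rightarrow> bool" where
  "two_natural_iso A B F F' \<alpha> \<longleftrightarrow> two_natural A B F F' \<alpha> \<and>
     (\<forall>x\<in>Ob A. is_isomorphism B (FunO F x) (FunO F' x) (\<alpha> x))"

definition two_equivalent :: "('o, 'm, 'c) twocat \<Rightarrow> ('p, 'n, 'd) twocat \<Rightarrow> bool" where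
  "two_equivalent A B \<longleftrightarrow> two_category A \<and> two_category B \<and>
     (\<exists>F G \<eta> \<epsilon>. two_functor A B F \<and> two_functor B A G \<and>
        two_natural_iso A A (id_two_fun A) (comp_two_fun A G F) \<eta> \<and>
        two_natural_iso B B (comp_two_fun B F G) (id_two_fun B) \<epsilon>)"

text \<open>
  1-cells and 2-cells of the 2-categories of structures below; 2-cells record their source and
  target since \<open>Dom\<close> and \<open>Cod\<close> of a category are functions of the arrow.
\<close>

record ('f, 'o, 'n) transf =
  Src :: 'f
  Tgt :: 'f
  Cpt :: "'o \<Rightarrow> 'n"

section \<open>Strong duality involutions\<close>

text \<open>
  Since \<open>co\<close> leaves cells and carriers unchanged, the same record serves as a 2-functor
  \<open>A \<rightarrow> B\<close> and as the 2-functor \<open>co A \<rightarrow> co B\<close>. In particular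
  \<open>comp_two_fun A (Inv A) (Inv A)\<close> is the 2-functor \<open>x \<mapsto> x\<degree>\<degree>\<close> from
  \<open>co (co A) = A\<close> to \<open>A\<close>.
\<close>

record ('o, 'm, 'c) dual_twocat =
  Und :: "('o, 'm, 'c) twocat"
  Inv :: "('o, 'm, 'c, 'o, 'm, 'c) two_fun"
  Dunit :: "'o \<Rightarrow> 'm"

definition strong_duality :: "('o, 'm, 'c) dual_twocat \<Rightarrow> bool" where
  "strong_duality A \<longleftrightarrow>
     two_category (Und A) \<and>
     two_functor (co (Und A)) (Und A) (Inv A) \<and>
     two_natural_iso (Und A) (Und A)
       (id_two_fun (Und A)) (comp_two_fun (Und A) (Inv A) (Inv A)) (Dunit A) \<and>
     (\<forall>x\<in>Ob (Und A). Dunit A (FunO (Inv A) x) =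
        Fun1 (Inv A) x (FunO (Inv A) (FunO (Inv A) x)) (Dunit A x))"

record ('o, 'm, 'c, 'p, 'n, 'd) dual_fun =
  Fun :: "('o, 'm, 'c, 'p, 'n, 'd) two_fun"
  Cns :: "'o \<Rightarrow> 'n"

definition duality_functor ::
  "('o, 'm, 'c) dual_twocat \<Rightarrow> ('p, 'n, 'd) dual_twocat \<Rightarrow>
   ('o, 'm, 'c, 'p, 'n, 'd) dual_fun \<Rightarrow> bool" where
  "duality_functor A B F \<longleftrightarrow>
     two_functor (Und A) (Und B) (Fun F) \<and>
     two_natural_iso (co (Und A)) (Und B)
       (comp_two_fun (co (Und A)) (Inv B) (Fun F))
       (comp_two_fun (co (Und A)) (Fun F) (Inv A)) (Cns F) \<and>
     (\<forall>x\<in>Ob (Und A).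
        let D = FunO (Inv A); E = FunO (Inv B); H = FunO (Fun F) in
        CompO (Und B) (H x) (E (H (D x))) (H (D (D x)))
          (Cns F (D x))
          (CompO (Und B) (H x) (E (E (H x))) (E (H (D x)))
             (Fun1 (Inv B) (E (H x)) (H (D x)) (Cns F x))
             (Dunit B (H x)))
        = Fun1 (Fun F) x (D (D x)) (Dunit A x))"

definition duality_natural ::
  "('o, 'm, 'c) dual_twocat \<Rightarrow> ('p, 'n, 'd) dual_twocat \<Rightarrow>
   ('o, 'm, 'c, 'p, 'n, 'd) dual_fun \<Rightarrow> ('o, 'm, 'c, 'p, 'n, 'd) dual_fun \<Rightarrow>
   ('o \<Rightarrow> 'n) \<Rightarrow> bool" where
  "duality_natural A B F F' \<alpha> \<longleftrightarrow>
     duality_functor A B F \<and> duality_functor A B F' \<and>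
     two_natural (Und A) (Und B) (Fun F) (Fun F') \<alpha> \<and>
     (\<forall>x\<in>Ob (Und A).
        let D = FunO (Inv A); E = FunO (Inv B); H = FunO (Fun F); H' = FunO (Fun F') in
        CompO (Und B) (E (H x)) (H (D x)) (H' (D x)) (\<alpha> (D x)) (Cns F x) =
        CompO (Und B) (E (H x)) (E (H' x)) (H' (D x))
          (Cns F' x) (Fun1 (Inv B) (H x) (H' x) (\<alpha> x)))"

definition id_dual_fun :: "('o, 'm, 'c) dual_twocat \<Rightarrow> ('o, 'm, 'c, 'o, 'm, 'c) dual_fun" where
  "id_dual_fun A = \<lparr>
     Fun = id_two_fun (Und A),
     Cns = (\<lambda>x. if x \<in> Ob (Und A) then One (Und A) (FunO (Inv A) x) else undefined)\<rparr>"

text \<open>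
  The constraint of \<open>G \<circ> F\<close> at \<open>x\<close> is the composite
  \<open>(G(F x))\<degree> \<rightarrow> G((F x)\<degree>) \<rightarrow> G(F(x\<degree>))\<close>.
\<close>

definition comp_dual_fun ::
  "('o, 'm, 'c) dual_twocat \<Rightarrow> ('p, 'n, 'd) dual_twocat \<Rightarrow> ('q, 'k, 'e) dual_twocat \<Rightarrow>
   ('p, 'n, 'd, 'q, 'k, 'e) dual_fun \<Rightarrow> ('o, 'm, 'c, 'p, 'n, 'd) dual_fun \<Rightarrow>
   ('o, 'm, 'c, 'q, 'k, 'e) dual_fun" where
  "comp_dual_fun A B C G F = \<lparr>
     Fun = comp_two_fun (Und A) (Fun G) (Fun F),
     Cns = (\<lambda>x. if x \<in> Ob (Und A)
       then let H = FunO (Fun F); K = FunO (Fun G) in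
         CompO (Und C)
           (FunO (Inv C) (K (H x))) (K (FunO (Inv B) (H x))) (K (H (FunO (Inv A) x)))
           (Fun1 (Fun G) (FunO (Inv B) (H x)) (H (FunO (Inv A) x)) (Cns F x))
           (Cns G (H x))
       else undefined)\<rparr>"

definition duality_hom ::
  "('o, 'm, 'c) dual_twocat \<Rightarrow> ('p, 'n, 'd) dual_twocat \<Rightarrow>
   (('o, 'm, 'c, 'p, 'n, 'd) dual_fun,
    (('o, 'm, 'c, 'p, 'n, 'd) dual_fun, 'o, 'n) transf) cat" where
  "duality_hom A B = \<lparr>
     Obj = {F. duality_functor A B F},
     Arr = {\<alpha>. duality_natural A B (Src \<alpha>) (Tgt \<alpha>) (Cpt \<alpha>)},
     Dom = Src,
     Cod = Tgt,
     Idn = (\<lambda>F. \<lparr>Src = F, Tgt = F,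
       Cpt = (\<lambda>x. if x \<in> Ob (Und A) then One (Und B) (FunO (Fun F) x) else undefined)\<rparr>),
     Cmp = (\<lambda>\<beta> \<alpha>. \<lparr>Src = Src \<alpha>, Tgt = Tgt \<beta>,
       Cpt = (\<lambda>x. if x \<in> Ob (Und A)
         then CompO (Und B)
           (FunO (Fun (Src \<alpha>)) x) (FunO (Fun (Tgt \<alpha>)) x) (FunO (Fun (Tgt \<beta>)) x)
           (Cpt \<beta> x) (Cpt \<alpha> x)
         else undefined)\<rparr>)\<rparr>"

text \<open>
  For \<open>\<alpha> : F \<rightarrow> F'\<close> and \<open>\<beta> : G \<rightarrow> G'\<close>, the horizontal composite \<open>G F \<rightarrow> G' F'\<close> has
  component \<open>\<beta>(F' x) \<circ> G(\<alpha> x)\<close> at \<open>x\<close>.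
\<close>

definition duality_TwoCat ::
  "(('o, 'm, 'c) dual_twocat,
    ('o, 'm, 'c, 'o, 'm, 'c) dual_fun,
    (('o, 'm, 'c, 'o, 'm, 'c) dual_fun, 'o, 'm) transf) twocat" where
  "duality_TwoCat = \<lparr>
     Ob = {A. strong_duality A},
     Hom = duality_hom,
     One = id_dual_fun,
     CompO = comp_dual_fun,
     CompA = (\<lambda>A B C \<beta> \<alpha>. \<lparr>
       Src = comp_dual_fun A B C (Src \<beta>) (Src \<alpha>),
       Tgt = comp_dual_fun A B C (Tgt \<beta>) (Tgt \<alpha>),
       Cpt = (\<lambda>x. if x \<in> Ob (Und A)
         then let a = FunO (Fun (Src \<alpha>)) x; a' = FunO (Fun (Tgt \<alpha>)) x in
           CompO (Und C)
             (FunO (Fun (Src \<beta>)) a) (FunO (Fun (Src \<beta>)) a') (FunO (Fun (Tgt \<beta>)) a')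
             (Cpt \<beta> a') (Fun1 (Fun (Src \<beta>)) a a' (Cpt \<alpha> x))
         else undefined)\<rparr>)\<rparr>"

section \<open>2-categories with contravariance\<close>

datatype variance = Cov | Con

fun vmul :: "variance \<Rightarrow> variance \<Rightarrow> variance" (infixl "\<odot>" 70) where
  "Cov \<odot> v = v"
| "Con \<odot> Cov = Con"
| "Con \<odot> Con = Cov"

fun var_cat :: "variance \<Rightarrow> ('m, 'c) cat \<Rightarrow> ('m, 'c) cat" where
  "var_cat Cov C = C"
| "var_cat Con C = op_cat C"

text \<open>
  The hom-categories of covariant and contravariant morphisms are \<open>CHom A Cov x y\<close> and
  \<open>CHom A Con x y\<close>. The four composition functors are indexed by the variance \<open>v\<close> of the
  second (outer) and \<open>w\<close> of the first (inner) morphism: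
  \<open>A\<^sup>v(y,z) \<times> (A\<^sup>w(x,y))\<^sup>v \<rightarrow> A\<^sup>v\<^sup>w(x,z)\<close>.
\<close>

record ('o, 'm, 'c) contra_twocat =
  COb :: "'o set"
  CHom :: "variance \<Rightarrow> 'o \<Rightarrow> 'o \<Rightarrow> ('m, 'c) cat"
  COne :: "'o \<Rightarrow> 'm"
  CCompO :: "variance \<Rightarrow> variance \<Rightarrow> 'o \<Rightarrow> 'o \<Rightarrow> 'o \<Rightarrow> 'm \<Rightarrow> 'm \<Rightarrow> 'm"
  CCompA :: "variance \<Rightarrow> variance \<Rightarrow> 'o \<Rightarrow> 'o \<Rightarrow> 'o \<Rightarrow> 'c \<Rightarrow> 'c \<Rightarrow> 'c"

locale contra_two_category =
  fixes A :: "('o, 'm, 'c) contra_twocat"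
  assumes hom_category: "\<lbrakk>x \<in> COb A; y \<in> COb A\<rbrakk> \<Longrightarrow> category (CHom A v x y)"
    and one_obj: "x \<in> COb A \<Longrightarrow> COne A x \<in> Obj (CHom A Cov x x)"
    and comp_functor: "\<lbrakk>x \<in> COb A; y \<in> COb A; z \<in> COb A\<rbrakk> \<Longrightarrow>
      cat_functor (prod_cat (CHom A v y z) (var_cat v (CHom A w x y))) (CHom A (v \<odot> w) x z)
        (\<lambda>(g, f). CCompO A v w x y z g f) (\<lambda>(\<beta>, \<alpha>). CCompA A v w x y z \<beta> \<alpha>)"
    and unit_left_obj: "\<lbrakk>x \<in> COb A; y \<in> COb A; f \<in> Obj (CHom A v x y)\<rbrakk> \<Longrightarrow>
      CCompO A Cov v x y y (COne A y) f = f"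
    and unit_left_arr: "\<lbrakk>x \<in> COb A; y \<in> COb A; \<alpha> \<in> Arr (CHom A v x y)\<rbrakk> \<Longrightarrow>
      CCompA A Cov v x y y (Idn (CHom A Cov y y) (COne A y)) \<alpha> = \<alpha>"
    and unit_right_obj: "\<lbrakk>x \<in> COb A; y \<in> COb A; f \<in> Obj (CHom A v x y)\<rbrakk> \<Longrightarrow>
      CCompO A v Cov x x y f (COne A x) = f"
    and unit_right_arr: "\<lbrakk>x \<in> COb A; y \<in> COb A; \<alpha> \<in> Arr (CHom A v x y)\<rbrakk> \<Longrightarrow>
      CCompA A v Cov x x y \<alpha> (Idn (CHom A Cov x x) (COne A x)) = \<alpha>"
    and assoc_obj: "\<lbrakk>a \<in> COb A; b \<in> COb A; c \<in> COb A; d \<in> COb A;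
      f \<in> Obj (CHom A w a b); g \<in> Obj (CHom A v b c); h \<in> Obj (CHom A u c d)\<rbrakk> \<Longrightarrow>
      CCompO A (u \<odot> v) w a b d (CCompO A u v b c d h g) f =
      CCompO A u (v \<odot> w) a c d h (CCompO A v w a b c g f)"
    and assoc_arr: "\<lbrakk>a \<in> COb A; b \<in> COb A; c \<in> COb A; d \<in> COb A;
      \<alpha> \<in> Arr (CHom A w a b); \<beta> \<in> Arr (CHom A v b c); \<gamma> \<in> Arr (CHom A u c d)\<rbrakk> \<Longrightarrow>
      CCompA A (u \<odot> v) w a b d (CCompA A u v b c d \<gamma> \<beta>) \<alpha> =
      CCompA A u (v \<odot> w) a c d \<gamma> (CCompA A v w a b c \<beta> \<alpha>)"

record ('o, 'm, 'c, 'p, 'n, 'd) contra_fun =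
  CFunO :: "'o \<Rightarrow> 'p"
  CFun1 :: "variance \<Rightarrow> 'o \<Rightarrow> 'o \<Rightarrow> 'm \<Rightarrow> 'n"
  CFun2 :: "variance \<Rightarrow> 'o \<Rightarrow> 'o \<Rightarrow> 'c \<Rightarrow> 'd"

locale contra_functor = source: contra_two_category A + target: contra_two_category B
  for A :: "('o, 'm, 'c) contra_twocat" and B :: "('p, 'n, 'd) contra_twocat" +
  fixes F :: "('o, 'm, 'c, 'p, 'n, 'd) contra_fun"
  assumes fun_ob: "x \<in> COb A \<Longrightarrow> CFunO F x \<in> COb B"
    and fun_hom: "\<lbrakk>x \<in> COb A; y \<in> COb A\<rbrakk> \<Longrightarrow>
      cat_functor (CHom A v x y) (CHom B v (CFunO F x) (CFunO F y)) (CFun1 F v x y) (CFun2 F v x y)"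
    and fun_one: "x \<in> COb A \<Longrightarrow> CFun1 F Cov x x (COne A x) = COne B (CFunO F x)"
    and fun_comp_obj: "\<lbrakk>x \<in> COb A; y \<in> COb A; z \<in> COb A;
      f \<in> Obj (CHom A w x y); g \<in> Obj (CHom A v y z)\<rbrakk> \<Longrightarrow>
      CFun1 F (v \<odot> w) x z (CCompO A v w x y z g f) =
        CCompO B v w (CFunO F x) (CFunO F y) (CFunO F z) (CFun1 F v y z g) (CFun1 F w x y f)"
    and fun_comp_arr: "\<lbrakk>x \<in> COb A; y \<in> COb A; z \<in> COb A;
      \<alpha> \<in> Arr (CHom A w x y); \<beta> \<in> Arr (CHom A v y z)\<rbrakk> \<Longrightarrow>
      CFun2 F (v \<odot> w) x z (CCompA A v w x y z \<beta> \<alpha>) =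
        CCompA B v w (CFunO F x) (CFunO F y) (CFunO F z) (CFun2 F v y z \<beta>) (CFun2 F w x y \<alpha>)"
    and ext_ob: "x \<notin> COb A \<Longrightarrow> CFunO F x = undefined"
    and ext_1: "\<not> (x \<in> COb A \<and> y \<in> COb A \<and> f \<in> Obj (CHom A v x y)) \<Longrightarrow>
      CFun1 F v x y f = undefined"
    and ext_2: "\<not> (x \<in> COb A \<and> y \<in> COb A \<and> \<alpha> \<in> Arr (CHom A v x y)) \<Longrightarrow>
      CFun2 F v x y \<alpha> = undefined"

definition id_contra_fun :: "('o, 'm, 'c) contra_twocat \<Rightarrow> ('o, 'm, 'c, 'o, 'm, 'c) contra_fun" where
  "id_contra_fun A = \<lparr>
     CFunO = (\<lambda>x. if x \<in> COb A then x else undefined),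
     CFun1 = (\<lambda>v x y f. if x \<in> COb A \<and> y \<in> COb A \<and> f \<in> Obj (CHom A v x y)
       then f else undefined),
     CFun2 = (\<lambda>v x y \<alpha>. if x \<in> COb A \<and> y \<in> COb A \<and> \<alpha> \<in> Arr (CHom A v x y)
       then \<alpha> else undefined)\<rparr>"

definition comp_contra_fun ::
  "('o, 'm, 'c) contra_twocat \<Rightarrow> ('p, 'n, 'd, 'q, 'k, 'e) contra_fun \<Rightarrow>
   ('o, 'm, 'c, 'p, 'n, 'd) contra_fun \<Rightarrow> ('o, 'm, 'c, 'q, 'k, 'e) contra_fun" where
  "comp_contra_fun A G F = \<lparr>
     CFunO = (\<lambda>x. if x \<in> COb A then CFunO G (CFunO F x) else undefined),
     CFun1 = (\<lambda>v x y f. if x \<in> COb A \<and> y \<in> COb A \<and> f \<in> Obj (CHom A v x y)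
       then CFun1 G v (CFunO F x) (CFunO F y) (CFun1 F v x y f) else undefined),
     CFun2 = (\<lambda>v x y \<alpha>. if x \<in> COb A \<and> y \<in> COb A \<and> \<alpha> \<in> Arr (CHom A v x y)
       then CFun2 G v (CFunO F x) (CFunO F y) (CFun2 F v x y \<alpha>) else undefined)\<rparr>"

locale contra_natural = F: contra_functor A B F + F': contra_functor A B F'
  for A :: "('o, 'm, 'c) contra_twocat" and B :: "('p, 'n, 'd) contra_twocat" and F F' +
  fixes \<alpha> :: "'o \<Rightarrow> 'n"
  assumes cpt_obj: "x \<in> COb A \<Longrightarrow> \<alpha> x \<in> Obj (CHom B Cov (CFunO F x) (CFunO F' x))"
    and naturality_obj: "\<lbrakk>x \<in> COb A; y \<in> COb A; f \<in> Obj (CHom A v x y)\<rbrakk> \<Longrightarrow>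
      CCompO B Cov v (CFunO F x) (CFunO F y) (CFunO F' y) (\<alpha> y) (CFun1 F v x y f) =
      CCompO B v Cov (CFunO F x) (CFunO F' x) (CFunO F' y) (CFun1 F' v x y f) (\<alpha> x)"
    and naturality_arr: "\<lbrakk>x \<in> COb A; y \<in> COb A; \<mu> \<in> Arr (CHom A v x y)\<rbrakk> \<Longrightarrow>
      CCompA B Cov v (CFunO F x) (CFunO F y) (CFunO F' y)
        (Idn (CHom B Cov (CFunO F y) (CFunO F' y)) (\<alpha> y)) (CFun2 F v x y \<mu>) =
      CCompA B v Cov (CFunO F x) (CFunO F' x) (CFunO F' y)
        (CFun2 F' v x y \<mu>) (Idn (CHom B Cov (CFunO F x) (CFunO F' x)) (\<alpha> x))"
    and ext_cpt: "x \<notin> COb A \<Longrightarrow> \<alpha> x = undefined"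

definition strict_opposite :: "('o, 'm, 'c) contra_twocat \<Rightarrow> 'o \<Rightarrow> 'o \<Rightarrow> 'm \<Rightarrow> bool" where
  "strict_opposite A x x' \<chi> \<longleftrightarrow>
     x' \<in> COb A \<and> \<chi> \<in> Obj (CHom A Con x x') \<and>
     (\<forall>y\<in>COb A.
        cat_isomorphism (CHom A Cov x' y) (CHom A Con x y)
          (\<lambda>f. CCompO A Cov Con x x' y f \<chi>)
          (\<lambda>\<mu>. CCompA A Cov Con x x' y \<mu> (Idn (CHom A Con x x') \<chi>)) \<and>
        cat_isomorphism (CHom A Con x' y) (CHom A Cov x y)
          (\<lambda>f. CCompO A Con Con x x' y f \<chi>)
          (\<lambda>\<mu>. CCompA A Con Con x x' y \<mu> (Idn (CHom A Con x x') \<chi>)))"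

definition has_strict_opposites :: "('o, 'm, 'c) contra_twocat \<Rightarrow> bool" where
  "has_strict_opposites A \<longleftrightarrow> (\<forall>x\<in>COb A. \<exists>x' \<chi>. strict_opposite A x x' \<chi>)"

definition contra_hom ::
  "('o, 'm, 'c) contra_twocat \<Rightarrow> ('p, 'n, 'd) contra_twocat \<Rightarrow>
   (('o, 'm, 'c, 'p, 'n, 'd) contra_fun,
    (('o, 'm, 'c, 'p, 'n, 'd) contra_fun, 'o, 'n) transf) cat" where
  "contra_hom A B = \<lparr>
     Obj = {F. contra_functor A B F},
     Arr = {\<alpha>. contra_natural A B (Src \<alpha>) (Tgt \<alpha>) (Cpt \<alpha>)},
     Dom = Src,
     Cod = Tgt,
     Idn = (\<lambda>F. \<lparr>Src = F, Tgt = F,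
       Cpt = (\<lambda>x. if x \<in> COb A then COne B (CFunO F x) else undefined)\<rparr>),
     Cmp = (\<lambda>\<beta> \<alpha>. \<lparr>Src = Src \<alpha>, Tgt = Tgt \<beta>,
       Cpt = (\<lambda>x. if x \<in> COb A
         then CCompO B Cov Cov
           (CFunO (Src \<alpha>) x) (CFunO (Tgt \<alpha>) x) (CFunO (Tgt \<beta>) x)
           (Cpt \<beta> x) (Cpt \<alpha> x)
         else undefined)\<rparr>)\<rparr>"

definition contra_TwoCat ::
  "(('o, 'm, 'c) contra_twocat,
    ('o, 'm, 'c, 'o, 'm, 'c) contra_fun,
    (('o, 'm, 'c, 'o, 'm, 'c) contra_fun, 'o, 'm) transf) twocat" where
  "contra_TwoCat = \<lparr>
     Ob = {A. contra_two_category A \<and> has_strict_opposites A},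
     Hom = contra_hom,
     One = id_contra_fun,
     CompO = (\<lambda>A B C. comp_contra_fun A),
     CompA = (\<lambda>A B C \<beta> \<alpha>. \<lparr>
       Src = comp_contra_fun A (Src \<beta>) (Src \<alpha>),
       Tgt = comp_contra_fun A (Tgt \<beta>) (Tgt \<alpha>),
       Cpt = (\<lambda>x. if x \<in> COb A
         then let a = CFunO (Src \<alpha>) x; a' = CFunO (Tgt \<alpha>) x in
           CCompO C Cov Cov
             (CFunO (Src \<beta>) a) (CFunO (Src \<beta>) a') (CFunO (Tgt \<beta>) a')
             (Cpt \<beta> a') (CFun1 (Src \<beta>) Cov a a' (Cpt \<alpha> x))
         else undefined)\<rparr>)\<rparr>"

end

(*
  From a 2-category A with a strong duality involution one gets a 2-category with contravariance
  by A^+(x,y) = A(x,y) and A^-(x,y) = A(x^o,y), where g in A^-(y,z) is composed with f after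
  applying (-)^o to f, and with the unit x -> x^oo when both are contravariant. The identity of x^o,
  seen as a contravariant morphism chi_x : x -> x^o, is invertible, and a contravariant morphism is
  a strict opposite exactly when it is invertible.

  A duality 2-functor (F, i) acts on A^-(x,y) by f |-> F(f) i_x; conversely i_x is recovered as the
  image of chi_x, so this is a bijection onto the functors preserving contravariance. On 2-cells the
  components do not change. Hence the construction is bijective on 1-cells and on 2-cells, and the
  2-category axioms on the duality side are reflected from the contravariance side.

  Finally, if every x has an invertible chi_x : x -> x^o, then f^o = chi_y f chi_x^{-1} with unit
  chi_{x^o} chi_x is a strong duality involution on the covariant part, and f |-> f chi_x is an
  isomorphism from the 2-category with contravariance it generates to the given one.
*)

theory Submission
  imports Defs
begin

text \<open>Three decisions shape the argument. Variances form the two-element group, and an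
  involution is treated as a pseudo action of it: \<open>dob\<close>, \<open>dmap1\<close> and
  \<open>dmap2\<close> act, \<open>dcmp\<close> compares acting by a product with acting twice, and
  \<open>dcns\<close> compares the actions on the two sides of a duality 2-functor. The four
  compositions then share one formula, the eight associativity laws need one cocycle equation, and
  the axioms on the unit and on the constraint are the only nontrivial cases of
  \<open>dcmp_cocycle\<close> and \<open>dcns_coherence\<close>. Next, most equations between
  1-cells are read off from their identity 2-cells, so that verifications take place on 2-cells.
  Finally, maps are \<open>undefined\<close> off the carriers, so the passage from (F, i) to a
  functor preserving contravariance is a bijection on the nose, and the inverse 2-functor can be
  made strict by conjugating with chosen isomorphisms. On objects only isomorphism can be expected:
  the generated structure has A^+(x^o,y) in place of A^-(x,y).\<close>

lemma op_cat_simps [simp]: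
  "Obj (op_cat C) = Obj C" "Arr (op_cat C) = Arr C" "Dom (op_cat C) = Cod C"
  "Cod (op_cat C) = Dom C" "Idn (op_cat C) = Idn C" "Cmp (op_cat C) g f = Cmp C f g"
  by (simp_all add: op_cat_def)

lemma prod_cat_simps [simp]:
  "Obj (prod_cat C D) = Obj C \<times> Obj D" "Arr (prod_cat C D) = Arr C \<times> Arr D"
  "Dom (prod_cat C D) = map_prod (Dom C) (Dom D)" "Cod (prod_cat C D) = map_prod (Cod C) (Cod D)"
  "Idn (prod_cat C D) = map_prod (Idn C) (Idn D)"
  "Cmp (prod_cat C D) (g, k) (f, h) = (Cmp C g f, Cmp D k h)"
  by (simp_all add: prod_cat_def)

lemma var_cat_simps [simp]:
  "Obj (var_cat v C) = Obj C" "Arr (var_cat v C) = Arr C" "Idn (var_cat v C) = Idn C"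
  by (cases v; simp)+

lemma category_op_cat: "category C \<Longrightarrow> category (op_cat C)"
  unfolding category_def by simp

lemma category_var_cat: "category C \<Longrightarrow> category (var_cat v C)"
  by (cases v) (simp_all add: category_op_cat)

lemma category_prod_cat: "category C \<Longrightarrow> category D \<Longrightarrow> category (prod_cat C D)"
  unfolding category_def by auto

text \<open>The domain of an identity recovers its object. This is how equations between 1-cells are
  later extracted from equations between identity 2-cells.\<close>

lemma category_idn_inject:
  "category C \<Longrightarrow> a \<in> Obj C \<Longrightarrow> b \<in> Obj C \<Longrightarrow> Idn C a = Idn C b \<Longrightarrow> a = b"
  by (metis category.dom_idn)

lemma category_cmp_idn_idn:
  "category C \<Longrightarrow> a \<in> Obj C \<Longrightarrow> Cmp C (Idn C a) (Idn C a) = Idn C a"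
  by (metis category.cmp_idn_left category.cod_idn category.idn_arr)

lemma vmul_Cov [simp]: "v \<odot> Cov = v"
  by (cases v) simp_all

lemma vmul_assoc [simp]: "(u \<odot> v) \<odot> w = u \<odot> (v \<odot> w)"
  by (cases u; cases v; cases w) simp_all

section \<open>The 2-category of 2-categories with contravariance\<close>

context contra_two_category
begin

text \<open>The copies for \<open>var_cat w\<close> are there because the inner argument of a
  composition functor lives in a hom-category twisted by the outer variance; as long as that
  variance is a variable, the twist cannot be evaluated.\<close>

lemma hom_simps [simp]:
  assumes "x \<in> COb A" "y \<in> COb A"
  shows "f \<in> Arr (CHom A v x y) \<Longrightarrow> Dom (CHom A v x y) f \<in> Obj (CHom A v x y)"
    and "f \<in> Arr (CHom A v x y) \<Longrightarrow> Cod (CHom A v x y) f \<in> Obj (CHom A v x y)"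
    and "f \<in> Arr (CHom A v x y) \<Longrightarrow> Dom (var_cat w (CHom A v x y)) f \<in> Obj (CHom A v x y)"
    and "f \<in> Arr (CHom A v x y) \<Longrightarrow> Cod (var_cat w (CHom A v x y)) f \<in> Obj (CHom A v x y)"
    and "a \<in> Obj (CHom A v x y) \<Longrightarrow> Idn (CHom A v x y) a \<in> Arr (CHom A v x y)"
    and "a \<in> Obj (CHom A v x y) \<Longrightarrow> Dom (CHom A v x y) (Idn (CHom A v x y) a) = a"
    and "a \<in> Obj (CHom A v x y) \<Longrightarrow> Cod (CHom A v x y) (Idn (CHom A v x y) a) = a"
    and "a \<in> Obj (CHom A v x y) \<Longrightarrow> Dom (var_cat w (CHom A v x y)) (Idn (CHom A v x y) a) = a"
    and "a \<in> Obj (CHom A v x y) \<Longrightarrow> Cod (var_cat w (CHom A v x y)) (Idn (CHom A v x y) a) = a"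
    and "a \<in> Obj (CHom A v x y) \<Longrightarrow> Cmp (CHom A v x y) (Idn (CHom A v x y) a) (Idn (CHom A v x y) a)
      = Idn (CHom A v x y) a"
    and "\<lbrakk>f \<in> Arr (CHom A v x y); g \<in> Arr (CHom A v x y);
      Dom (CHom A v x y) g = Cod (CHom A v x y) f\<rbrakk> \<Longrightarrow>
      Cmp (CHom A v x y) g f \<in> Arr (CHom A v x y)"
    and "\<lbrakk>f \<in> Arr (CHom A v x y); g \<in> Arr (CHom A v x y);
      Dom (CHom A v x y) g = Cod (CHom A v x y) f\<rbrakk> \<Longrightarrow>
      Dom (CHom A v x y) (Cmp (CHom A v x y) g f) = Dom (CHom A v x y) f"
    and "\<lbrakk>f \<in> Arr (CHom A v x y); g \<in> Arr (CHom A v x y);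
      Dom (CHom A v x y) g = Cod (CHom A v x y) f\<rbrakk> \<Longrightarrow>
      Cod (CHom A v x y) (Cmp (CHom A v x y) g f) = Cod (CHom A v x y) g"
  using category.dom_obj[OF hom_category[OF assms]]
    category.cod_obj[OF hom_category[OF assms]]
    category.idn_arr[OF hom_category[OF assms]]
    category.dom_idn[OF hom_category[OF assms]]
    category.cod_idn[OF hom_category[OF assms]]
    category.dom_obj[OF category_var_cat[OF hom_category[OF assms]]]
    category.cod_obj[OF category_var_cat[OF hom_category[OF assms]]]
    category.dom_idn[OF category_var_cat[OF hom_category[OF assms]]]
    category.cod_idn[OF category_var_cat[OF hom_category[OF assms]]]
    category.cmp_arr[OF hom_category[OF assms]]
    category.dom_cmp[OF hom_category[OF assms]]
    category.cod_cmp[OF hom_category[OF assms]]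
    category_cmp_idn_idn[OF hom_category[OF assms]]
  by auto

declare one_obj [simp]

lemma comp_simps [simp]:
  assumes "x \<in> COb A" "y \<in> COb A" "z \<in> COb A" "u = v \<odot> w"
  shows "\<lbrakk>g \<in> Obj (CHom A v y z); f \<in> Obj (CHom A w x y)\<rbrakk> \<Longrightarrow>
      CCompO A v w x y z g f \<in> Obj (CHom A u x z)"
    and "\<lbrakk>\<beta> \<in> Arr (CHom A v y z); \<alpha> \<in> Arr (CHom A w x y)\<rbrakk> \<Longrightarrow>
      CCompA A v w x y z \<beta> \<alpha> \<in> Arr (CHom A u x z)"
    and "\<lbrakk>\<beta> \<in> Arr (CHom A v y z); \<alpha> \<in> Arr (CHom A w x y)\<rbrakk> \<Longrightarrow>
      Dom (CHom A u x z) (CCompA A v w x y z \<beta> \<alpha>) =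
        CCompO A v w x y z (Dom (CHom A v y z) \<beta>) (Dom (var_cat v (CHom A w x y)) \<alpha>)"
    and "\<lbrakk>\<beta> \<in> Arr (CHom A v y z); \<alpha> \<in> Arr (CHom A w x y)\<rbrakk> \<Longrightarrow>
      Cod (CHom A u x z) (CCompA A v w x y z \<beta> \<alpha>) =
        CCompO A v w x y z (Cod (CHom A v y z) \<beta>) (Cod (var_cat v (CHom A w x y)) \<alpha>)"
    and "\<lbrakk>g \<in> Obj (CHom A v y z); f \<in> Obj (CHom A w x y)\<rbrakk> \<Longrightarrow>
      Idn (CHom A u x z) (CCompO A v w x y z g f) =
        CCompA A v w x y z (Idn (CHom A v y z) g) (Idn (CHom A w x y) f)"
  using cat_functor.map_obj[OF comp_functor[OF assms(1-3)], of "(g, f)" v w]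
    cat_functor.map_arr[OF comp_functor[OF assms(1-3)], of "(\<beta>, \<alpha>)" v w]
    cat_functor.map_dom[OF comp_functor[OF assms(1-3)], of "(\<beta>, \<alpha>)" v w]
    cat_functor.map_cod[OF comp_functor[OF assms(1-3)], of "(\<beta>, \<alpha>)" v w]
    cat_functor.map_idn[OF comp_functor[OF assms(1-3)], of "(g, f)" v w] assms(4)
  by simp_all

text \<open>For \<open>v = Con\<close> the inner 2-cells are composed in the opposite category, so
  \<alpha> comes after \<alpha>' in the hom-category itself.\<close>

lemma interchange:
  assumes "x \<in> COb A" "y \<in> COb A" "z \<in> COb A" "u = v \<odot> w"
    "\<beta> \<in> Arr (CHom A v y z)" "\<beta>' \<in> Arr (CHom A v y z)"
    "\<alpha> \<in> Arr (CHom A w x y)" "\<alpha>' \<in> Arr (CHom A w x y)"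
    "Dom (CHom A v y z) \<beta>' = Cod (CHom A v y z) \<beta>"
    "Dom (var_cat v (CHom A w x y)) \<alpha>' = Cod (var_cat v (CHom A w x y)) \<alpha>"
  shows "CCompA A v w x y z (Cmp (CHom A v y z) \<beta>' \<beta>) (Cmp (var_cat v (CHom A w x y)) \<alpha>' \<alpha>) =
    Cmp (CHom A u x z) (CCompA A v w x y z \<beta>' \<alpha>') (CCompA A v w x y z \<beta> \<alpha>)"
proof -
  interpret cat_functor "prod_cat (CHom A v y z) (var_cat v (CHom A w x y))" "CHom A (v \<odot> w) x z"
        "\<lambda>(g, f). CCompO A v w x y z g f" "\<lambda>(\<beta>, \<alpha>). CCompA A v w x y z \<beta> \<alpha>"
    by (rule comp_functor) fact+
  show ?thesis
    using map_cmp[of "(\<beta>, \<alpha>)" "(\<beta>', \<alpha>')"] assms by simp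
qed

lemma unit_simps [simp]:
  assumes "x \<in> COb A" "y \<in> COb A"
  shows "f \<in> Obj (CHom A v x y) \<Longrightarrow> CCompO A Cov v x y y (COne A y) f = f"
    and "\<alpha> \<in> Arr (CHom A v x y) \<Longrightarrow>
      CCompA A Cov v x y y (Idn (CHom A Cov y y) (COne A y)) \<alpha> = \<alpha>"
    and "f \<in> Obj (CHom A v x y) \<Longrightarrow> CCompO A v Cov x x y f (COne A x) = f"
    and "\<alpha> \<in> Arr (CHom A v x y) \<Longrightarrow>
      CCompA A v Cov x x y \<alpha> (Idn (CHom A Cov x x) (COne A x)) = \<alpha>"
  using assms by (simp_all add: unit_left_obj unit_left_arr unit_right_obj unit_right_arr)

text \<open>The premise \<open>t = u \<odot> v\<close> lets these rewrite after concrete variances have been multiplied.\<close>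

lemma assocs [simp]:
  assumes "a \<in> COb A" "b \<in> COb A" "c \<in> COb A" "d \<in> COb A" "t = u \<odot> v"
  shows "\<lbrakk>f \<in> Obj (CHom A w a b); g \<in> Obj (CHom A v b c); h \<in> Obj (CHom A u c d)\<rbrakk> \<Longrightarrow>
      CCompO A t w a b d (CCompO A u v b c d h g) f =
      CCompO A u (v \<odot> w) a c d h (CCompO A v w a b c g f)"
    and "\<lbrakk>\<alpha> \<in> Arr (CHom A w a b); \<beta> \<in> Arr (CHom A v b c); \<gamma> \<in> Arr (CHom A u c d)\<rbrakk> \<Longrightarrow>
      CCompA A t w a b d (CCompA A u v b c d \<gamma> \<beta>) \<alpha> =
      CCompA A u (v \<odot> w) a c d \<gamma> (CCompA A v w a b c \<beta> \<alpha>)"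
  using assms by (simp_all add: assoc_obj assoc_arr)

end

text \<open>Equations between 1-cells are instances, at identity 2-cells, of those between 2-cells.\<close>

lemma contra_two_categoryI:
  fixes A :: "('o, 'm, 'c) contra_twocat"
  assumes hom: "\<And>v x y. \<lbrakk>x \<in> COb A; y \<in> COb A\<rbrakk> \<Longrightarrow> category (CHom A v x y)"
    and one: "\<And>x. x \<in> COb A \<Longrightarrow> COne A x \<in> Obj (CHom A Cov x x)"
    and comp: "\<And>v w x y z. \<lbrakk>x \<in> COb A; y \<in> COb A; z \<in> COb A\<rbrakk> \<Longrightarrow>
      cat_functor (prod_cat (CHom A v y z) (var_cat v (CHom A w x y))) (CHom A (v \<odot> w) x z)
        (\<lambda>(g, f). CCompO A v w x y z g f) (\<lambda>(\<beta>, \<alpha>). CCompA A v w x y z \<beta> \<alpha>)"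
    and unit_left: "\<And>v x y \<alpha>. \<lbrakk>x \<in> COb A; y \<in> COb A; \<alpha> \<in> Arr (CHom A v x y)\<rbrakk> \<Longrightarrow>
      CCompA A Cov v x y y (Idn (CHom A Cov y y) (COne A y)) \<alpha> = \<alpha>"
    and unit_right: "\<And>v x y \<alpha>. \<lbrakk>x \<in> COb A; y \<in> COb A; \<alpha> \<in> Arr (CHom A v x y)\<rbrakk> \<Longrightarrow>
      CCompA A v Cov x x y \<alpha> (Idn (CHom A Cov x x) (COne A x)) = \<alpha>"
    and assoc: "\<And>u v w a b c d \<alpha> \<beta> \<gamma>. \<lbrakk>a \<in> COb A; b \<in> COb A; c \<in> COb A; d \<in> COb A;
      \<alpha> \<in> Arr (CHom A w a b); \<beta> \<in> Arr (CHom A v b c); \<gamma> \<in> Arr (CHom A u c d)\<rbrakk> \<Longrightarrow>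
      CCompA A (u \<odot> v) w a b d (CCompA A u v b c d \<gamma> \<beta>) \<alpha> =
      CCompA A u (v \<odot> w) a c d \<gamma> (CCompA A v w a b c \<beta> \<alpha>)"
  shows "contra_two_category A"
proof -
  have idn: "Idn (CHom A (v \<odot> w) x z) (CCompO A v w x y z g f) =
      CCompA A v w x y z (Idn (CHom A v y z) g) (Idn (CHom A w x y) f)"
    and obj: "CCompO A v w x y z g f \<in> Obj (CHom A (v \<odot> w) x z)"
    if "x \<in> COb A" "y \<in> COb A" "z \<in> COb A" "g \<in> Obj (CHom A v y z)" "f \<in> Obj (CHom A w x y)"
    for v w x y z g f
    using cat_functor.map_idn[OF comp, of x y z "(g, f)" v w]
      cat_functor.map_obj[OF comp, of x y z "(g, f)" v w] that by simp_all
  note arr = category.idn_arr[OF hom]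
  show ?thesis
  proof (rule contra_two_category.intro)
    show "CCompO A Cov v x y y (COne A y) f = f"
      if "x \<in> COb A" "y \<in> COb A" "f \<in> Obj (CHom A v x y)" for v x y f
      using that idn[of x y y "COne A y" Cov f v] obj[of x y y "COne A y" Cov f v]
      by (intro category_idn_inject[OF hom, of x y _ v]) (simp_all add: one unit_left arr)
    show "CCompO A v Cov x x y f (COne A x) = f"
      if "x \<in> COb A" "y \<in> COb A" "f \<in> Obj (CHom A v x y)" for v x y f
      using that idn[of x x y f v "COne A x" Cov] obj[of x x y f v "COne A x" Cov]
      by (intro category_idn_inject[OF hom, of x y _ v]) (simp_all add: one unit_right arr)
    show "CCompO A (u \<odot> v) w a b d (CCompO A u v b c d h g) f =
        CCompO A u (v \<odot> w) a c d h (CCompO A v w a b c g f)"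
      if ob: "a \<in> COb A" "b \<in> COb A" "c \<in> COb A" "d \<in> COb A"
        and ce: "f \<in> Obj (CHom A w a b)" "g \<in> Obj (CHom A v b c)" "h \<in> Obj (CHom A u c d)"
      for u v w a b c d f g h
    proof (rule category_idn_inject[OF hom, of a d _ "u \<odot> v \<odot> w"])
      show "CCompO A (u \<odot> v) w a b d (CCompO A u v b c d h g) f \<in> Obj (CHom A (u \<odot> v \<odot> w) a d)"
        using that by (intro obj) auto
      show "CCompO A u (v \<odot> w) a c d h (CCompO A v w a b c g f) \<in> Obj (CHom A (u \<odot> v \<odot> w) a d)"
        using obj[of a c d h u "CCompO A v w a b c g f" "v \<odot> w"] obj[of a b c g v f w] that
        by simp
      have "Idn (CHom A (u \<odot> v \<odot> w) a d) (CCompO A (u \<odot> v) w a b d (CCompO A u v b c d h g) f)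
        = CCompA A (u \<odot> v) w a b d (CCompA A u v b c d (Idn (CHom A u c d) h) (Idn (CHom A v b c) g))
            (Idn (CHom A w a b) f)"
        \<comment> \<open>Reassociating the signs here would keep \<open>idn\<close> from matching
          the outer composite, whose outer variance is \<open>u \<odot> v\<close>.\<close>
        using that by (simp add: idn obj del: vmul_assoc)
      also have "\<dots> = CCompA A u (v \<odot> w) a c d (Idn (CHom A u c d) h)
          (CCompA A v w a b c (Idn (CHom A v b c) g) (Idn (CHom A w a b) f))"
        using that by (intro assoc) (auto intro: arr)
      also have "\<dots> = Idn (CHom A (u \<odot> (v \<odot> w)) a d)
          (CCompO A u (v \<odot> w) a c d h (CCompO A v w a b c g f))"
        using that by (simp add: idn obj)
      finally show "Idn (CHom A (u \<odot> v \<odot> w) a d)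
          (CCompO A (u \<odot> v) w a b d (CCompO A u v b c d h g) f) =
        Idn (CHom A (u \<odot> v \<odot> w) a d) (CCompO A u (v \<odot> w) a c d h (CCompO A v w a b c g f))"
        by simp
    qed (use that in auto)
  qed (rule hom one comp unit_left unit_right assoc; assumption)+
qed

section \<open>2-functors preserving contravariance\<close>

context contra_functor
begin

declare fun_ob [simp] fun_one [simp]

lemma fun_simps [simp]:
  assumes "x \<in> COb A" "y \<in> COb A"
  shows "f \<in> Obj (CHom A v x y) \<Longrightarrow> CFun1 F v x y f \<in> Obj (CHom B v (CFunO F x) (CFunO F y))"
    and "\<alpha> \<in> Arr (CHom A v x y) \<Longrightarrow> CFun2 F v x y \<alpha> \<in> Arr (CHom B v (CFunO F x) (CFunO F y))"
    and "\<alpha> \<in> Arr (CHom A v x y) \<Longrightarrow> Dom (CHom B v (CFunO F x) (CFunO F y)) (CFun2 F v x y \<alpha>) =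
      CFun1 F v x y (Dom (CHom A v x y) \<alpha>)"
    and "\<alpha> \<in> Arr (CHom A v x y) \<Longrightarrow> Cod (CHom B v (CFunO F x) (CFunO F y)) (CFun2 F v x y \<alpha>) =
      CFun1 F v x y (Cod (CHom A v x y) \<alpha>)"
    and "\<alpha> \<in> Arr (CHom A v x y) \<Longrightarrow>
      Dom (var_cat w (CHom B v (CFunO F x) (CFunO F y))) (CFun2 F v x y \<alpha>) =
      CFun1 F v x y (Dom (var_cat w (CHom A v x y)) \<alpha>)"
    and "\<alpha> \<in> Arr (CHom A v x y) \<Longrightarrow>
      Cod (var_cat w (CHom B v (CFunO F x) (CFunO F y))) (CFun2 F v x y \<alpha>) =
      CFun1 F v x y (Cod (var_cat w (CHom A v x y)) \<alpha>)"
    and "f \<in> Obj (CHom A v x y) \<Longrightarrow> CFun2 F v x y (Idn (CHom A v x y) f) =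
      Idn (CHom B v (CFunO F x) (CFunO F y)) (CFun1 F v x y f)"
    and "\<lbrakk>\<alpha> \<in> Arr (CHom A v x y); \<beta> \<in> Arr (CHom A v x y);
      Dom (CHom A v x y) \<beta> = Cod (CHom A v x y) \<alpha>\<rbrakk> \<Longrightarrow>
      CFun2 F v x y (Cmp (CHom A v x y) \<beta> \<alpha>) =
      Cmp (CHom B v (CFunO F x) (CFunO F y)) (CFun2 F v x y \<beta>) (CFun2 F v x y \<alpha>)"
  using cat_functor.map_obj[OF fun_hom[OF assms]]
    cat_functor.map_arr[OF fun_hom[OF assms]]
    cat_functor.map_dom[OF fun_hom[OF assms]]
    cat_functor.map_cod[OF fun_hom[OF assms]]
    cat_functor.map_idn[OF fun_hom[OF assms]]
    cat_functor.map_cmp[OF fun_hom[OF assms]]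
  by (cases w; simp)+

lemma fun_comps [simp]:
  assumes "x \<in> COb A" "y \<in> COb A" "z \<in> COb A" "u = v \<odot> w"
  shows "\<lbrakk>f \<in> Obj (CHom A w x y); g \<in> Obj (CHom A v y z)\<rbrakk> \<Longrightarrow>
      CFun1 F u x z (CCompO A v w x y z g f) =
        CCompO B v w (CFunO F x) (CFunO F y) (CFunO F z) (CFun1 F v y z g) (CFun1 F w x y f)"
    and "\<lbrakk>\<alpha> \<in> Arr (CHom A w x y); \<beta> \<in> Arr (CHom A v y z)\<rbrakk> \<Longrightarrow>
      CFun2 F u x z (CCompA A v w x y z \<beta> \<alpha>) =
        CCompA B v w (CFunO F x) (CFunO F y) (CFunO F z) (CFun2 F v y z \<beta>) (CFun2 F w x y \<alpha>)"
  using assms by (simp_all add: fun_comp_obj fun_comp_arr)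

end

text \<open>Preservation of composites of 1-cells is the premise \<open>comp\<close> at identity
  2-cells, which \<open>F\<close> and the composition functors preserve, followed by injectivity of
  \<open>Idn\<close>.\<close>

lemma contra_functorI:
  fixes F :: "('o, 'm, 'c, 'p, 'n, 'd) contra_fun"
  assumes A: "contra_two_category A" and B: "contra_two_category B"
    and ob: "\<And>x. x \<in> COb A \<Longrightarrow> CFunO F x \<in> COb B"
    and hom: "\<And>v x y. \<lbrakk>x \<in> COb A; y \<in> COb A\<rbrakk> \<Longrightarrow>
      cat_functor (CHom A v x y) (CHom B v (CFunO F x) (CFunO F y)) (CFun1 F v x y) (CFun2 F v x y)"
    and one: "\<And>x. x \<in> COb A \<Longrightarrow> CFun1 F Cov x x (COne A x) = COne B (CFunO F x)"
    and comp: "\<And>v w x y z \<alpha> \<beta>. \<lbrakk>x \<in> COb A; y \<in> COb A; z \<in> COb A;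
      \<alpha> \<in> Arr (CHom A w x y); \<beta> \<in> Arr (CHom A v y z)\<rbrakk> \<Longrightarrow>
      CFun2 F (v \<odot> w) x z (CCompA A v w x y z \<beta> \<alpha>) =
        CCompA B v w (CFunO F x) (CFunO F y) (CFunO F z) (CFun2 F v y z \<beta>) (CFun2 F w x y \<alpha>)"
    and ext: "\<And>x. x \<notin> COb A \<Longrightarrow> CFunO F x = undefined"
      "\<And>v x y f. \<not> (x \<in> COb A \<and> y \<in> COb A \<and> f \<in> Obj (CHom A v x y)) \<Longrightarrow>
        CFun1 F v x y f = undefined"
      "\<And>v x y \<alpha>. \<not> (x \<in> COb A \<and> y \<in> COb A \<and> \<alpha> \<in> Arr (CHom A v x y)) \<Longrightarrow>
        CFun2 F v x y \<alpha> = undefined"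
  shows "contra_functor A B F"
proof -
  interpret A: contra_two_category A by fact
  interpret B: contra_two_category B by fact
  note map_obj = cat_functor.map_obj[OF hom] and map_idn = cat_functor.map_idn[OF hom]
  have "CFun1 F (v \<odot> w) x z (CCompO A v w x y z g f) =
        CCompO B v w (CFunO F x) (CFunO F y) (CFunO F z) (CFun1 F v y z g) (CFun1 F w x y f)"
    if ob': "x \<in> COb A" "y \<in> COb A" "z \<in> COb A"
      and ce: "f \<in> Obj (CHom A w x y)" "g \<in> Obj (CHom A v y z)" for v w x y z f g
  proof (rule category_idn_inject[OF B.hom_category[of "CFunO F x" "CFunO F z" "v \<odot> w"]])
    show "Idn (CHom B (v \<odot> w) (CFunO F x) (CFunO F z))
        (CFun1 F (v \<odot> w) x z (CCompO A v w x y z g f)) =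
      Idn (CHom B (v \<odot> w) (CFunO F x) (CFunO F z)) (CCompO B v w (CFunO F x) (CFunO F y) (CFunO F z)
        (CFun1 F v y z g) (CFun1 F w x y f))"
      using that comp[of x y z "Idn (CHom A w x y) f" w "Idn (CHom A v y z) g" v]
      by (simp add: ob map_obj map_idn flip: map_idn[of x z _ "v \<odot> w"])
  qed (use that in \<open>auto simp: ob map_obj\<close>)
  note obj = this
  show ?thesis
    by (intro contra_functor.intro contra_functor_axioms.intro)
      (rule A B ob hom one obj comp ext; assumption)+
qed

lemma comp_contra_fun_simps [simp]:
  "x \<in> COb A \<Longrightarrow> CFunO (comp_contra_fun A G F) x = CFunO G (CFunO F x)"
  "\<lbrakk>x \<in> COb A; y \<in> COb A; f \<in> Obj (CHom A v x y)\<rbrakk> \<Longrightarrow> CFun1 (comp_contra_fun A G F) v x y f =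
    CFun1 G v (CFunO F x) (CFunO F y) (CFun1 F v x y f)"
  "\<lbrakk>x \<in> COb A; y \<in> COb A; \<alpha> \<in> Arr (CHom A v x y)\<rbrakk> \<Longrightarrow> CFun2 (comp_contra_fun A G F) v x y \<alpha> =
    CFun2 G v (CFunO F x) (CFunO F y) (CFun2 F v x y \<alpha>)"
  by (simp_all add: comp_contra_fun_def)

lemma id_contra_fun_simps [simp]:
  "x \<in> COb A \<Longrightarrow> CFunO (id_contra_fun A) x = x"
  "\<lbrakk>x \<in> COb A; y \<in> COb A; f \<in> Obj (CHom A v x y)\<rbrakk> \<Longrightarrow> CFun1 (id_contra_fun A) v x y f = f"
  "\<lbrakk>x \<in> COb A; y \<in> COb A; \<alpha> \<in> Arr (CHom A v x y)\<rbrakk> \<Longrightarrow> CFun2 (id_contra_fun A) v x y \<alpha> = \<alpha>"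
  by (simp_all add: id_contra_fun_def)

lemma contra_functor_id: "contra_two_category A \<Longrightarrow> contra_functor A A (id_contra_fun A)"
proof -
  assume "contra_two_category A"
  then interpret contra_two_category A .
  show ?thesis
  proof (rule contra_functorI)
    show "cat_functor (CHom A v x y) (CHom A v (CFunO (id_contra_fun A) x) (CFunO (id_contra_fun A) y))
        (CFun1 (id_contra_fun A) v x y) (CFun2 (id_contra_fun A) v x y)"
      if "x \<in> COb A" "y \<in> COb A" for v x y
      using that by (intro cat_functor.intro cat_functor_axioms.intro) (simp_all add: hom_category)
  qed (fact contra_two_category_axioms | simp
      | auto simp: id_contra_fun_def)+
qed

lemma contra_functor_comp:
  assumes "contra_functor A B F" "contra_functor B C G"
  shows "contra_functor A C (comp_contra_fun A G F)"
proof -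
  interpret F: contra_functor A B F by fact
  interpret G: contra_functor B C G by fact
  show ?thesis
  proof (rule contra_functorI)
    show "cat_functor (CHom A v x y)
        (CHom C v (CFunO (comp_contra_fun A G F) x) (CFunO (comp_contra_fun A G F) y))
        (CFun1 (comp_contra_fun A G F) v x y) (CFun2 (comp_contra_fun A G F) v x y)"
      if "x \<in> COb A" "y \<in> COb A" for v x y
      using that by (intro cat_functor.intro cat_functor_axioms.intro)
        (simp_all add: F.source.hom_category G.target.hom_category)
  qed (fact F.source.contra_two_category_axioms G.target.contra_two_category_axioms | simp
      | auto simp: comp_contra_fun_def)+
qed

text \<open>Off the carriers both functors are \<open>undefined\<close>, so agreement on the
  carriers is already equality of the records.\<close>

lemma contra_fun_eqI:
  assumes "contra_functor A B F" "contra_functor A B F'"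
    and "\<And>x. x \<in> COb A \<Longrightarrow> CFunO F x = CFunO F' x"
    and "\<And>v x y f. \<lbrakk>x \<in> COb A; y \<in> COb A; f \<in> Obj (CHom A v x y)\<rbrakk> \<Longrightarrow>
      CFun1 F v x y f = CFun1 F' v x y f"
    and "\<And>v x y \<alpha>. \<lbrakk>x \<in> COb A; y \<in> COb A; \<alpha> \<in> Arr (CHom A v x y)\<rbrakk> \<Longrightarrow>
      CFun2 F v x y \<alpha> = CFun2 F' v x y \<alpha>"
  shows "F = F'"
proof -
  interpret F: contra_functor A B F by fact
  interpret F': contra_functor A B F' by fact
  have "CFunO F = CFunO F'"
    using assms(3) F.ext_ob F'.ext_ob by (intro ext) metis
  moreover have "CFun1 F = CFun1 F'"
    using assms(4) F.ext_1 F'.ext_1 by (intro ext) metis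
  moreover have "CFun2 F = CFun2 F'"
    using assms(5) F.ext_2 F'.ext_2 by (intro ext) metis
  ultimately show ?thesis
    by simp
qed

lemma comp_contra_fun_id:
  assumes "contra_functor A B F"
  shows "comp_contra_fun A (id_contra_fun B) F = F" "comp_contra_fun A F (id_contra_fun A) = F"
proof -
  interpret contra_functor A B F by fact
  note * = contra_functor_id[OF source.contra_two_category_axioms]
    contra_functor_id[OF target.contra_two_category_axioms]
  show "comp_contra_fun A (id_contra_fun B) F = F"
    by (rule contra_fun_eqI[OF contra_functor_comp[OF assms *(2)] assms]) simp_all
  show "comp_contra_fun A F (id_contra_fun A) = F"
    by (rule contra_fun_eqI[OF contra_functor_comp[OF *(1) assms] assms]) simp_all
qed

lemma comp_contra_fun_assoc:
  assumes F: "contra_functor A B F" and G: "contra_functor B C G" and H: "contra_functor C D H"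
  shows "comp_contra_fun A (comp_contra_fun B H G) F = comp_contra_fun A H (comp_contra_fun A G F)"
proof -
  interpret F: contra_functor A B F by fact
  interpret G: contra_functor B C G by fact
  interpret H: contra_functor C D H by fact
  show ?thesis
    by (rule contra_fun_eqI[OF contra_functor_comp[OF F contra_functor_comp[OF G H]]
          contra_functor_comp[OF contra_functor_comp[OF F G] H]]) simp_all
qed

section \<open>2-natural transformations respecting contravariance and their two
  compositions\<close>

lemma contra_naturalI:
  fixes \<alpha> :: "'o \<Rightarrow> 'n" and A :: "('o, 'm, 'c) contra_twocat" and B :: "('p, 'n, 'd) contra_twocat"
  assumes F: "contra_functor A B F" and F': "contra_functor A B F'"
    and obj: "\<And>x. x \<in> COb A \<Longrightarrow> \<alpha> x \<in> Obj (CHom B Cov (CFunO F x) (CFunO F' x))"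
    and nat: "\<And>v x y \<mu>. \<lbrakk>x \<in> COb A; y \<in> COb A; \<mu> \<in> Arr (CHom A v x y)\<rbrakk> \<Longrightarrow>
      CCompA B Cov v (CFunO F x) (CFunO F y) (CFunO F' y)
        (Idn (CHom B Cov (CFunO F y) (CFunO F' y)) (\<alpha> y)) (CFun2 F v x y \<mu>) =
      CCompA B v Cov (CFunO F x) (CFunO F' x) (CFunO F' y)
        (CFun2 F' v x y \<mu>) (Idn (CHom B Cov (CFunO F x) (CFunO F' x)) (\<alpha> x))"
    and ext: "\<And>x. x \<notin> COb A \<Longrightarrow> \<alpha> x = undefined"
  shows "contra_natural A B F F' \<alpha>"
proof -
  interpret F: contra_functor A B F by fact
  interpret F': contra_functor A B F' by fact
  have "CCompO B Cov v (CFunO F x) (CFunO F y) (CFunO F' y) (\<alpha> y) (CFun1 F v x y f) =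
      CCompO B v Cov (CFunO F x) (CFunO F' x) (CFunO F' y) (CFun1 F' v x y f) (\<alpha> x)"
    if "x \<in> COb A" "y \<in> COb A" "f \<in> Obj (CHom A v x y)" for v x y f
    using that nat[of x y "Idn (CHom A v x y) f" v]
    by (intro category_idn_inject[OF F.target.hom_category[of "CFunO F x" "CFunO F' y" v]])
      (simp_all add: obj)
  note nat_obj = this
  show ?thesis
    by (intro contra_natural.intro contra_natural_axioms.intro)
      (rule F F' obj nat_obj nat ext; assumption)+
qed

context contra_natural
begin

declare cpt_obj [simp]

text \<open>The simplifier associates composites to the right, where one side of a naturality square
  may occur with a further cell \<open>g\<close> or \<nu> composed after it on the right. This is
  the square in that form.\<close>

lemma naturality_assoc:
  assumes "x \<in> COb A" "y \<in> COb A" "a \<in> COb B" "t = v \<odot> w"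
  shows "\<lbrakk>f \<in> Obj (CHom A v x y); g \<in> Obj (CHom B w a (CFunO F x))\<rbrakk> \<Longrightarrow>
      CCompO B Cov t a (CFunO F y) (CFunO F' y) (\<alpha> y)
        (CCompO B v w a (CFunO F x) (CFunO F y) (CFun1 F v x y f) g) =
      CCompO B v w a (CFunO F' x) (CFunO F' y) (CFun1 F' v x y f)
        (CCompO B Cov w a (CFunO F x) (CFunO F' x) (\<alpha> x) g)"
    and "\<lbrakk>\<mu> \<in> Arr (CHom A v x y); \<nu> \<in> Arr (CHom B w a (CFunO F x))\<rbrakk> \<Longrightarrow>
      CCompA B Cov t a (CFunO F y) (CFunO F' y) (Idn (CHom B Cov (CFunO F y) (CFunO F' y)) (\<alpha> y))
        (CCompA B v w a (CFunO F x) (CFunO F y) (CFun2 F v x y \<mu>) \<nu>) =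
      CCompA B v w a (CFunO F' x) (CFunO F' y) (CFun2 F' v x y \<mu>)
        (CCompA B Cov w a (CFunO F x) (CFunO F' x) (Idn (CHom B Cov (CFunO F x) (CFunO F' x)) (\<alpha> x)) \<nu>)"
proof -
  show "CCompO B Cov t a (CFunO F y) (CFunO F' y) (\<alpha> y)
        (CCompO B v w a (CFunO F x) (CFunO F y) (CFun1 F v x y f) g) =
      CCompO B v w a (CFunO F' x) (CFunO F' y) (CFun1 F' v x y f)
        (CCompO B Cov w a (CFunO F x) (CFunO F' x) (\<alpha> x) g)"
    if "f \<in> Obj (CHom A v x y)" "g \<in> Obj (CHom B w a (CFunO F x))"
    using assms that F.target.assocs(1)[of a "CFunO F x" "CFunO F y" "CFunO F' y" v Cov v g w
        "CFun1 F v x y f" "\<alpha> y"]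
    by (simp add: naturality_obj)
  show "CCompA B Cov t a (CFunO F y) (CFunO F' y) (Idn (CHom B Cov (CFunO F y) (CFunO F' y)) (\<alpha> y))
        (CCompA B v w a (CFunO F x) (CFunO F y) (CFun2 F v x y \<mu>) \<nu>) =
      CCompA B v w a (CFunO F' x) (CFunO F' y) (CFun2 F' v x y \<mu>)
        (CCompA B Cov w a (CFunO F x) (CFunO F' x) (Idn (CHom B Cov (CFunO F x) (CFunO F' x)) (\<alpha> x)) \<nu>)"
    if "\<mu> \<in> Arr (CHom A v x y)" "\<nu> \<in> Arr (CHom B w a (CFunO F x))"
    using assms that F.target.assocs(2)[of a "CFunO F x" "CFunO F y" "CFunO F' y" v Cov v \<nu> w
        "CFun2 F v x y \<mu>" "Idn (CHom B Cov (CFunO F y) (CFunO F' y)) (\<alpha> y)"]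
    by (simp add: naturality_arr)
qed

end

lemma contra_natural_id:
  assumes "contra_functor A B F"
  shows "contra_natural A B F F (\<lambda>x. if x \<in> COb A then COne B (CFunO F x) else undefined)"
proof -
  interpret contra_functor A B F by fact
  show ?thesis
    by (rule contra_naturalI[OF assms assms]) simp_all
qed

lemma contra_natural_vcomp:
  assumes "contra_natural A B F F' \<alpha>" "contra_natural A B F' F'' \<beta>"
  shows "contra_natural A B F F'' (\<lambda>x. if x \<in> COb A
    then CCompO B Cov Cov (CFunO F x) (CFunO F' x) (CFunO F'' x) (\<beta> x) (\<alpha> x) else undefined)"
proof -
  interpret \<alpha>: contra_natural A B F F' \<alpha> by fact
  interpret \<beta>: contra_natural A B F' F'' \<beta> by fact
  show ?thesis
    by (rule contra_naturalI[OF \<alpha>.F.contra_functor_axioms \<beta>.F'.contra_functor_axioms])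
      (simp_all add: \<alpha>.naturality_arr \<beta>.naturality_assoc)
qed

lemma contra_natural_hcomp:
  assumes "contra_natural A B F F' \<alpha>" "contra_natural B C G G' \<beta>"
  shows "contra_natural A C (comp_contra_fun A G F) (comp_contra_fun A G' F') (\<lambda>x. if x \<in> COb A
    then let a = CFunO F x; a' = CFunO F' x in
      CCompO C Cov Cov (CFunO G a) (CFunO G a') (CFunO G' a') (\<beta> a') (CFun1 G Cov a a' (\<alpha> x))
    else undefined)"
proof -
  interpret \<alpha>: contra_natural A B F F' \<alpha> by fact
  interpret \<beta>: contra_natural B C G G' \<beta> by fact
  \<comment> \<open>The image under \<open>G\<close> of the naturality square of \<alpha>.\<close>
  have *: "CCompA C Cov v (CFunO G (CFunO F x)) (CFunO G (CFunO F y)) (CFunO G (CFunO F' y))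
      (Idn (CHom C Cov (CFunO G (CFunO F y)) (CFunO G (CFunO F' y)))
        (CFun1 G Cov (CFunO F y) (CFunO F' y) (\<alpha> y))) (CFun2 G v (CFunO F x) (CFunO F y) (CFun2 F v x y \<mu>)) =
    CCompA C v Cov (CFunO G (CFunO F x)) (CFunO G (CFunO F' x)) (CFunO G (CFunO F' y))
      (CFun2 G v (CFunO F' x) (CFunO F' y) (CFun2 F' v x y \<mu>))
      (Idn (CHom C Cov (CFunO G (CFunO F x)) (CFunO G (CFunO F' x)))
        (CFun1 G Cov (CFunO F x) (CFunO F' x) (\<alpha> x)))"
    if "x \<in> COb A" "y \<in> COb A" "\<mu> \<in> Arr (CHom A v x y)" for v x y \<mu>
    using that arg_cong[OF \<alpha>.naturality_arr[OF that], of "CFun2 G v (CFunO F x) (CFunO F' y)"]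
    by simp
  show ?thesis
    by (rule contra_naturalI[OF contra_functor_comp[OF \<alpha>.F.contra_functor_axioms \<beta>.F.contra_functor_axioms]
          contra_functor_comp[OF \<alpha>.F'.contra_functor_axioms \<beta>.F'.contra_functor_axioms]])
      (simp_all add: * \<beta>.naturality_assoc Let_def)
qed


section \<open>Hom-categories of functors preserving contravariance and the 2-category
  axioms\<close>

lemma contra_hom_simps [simp]:
  "Obj (contra_hom A B) = {F. contra_functor A B F}"
  "Arr (contra_hom A B) = {\<alpha>. contra_natural A B (Src \<alpha>) (Tgt \<alpha>) (Cpt \<alpha>)}"
  "Dom (contra_hom A B) = Src" "Cod (contra_hom A B) = Tgt"
  by (simp_all add: contra_hom_def)

lemma transf_eqI:
  "Src \<alpha> = Src \<beta> \<Longrightarrow> Tgt \<alpha> = Tgt \<beta> \<Longrightarrow> (\<And>x. Cpt \<alpha> x = Cpt \<beta> x) \<Longrightarrow> (\<alpha> :: ('f, 'o, 'n) transf) = \<beta>"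
  by (cases \<alpha>; cases \<beta>) auto

lemma category_contra_hom:
  fixes A :: "('o, 'm, 'c) contra_twocat" and B :: "('p, 'n, 'd) contra_twocat"
  shows "category (contra_hom A B)"
proof
  fix f g h :: "(('o, 'm, 'c, 'p, 'n, 'd) contra_fun, 'o, 'n) transf"
  assume f: "f \<in> Arr (contra_hom A B)"
  then interpret f: contra_natural A B "Src f" "Tgt f" "Cpt f"
    by simp
  show "Cmp (contra_hom A B) (Idn (contra_hom A B) (Cod (contra_hom A B) f)) f = f"
    by (rule transf_eqI) (auto simp: contra_hom_def f.ext_cpt)
  show "Cmp (contra_hom A B) f (Idn (contra_hom A B) (Dom (contra_hom A B) f)) = f"
    by (rule transf_eqI) (auto simp: contra_hom_def f.ext_cpt)
  show "Dom (contra_hom A B) f \<in> Obj (contra_hom A B)" "Cod (contra_hom A B) f \<in> Obj (contra_hom A B)"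
    by (simp_all add: f.F.contra_functor_axioms f.F'.contra_functor_axioms)
  assume g: "g \<in> Arr (contra_hom A B)" and gf: "Dom (contra_hom A B) g = Cod (contra_hom A B) f"
  then interpret g: contra_natural A B "Tgt f" "Tgt g" "Cpt g"
    by simp
  show "Cmp (contra_hom A B) g f \<in> Arr (contra_hom A B)"
    using contra_natural_vcomp[OF f.contra_natural_axioms g.contra_natural_axioms] gf
    by (simp add: contra_hom_def)
  show "Dom (contra_hom A B) (Cmp (contra_hom A B) g f) = Dom (contra_hom A B) f"
    "Cod (contra_hom A B) (Cmp (contra_hom A B) g f) = Cod (contra_hom A B) g"
    by (simp_all add: contra_hom_def)
  assume h: "h \<in> Arr (contra_hom A B)" and hg: "Dom (contra_hom A B) h = Cod (contra_hom A B) g"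
  then interpret h: contra_natural A B "Tgt g" "Tgt h" "Cpt h"
    by simp
  show "Cmp (contra_hom A B) (Cmp (contra_hom A B) h g) f =
      Cmp (contra_hom A B) h (Cmp (contra_hom A B) g f)"
    using gf hg by (intro transf_eqI) (auto simp: contra_hom_def)
next
  fix F :: "('o, 'm, 'c, 'p, 'n, 'd) contra_fun"
  assume "F \<in> Obj (contra_hom A B)"
  then show "Idn (contra_hom A B) F \<in> Arr (contra_hom A B)"
    using contra_natural_id[of A B F] by (simp add: contra_hom_def)
qed (simp_all add: contra_hom_def)

lemma contra_TwoCat_simps [simp]:
  "Ob contra_TwoCat = {A. contra_two_category A \<and> has_strict_opposites A}"
  "Hom contra_TwoCat = contra_hom" "One contra_TwoCat = id_contra_fun"
  "CompO contra_TwoCat A B C = comp_contra_fun A"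
  "Src (CompA contra_TwoCat A B C \<beta> \<alpha>) = comp_contra_fun A (Src \<beta>) (Src \<alpha>)"
  "Tgt (CompA contra_TwoCat A B C \<beta> \<alpha>) = comp_contra_fun A (Tgt \<beta>) (Tgt \<alpha>)"
  "Cpt (CompA contra_TwoCat A B C \<beta> \<alpha>) = (\<lambda>x. if x \<in> COb A
         then let a = CFunO (Src \<alpha>) x; a' = CFunO (Tgt \<alpha>) x in
           CCompO C Cov Cov
             (CFunO (Src \<beta>) a) (CFunO (Src \<beta>) a') (CFunO (Tgt \<beta>) a')
             (Cpt \<beta> a') (CFun1 (Src \<beta>) Cov a a' (Cpt \<alpha> x))
         else undefined)"
  by (simp_all add: contra_TwoCat_def)

lemma contra_hom_arr_simps [simp]:
  "Src (Idn (contra_hom A B) F) = F" "Tgt (Idn (contra_hom A B) F) = F"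
  "Cpt (Idn (contra_hom A B) F) x = (if x \<in> COb A then COne B (CFunO F x) else undefined)"
  "Src (Cmp (contra_hom A B) \<beta> \<alpha>) = Src \<alpha>" "Tgt (Cmp (contra_hom A B) \<beta> \<alpha>) = Tgt \<beta>"
  "Cpt (Cmp (contra_hom A B) \<beta> \<alpha>) x = (if x \<in> COb A then CCompO B Cov Cov
      (CFunO (Src \<alpha>) x) (CFunO (Tgt \<alpha>) x) (CFunO (Tgt \<beta>) x) (Cpt \<beta> x) (Cpt \<alpha> x) else undefined)"
  by (simp_all add: contra_hom_def)

lemma two_category_contra_TwoCat:
  "two_category (contra_TwoCat :: (('o, 'm, 'c) contra_twocat, ('o, 'm, 'c, 'o, 'm, 'c) contra_fun,
    (('o, 'm, 'c, 'o, 'm, 'c) contra_fun, 'o, 'm) transf) twocat)"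
proof (rule two_category.intro)
  fix A B C :: "('o, 'm, 'c) contra_twocat"
  show "cat_functor (prod_cat (Hom contra_TwoCat B C) (Hom contra_TwoCat A B)) (Hom contra_TwoCat A C)
     (\<lambda>(g, f). CompO contra_TwoCat A B C g f) (\<lambda>(\<beta>, \<alpha>). CompA contra_TwoCat A B C \<beta> \<alpha>)"
  proof (intro cat_functor.intro cat_functor_axioms.intro)
    fix f g :: "(('o, 'm, 'c, 'o, 'm, 'c) contra_fun, 'o, 'm) transf \<times>
      (('o, 'm, 'c, 'o, 'm, 'c) contra_fun, 'o, 'm) transf"
    assume f: "f \<in> Arr (prod_cat (Hom contra_TwoCat B C) (Hom contra_TwoCat A B))"
    obtain \<beta> \<alpha> where f_eq: "f = (\<beta>, \<alpha>)"
      by (cases f)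
    interpret \<alpha>: contra_natural A B "Src \<alpha>" "Tgt \<alpha>" "Cpt \<alpha>"
      using f by (simp add: f_eq)
    interpret \<beta>: contra_natural B C "Src \<beta>" "Tgt \<beta>" "Cpt \<beta>"
      using f by (simp add: f_eq)
    show "(case f of (\<beta>, \<alpha>) \<Rightarrow> CompA contra_TwoCat A B C \<beta> \<alpha>) \<in> Arr (Hom contra_TwoCat A C)"
      using contra_natural_hcomp[OF \<alpha>.contra_natural_axioms \<beta>.contra_natural_axioms]
      by (simp add: f_eq Let_def)
    assume g: "g \<in> Arr (prod_cat (Hom contra_TwoCat B C) (Hom contra_TwoCat A B))"
      and gf: "Dom (prod_cat (Hom contra_TwoCat B C) (Hom contra_TwoCat A B)) g =
        Cod (prod_cat (Hom contra_TwoCat B C) (Hom contra_TwoCat A B)) f"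
    obtain \<beta>' \<alpha>' where g_eq: "g = (\<beta>', \<alpha>')"
      by (cases g)
    interpret \<alpha>': contra_natural A B "Tgt \<alpha>" "Tgt \<alpha>'" "Cpt \<alpha>'"
      using g gf by (simp add: g_eq f_eq)
    interpret \<beta>': contra_natural B C "Tgt \<beta>" "Tgt \<beta>'" "Cpt \<beta>'"
      using g gf by (simp add: g_eq f_eq)
    show "(case Cmp (prod_cat (Hom contra_TwoCat B C) (Hom contra_TwoCat A B)) g f of
         (\<beta>, \<alpha>) \<Rightarrow> CompA contra_TwoCat A B C \<beta> \<alpha>) =
        Cmp (Hom contra_TwoCat A C) (case g of (\<beta>, \<alpha>) \<Rightarrow> CompA contra_TwoCat A B C \<beta> \<alpha>)
         (case f of (\<beta>, \<alpha>) \<Rightarrow> CompA contra_TwoCat A B C \<beta> \<alpha>)"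
      \<comment> \<open>Interchange comes down to naturality of \<beta> at the components of
        \<alpha>'.\<close>
      using gf by (intro transf_eqI) (auto simp: f_eq g_eq Let_def \<beta>.naturality_assoc)
  next
    fix a :: "('o, 'm, 'c, 'o, 'm, 'c) contra_fun \<times> ('o, 'm, 'c, 'o, 'm, 'c) contra_fun"
    assume a: "a \<in> Obj (prod_cat (Hom contra_TwoCat B C) (Hom contra_TwoCat A B))"
    obtain G F where a_eq: "a = (G, F)"
      by (cases a)
    interpret F: contra_functor A B F + G: contra_functor B C G
      using a by (simp_all add: a_eq)
    show "(case Idn (prod_cat (Hom contra_TwoCat B C) (Hom contra_TwoCat A B)) a of
         (\<beta>, \<alpha>) \<Rightarrow> CompA contra_TwoCat A B C \<beta> \<alpha>) =
        Idn (Hom contra_TwoCat A C) (case a of (g, f) \<Rightarrow> CompO contra_TwoCat A B C g f)"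
      by (rule transf_eqI) (simp_all add: a_eq Let_def)
  qed (auto simp: category_prod_cat category_contra_hom contra_functor_comp)
next
  fix A B C D :: "('o, 'm, 'c) contra_twocat"
    and \<alpha> \<beta> \<gamma> :: "(('o, 'm, 'c, 'o, 'm, 'c) contra_fun, 'o, 'm) transf"
  assume "\<alpha> \<in> Arr (Hom contra_TwoCat A B)"
  then interpret \<alpha>: contra_natural A B "Src \<alpha>" "Tgt \<alpha>" "Cpt \<alpha>"
    by simp
  show "CompA contra_TwoCat A B B (Idn (Hom contra_TwoCat B B) (One contra_TwoCat B)) \<alpha> = \<alpha>"
    by (rule transf_eqI)
      (auto simp: Let_def \<alpha>.ext_cpt comp_contra_fun_id[OF \<alpha>.F.contra_functor_axioms]
        comp_contra_fun_id[OF \<alpha>.F'.contra_functor_axioms])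
  show "CompA contra_TwoCat A A B \<alpha> (Idn (Hom contra_TwoCat A A) (One contra_TwoCat A)) = \<alpha>"
    by (rule transf_eqI)
      (auto simp: Let_def \<alpha>.ext_cpt comp_contra_fun_id[OF \<alpha>.F.contra_functor_axioms]
        comp_contra_fun_id[OF \<alpha>.F'.contra_functor_axioms])
  assume "\<beta> \<in> Arr (Hom contra_TwoCat B C)" "\<gamma> \<in> Arr (Hom contra_TwoCat C D)"
  then interpret \<beta>: contra_natural B C "Src \<beta>" "Tgt \<beta>" "Cpt \<beta>"
    + \<gamma>: contra_natural C D "Src \<gamma>" "Tgt \<gamma>" "Cpt \<gamma>"
    by simp_all
  show "CompA contra_TwoCat A B D (CompA contra_TwoCat B C D \<gamma> \<beta>) \<alpha> =
       CompA contra_TwoCat A C D \<gamma> (CompA contra_TwoCat A B C \<beta> \<alpha>)"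
    by (rule transf_eqI)
      (auto simp: Let_def comp_contra_fun_assoc[OF \<alpha>.F.contra_functor_axioms
          \<beta>.F.contra_functor_axioms \<gamma>.F.contra_functor_axioms]
        comp_contra_fun_assoc[OF \<alpha>.F'.contra_functor_axioms
          \<beta>.F'.contra_functor_axioms \<gamma>.F'.contra_functor_axioms])
qed (auto simp: category_contra_hom contra_functor_id comp_contra_fun_id intro: comp_contra_fun_assoc)

section \<open>Equivalences of 2-categories\<close>

context two_category
begin

lemma hom_simps [simp]:
  assumes "x \<in> Ob A" "y \<in> Ob A"
  shows "f \<in> Arr (Hom A x y) \<Longrightarrow> Dom (Hom A x y) f \<in> Obj (Hom A x y)"
    and "f \<in> Arr (Hom A x y) \<Longrightarrow> Cod (Hom A x y) f \<in> Obj (Hom A x y)"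
    and "f \<in> Arr (Hom A x y) \<Longrightarrow> Dom (var_cat w (Hom A x y)) f \<in> Obj (Hom A x y)"
    and "f \<in> Arr (Hom A x y) \<Longrightarrow> Cod (var_cat w (Hom A x y)) f \<in> Obj (Hom A x y)"
    and "a \<in> Obj (Hom A x y) \<Longrightarrow> Idn (Hom A x y) a \<in> Arr (Hom A x y)"
    and "a \<in> Obj (Hom A x y) \<Longrightarrow> Dom (Hom A x y) (Idn (Hom A x y) a) = a"
    and "a \<in> Obj (Hom A x y) \<Longrightarrow> Cod (Hom A x y) (Idn (Hom A x y) a) = a"
    and "a \<in> Obj (Hom A x y) \<Longrightarrow> Cmp (Hom A x y) (Idn (Hom A x y) a) (Idn (Hom A x y) a)
      = Idn (Hom A x y) a"
    and "\<lbrakk>f \<in> Arr (Hom A x y); g \<in> Arr (Hom A x y); Dom (Hom A x y) g = Cod (Hom A x y) f\<rbrakk> \<Longrightarrow>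
      Cmp (Hom A x y) g f \<in> Arr (Hom A x y)"
    and "\<lbrakk>f \<in> Arr (Hom A x y); g \<in> Arr (Hom A x y); Dom (Hom A x y) g = Cod (Hom A x y) f\<rbrakk> \<Longrightarrow>
      Dom (Hom A x y) (Cmp (Hom A x y) g f) = Dom (Hom A x y) f"
    and "\<lbrakk>f \<in> Arr (Hom A x y); g \<in> Arr (Hom A x y); Dom (Hom A x y) g = Cod (Hom A x y) f\<rbrakk> \<Longrightarrow>
      Cod (Hom A x y) (Cmp (Hom A x y) g f) = Cod (Hom A x y) g"
  using category.dom_obj[OF hom_category[OF assms]]
    category.cod_obj[OF hom_category[OF assms]]
    category.idn_arr[OF hom_category[OF assms]]
    category.dom_idn[OF hom_category[OF assms]]
    category.cod_idn[OF hom_category[OF assms]]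
    category.dom_obj[OF category_var_cat[OF hom_category[OF assms]]]
    category.cod_obj[OF category_var_cat[OF hom_category[OF assms]]]
    category.dom_idn[OF category_var_cat[OF hom_category[OF assms]]]
    category.cod_idn[OF category_var_cat[OF hom_category[OF assms]]]
    category.cmp_arr[OF hom_category[OF assms]]
    category.dom_cmp[OF hom_category[OF assms]]
    category.cod_cmp[OF hom_category[OF assms]]
    category_cmp_idn_idn[OF hom_category[OF assms]]
  by auto

declare one_obj [simp]

lemma comp_simps [simp]:
  assumes "x \<in> Ob A" "y \<in> Ob A" "z \<in> Ob A"
  shows "\<lbrakk>g \<in> Obj (Hom A y z); f \<in> Obj (Hom A x y)\<rbrakk> \<Longrightarrow> CompO A x y z g f \<in> Obj (Hom A x z)"
    and "\<lbrakk>\<beta> \<in> Arr (Hom A y z); \<alpha> \<in> Arr (Hom A x y)\<rbrakk> \<Longrightarrow> CompA A x y z \<beta> \<alpha> \<in> Arr (Hom A x z)"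
    and "\<lbrakk>\<beta> \<in> Arr (Hom A y z); \<alpha> \<in> Arr (Hom A x y)\<rbrakk> \<Longrightarrow> Dom (Hom A x z) (CompA A x y z \<beta> \<alpha>) =
        CompO A x y z (Dom (Hom A y z) \<beta>) (Dom (Hom A x y) \<alpha>)"
    and "\<lbrakk>\<beta> \<in> Arr (Hom A y z); \<alpha> \<in> Arr (Hom A x y)\<rbrakk> \<Longrightarrow> Cod (Hom A x z) (CompA A x y z \<beta> \<alpha>) =
        CompO A x y z (Cod (Hom A y z) \<beta>) (Cod (Hom A x y) \<alpha>)"
    and "\<lbrakk>g \<in> Obj (Hom A y z); f \<in> Obj (Hom A x y)\<rbrakk> \<Longrightarrow> Idn (Hom A x z) (CompO A x y z g f) =
        CompA A x y z (Idn (Hom A y z) g) (Idn (Hom A x y) f)"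
    and "\<lbrakk>\<beta> \<in> Arr (Hom A y z); \<beta>' \<in> Arr (Hom A y z); \<alpha> \<in> Arr (Hom A x y); \<alpha>' \<in> Arr (Hom A x y);
      Dom (Hom A y z) \<beta>' = Cod (Hom A y z) \<beta>; Dom (Hom A x y) \<alpha>' = Cod (Hom A x y) \<alpha>\<rbrakk> \<Longrightarrow>
      Cmp (Hom A x z) (CompA A x y z \<beta>' \<alpha>') (CompA A x y z \<beta> \<alpha>) =
        CompA A x y z (Cmp (Hom A y z) \<beta>' \<beta>) (Cmp (Hom A x y) \<alpha>' \<alpha>)"
  using cat_functor.map_obj[OF comp_functor[OF assms(1-3)], of "(g, f)"]
    cat_functor.map_arr[OF comp_functor[OF assms(1-3)], of "(\<beta>, \<alpha>)"]
    cat_functor.map_dom[OF comp_functor[OF assms(1-3)], of "(\<beta>, \<alpha>)"]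
    cat_functor.map_cod[OF comp_functor[OF assms(1-3)], of "(\<beta>, \<alpha>)"]
    cat_functor.map_idn[OF comp_functor[OF assms(1-3)], of "(g, f)"]
    cat_functor.map_cmp[OF comp_functor[OF assms(1-3)], of "(\<beta>, \<alpha>)" "(\<beta>', \<alpha>')"]
  by simp_all

lemma unit_simps [simp]:
  assumes "x \<in> Ob A" "y \<in> Ob A"
  shows "f \<in> Obj (Hom A x y) \<Longrightarrow> CompO A x y y (One A y) f = f"
    and "\<alpha> \<in> Arr (Hom A x y) \<Longrightarrow> CompA A x y y (Idn (Hom A y y) (One A y)) \<alpha> = \<alpha>"
    and "f \<in> Obj (Hom A x y) \<Longrightarrow> CompO A x x y f (One A x) = f"
    and "\<alpha> \<in> Arr (Hom A x y) \<Longrightarrow> CompA A x x y \<alpha> (Idn (Hom A x x) (One A x)) = \<alpha>"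
  using assms by (simp_all add: unit_left_obj unit_left_arr unit_right_obj unit_right_arr)

declare assoc_obj [simp] assoc_arr [simp]

text \<open>With composites associated to the right, a pair with \<open>g f = 1\<close> meets the
  simplifier as \<open>g (f h)\<close>. The 2-cell versions whisker with identity 2-cells.\<close>

lemma cancel:
  assumes "x \<in> Ob A" "y \<in> Ob A" "f \<in> Obj (Hom A x y)" "g \<in> Obj (Hom A y x)"
    and gf: "CompO A x y x g f = One A x"
  shows "CompA A x y x (Idn (Hom A y x) g) (Idn (Hom A x y) f) = Idn (Hom A x x) (One A x)"
    and "\<lbrakk>w \<in> Ob A; h \<in> Obj (Hom A w x)\<rbrakk> \<Longrightarrow> CompO A w y x g (CompO A w x y f h) = h"
    and "\<lbrakk>w \<in> Ob A; \<alpha> \<in> Arr (Hom A w x)\<rbrakk> \<Longrightarrow>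
      CompA A w y x (Idn (Hom A y x) g) (CompA A w x y (Idn (Hom A x y) f) \<alpha>) = \<alpha>"
proof -
  show *: "CompA A x y x (Idn (Hom A y x) g) (Idn (Hom A x y) f) = Idn (Hom A x x) (One A x)"
    using assms comp_simps(5)[of x y x g f] by simp
  show "CompO A w y x g (CompO A w x y f h) = h" if "w \<in> Ob A" "h \<in> Obj (Hom A w x)"
    using assms that assoc_obj[of w x y x h f g] by simp
  show "CompA A w y x (Idn (Hom A y x) g) (CompA A w x y (Idn (Hom A x y) f) \<alpha>) = \<alpha>"
    if "w \<in> Ob A" "\<alpha> \<in> Arr (Hom A w x)"
    using assms(1-4) * that assoc_arr[of w x y x \<alpha> "Idn (Hom A x y) f" "Idn (Hom A y x) g"] by simp
qed

end

section \<open>Strict 2-functors and 2-natural transformations\<close>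

context two_functor
begin

declare fun_ob [simp] fun_one [simp] fun_comp_obj [simp] fun_comp_arr [simp]

lemma fun_simps [simp]:
  assumes "x \<in> Ob A" "y \<in> Ob A"
  shows "f \<in> Obj (Hom A x y) \<Longrightarrow> Fun1 F x y f \<in> Obj (Hom B (FunO F x) (FunO F y))"
    and "\<alpha> \<in> Arr (Hom A x y) \<Longrightarrow> Fun2 F x y \<alpha> \<in> Arr (Hom B (FunO F x) (FunO F y))"
    and "\<alpha> \<in> Arr (Hom A x y) \<Longrightarrow> Dom (Hom B (FunO F x) (FunO F y)) (Fun2 F x y \<alpha>) =
      Fun1 F x y (Dom (Hom A x y) \<alpha>)"
    and "\<alpha> \<in> Arr (Hom A x y) \<Longrightarrow> Cod (Hom B (FunO F x) (FunO F y)) (Fun2 F x y \<alpha>) =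
      Fun1 F x y (Cod (Hom A x y) \<alpha>)"
    and "f \<in> Obj (Hom A x y) \<Longrightarrow> Fun2 F x y (Idn (Hom A x y) f) =
      Idn (Hom B (FunO F x) (FunO F y)) (Fun1 F x y f)"
    and "\<lbrakk>\<alpha> \<in> Arr (Hom A x y); \<beta> \<in> Arr (Hom A x y); Dom (Hom A x y) \<beta> = Cod (Hom A x y) \<alpha>\<rbrakk> \<Longrightarrow>
      Fun2 F x y (Cmp (Hom A x y) \<beta> \<alpha>) =
      Cmp (Hom B (FunO F x) (FunO F y)) (Fun2 F x y \<beta>) (Fun2 F x y \<alpha>)"
  using cat_functor.map_obj[OF fun_hom[OF assms]]
    cat_functor.map_arr[OF fun_hom[OF assms]]
    cat_functor.map_dom[OF fun_hom[OF assms]]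
    cat_functor.map_cod[OF fun_hom[OF assms]]
    cat_functor.map_idn[OF fun_hom[OF assms]]
    cat_functor.map_cmp[OF fun_hom[OF assms]]
  by simp_all

end

lemma two_functorI:
  fixes F :: "('o, 'm, 'c, 'p, 'n, 'd) two_fun"
  assumes A: "two_category A" and B: "two_category B"
    and ob: "\<And>x. x \<in> Ob A \<Longrightarrow> FunO F x \<in> Ob B"
    and hom: "\<And>x y. \<lbrakk>x \<in> Ob A; y \<in> Ob A\<rbrakk> \<Longrightarrow>
      cat_functor (Hom A x y) (Hom B (FunO F x) (FunO F y)) (Fun1 F x y) (Fun2 F x y)"
    and one: "\<And>x. x \<in> Ob A \<Longrightarrow> Fun1 F x x (One A x) = One B (FunO F x)"
    and comp: "\<And>x y z \<alpha> \<beta>. \<lbrakk>x \<in> Ob A; y \<in> Ob A; z \<in> Ob A;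
      \<alpha> \<in> Arr (Hom A x y); \<beta> \<in> Arr (Hom A y z)\<rbrakk> \<Longrightarrow>
      Fun2 F x z (CompA A x y z \<beta> \<alpha>) =
        CompA B (FunO F x) (FunO F y) (FunO F z) (Fun2 F y z \<beta>) (Fun2 F x y \<alpha>)"
    and ext: "\<And>x. x \<notin> Ob A \<Longrightarrow> FunO F x = undefined"
      "\<And>x y f. \<not> (x \<in> Ob A \<and> y \<in> Ob A \<and> f \<in> Obj (Hom A x y)) \<Longrightarrow> Fun1 F x y f = undefined"
      "\<And>x y \<alpha>. \<not> (x \<in> Ob A \<and> y \<in> Ob A \<and> \<alpha> \<in> Arr (Hom A x y)) \<Longrightarrow> Fun2 F x y \<alpha> = undefined"
  shows "two_functor A B F"
proof -
  interpret A: two_category A by fact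
  interpret B: two_category B by fact
  note map_obj = cat_functor.map_obj[OF hom] and map_idn = cat_functor.map_idn[OF hom]
  have "Fun1 F x z (CompO A x y z g f) =
        CompO B (FunO F x) (FunO F y) (FunO F z) (Fun1 F y z g) (Fun1 F x y f)"
    if "x \<in> Ob A" "y \<in> Ob A" "z \<in> Ob A"
      and "f \<in> Obj (Hom A x y)" "g \<in> Obj (Hom A y z)" for x y z f g
  proof (rule category_idn_inject[OF B.hom_category[of "FunO F x" "FunO F z"]])
    show "Idn (Hom B (FunO F x) (FunO F z)) (Fun1 F x z (CompO A x y z g f)) =
      Idn (Hom B (FunO F x) (FunO F z)) (CompO B (FunO F x) (FunO F y) (FunO F z)
        (Fun1 F y z g) (Fun1 F x y f))"
      using that comp[of x y z "Idn (Hom A x y) f" "Idn (Hom A y z) g"]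
      by (simp add: ob map_obj map_idn flip: map_idn[of x z _])
  qed (use that in \<open>auto simp: ob map_obj\<close>)
  note obj = this
  show ?thesis
    by (intro two_functor.intro two_functor_axioms.intro)
      (rule A B ob hom one obj comp ext; assumption)+
qed

lemma two_naturalI:
  fixes \<alpha> :: "'o \<Rightarrow> 'n" and A :: "('o, 'm, 'c) twocat" and B :: "('p, 'n, 'd) twocat"
  assumes F: "two_functor A B F" and F': "two_functor A B F'"
    and obj: "\<And>x. x \<in> Ob A \<Longrightarrow> \<alpha> x \<in> Obj (Hom B (FunO F x) (FunO F' x))"
    and nat: "\<And>x y \<mu>. \<lbrakk>x \<in> Ob A; y \<in> Ob A; \<mu> \<in> Arr (Hom A x y)\<rbrakk> \<Longrightarrow>
      CompA B (FunO F x) (FunO F y) (FunO F' y)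
        (Idn (Hom B (FunO F y) (FunO F' y)) (\<alpha> y)) (Fun2 F x y \<mu>) =
      CompA B (FunO F x) (FunO F' x) (FunO F' y)
        (Fun2 F' x y \<mu>) (Idn (Hom B (FunO F x) (FunO F' x)) (\<alpha> x))"
    and ext: "\<And>x. x \<notin> Ob A \<Longrightarrow> \<alpha> x = undefined"
  shows "two_natural A B F F' \<alpha>"
proof -
  interpret F: two_functor A B F by fact
  interpret F': two_functor A B F' by fact
  have "CompO B (FunO F x) (FunO F y) (FunO F' y) (\<alpha> y) (Fun1 F x y f) =
      CompO B (FunO F x) (FunO F' x) (FunO F' y) (Fun1 F' x y f) (\<alpha> x)"
    if "x \<in> Ob A" "y \<in> Ob A" "f \<in> Obj (Hom A x y)" for x y f
    using that nat[of x y "Idn (Hom A x y) f"]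
    by (intro category_idn_inject[OF F.target.hom_category[of "FunO F x" "FunO F' y"]])
      (simp_all add: obj)
  note nat_obj = this
  show ?thesis
    by (intro two_natural.intro two_natural_axioms.intro)
      (rule F F' obj nat_obj nat ext; assumption)+
qed

lemma comp_two_fun_simps [simp]:
  "x \<in> Ob A \<Longrightarrow> FunO (comp_two_fun A G F) x = FunO G (FunO F x)"
  "\<lbrakk>x \<in> Ob A; y \<in> Ob A; f \<in> Obj (Hom A x y)\<rbrakk> \<Longrightarrow> Fun1 (comp_two_fun A G F) x y f =
    Fun1 G (FunO F x) (FunO F y) (Fun1 F x y f)"
  "\<lbrakk>x \<in> Ob A; y \<in> Ob A; \<alpha> \<in> Arr (Hom A x y)\<rbrakk> \<Longrightarrow> Fun2 (comp_two_fun A G F) x y \<alpha> =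
    Fun2 G (FunO F x) (FunO F y) (Fun2 F x y \<alpha>)"
  by (simp_all add: comp_two_fun_def)

lemma id_two_fun_simps [simp]:
  "x \<in> Ob A \<Longrightarrow> FunO (id_two_fun A) x = x"
  "\<lbrakk>x \<in> Ob A; y \<in> Ob A; f \<in> Obj (Hom A x y)\<rbrakk> \<Longrightarrow> Fun1 (id_two_fun A) x y f = f"
  "\<lbrakk>x \<in> Ob A; y \<in> Ob A; \<alpha> \<in> Arr (Hom A x y)\<rbrakk> \<Longrightarrow> Fun2 (id_two_fun A) x y \<alpha> = \<alpha>"
  by (simp_all add: id_two_fun_def)

lemma two_functor_id: "two_category A \<Longrightarrow> two_functor A A (id_two_fun A)"
proof -
  assume "two_category A"
  then interpret two_category A .
  show ?thesis
  proof (rule two_functorI)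
    show "cat_functor (Hom A x y) (Hom A (FunO (id_two_fun A) x) (FunO (id_two_fun A) y))
        (Fun1 (id_two_fun A) x y) (Fun2 (id_two_fun A) x y)"
      if "x \<in> Ob A" "y \<in> Ob A" for x y
      using that by (intro cat_functor.intro cat_functor_axioms.intro) (simp_all add: hom_category)
  qed (fact two_category_axioms | simp | auto simp: id_two_fun_def)+
qed

lemma two_functor_comp:
  assumes "two_functor A B F" "two_functor B C G"
  shows "two_functor A C (comp_two_fun A G F)"
proof -
  interpret F: two_functor A B F by fact
  interpret G: two_functor B C G by fact
  show ?thesis
  proof (rule two_functorI)
    show "cat_functor (Hom A x y) (Hom C (FunO (comp_two_fun A G F) x) (FunO (comp_two_fun A G F) y))
        (Fun1 (comp_two_fun A G F) x y) (Fun2 (comp_two_fun A G F) x y)"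
      if "x \<in> Ob A" "y \<in> Ob A" for x y
      using that by (intro cat_functor.intro cat_functor_axioms.intro)
        (simp_all add: F.source.hom_category G.target.hom_category)
  qed (fact F.source.two_category_axioms G.target.two_category_axioms | simp
      | auto simp: comp_two_fun_def)+
qed

definition restrict_two_fun :: "('o, 'm, 'c) twocat \<Rightarrow> ('o \<Rightarrow> 'p) \<Rightarrow> ('o \<Rightarrow> 'o \<Rightarrow> 'm \<Rightarrow> 'n) \<Rightarrow>
    ('o \<Rightarrow> 'o \<Rightarrow> 'c \<Rightarrow> 'd) \<Rightarrow> ('o, 'm, 'c, 'p, 'n, 'd) two_fun" where
  "restrict_two_fun A P Q R = \<lparr>
     FunO = (\<lambda>x. if x \<in> Ob A then P x else undefined),
     Fun1 = (\<lambda>x y f. if x \<in> Ob A \<and> y \<in> Ob A \<and> f \<in> Obj (Hom A x y) then Q x y f else undefined),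
     Fun2 = (\<lambda>x y \<alpha>. if x \<in> Ob A \<and> y \<in> Ob A \<and> \<alpha> \<in> Arr (Hom A x y) then R x y \<alpha> else undefined)\<rparr>"

lemma restrict_two_fun_simps [simp]:
  "x \<in> Ob A \<Longrightarrow> FunO (restrict_two_fun A P Q R) x = P x"
  "\<lbrakk>x \<in> Ob A; y \<in> Ob A; f \<in> Obj (Hom A x y)\<rbrakk> \<Longrightarrow> Fun1 (restrict_two_fun A P Q R) x y f = Q x y f"
  "\<lbrakk>x \<in> Ob A; y \<in> Ob A; \<alpha> \<in> Arr (Hom A x y)\<rbrakk> \<Longrightarrow> Fun2 (restrict_two_fun A P Q R) x y \<alpha> = R x y \<alpha>"
  by (simp_all add: restrict_two_fun_def)

lemma two_functor_restrict:
  assumes A: "two_category A" and B: "two_category B"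
    and ob: "\<And>x. x \<in> Ob A \<Longrightarrow> P x \<in> Ob B"
    and hom: "\<And>x y. \<lbrakk>x \<in> Ob A; y \<in> Ob A\<rbrakk> \<Longrightarrow>
      cat_functor (Hom A x y) (Hom B (P x) (P y)) (Q x y) (R x y)"
    and one: "\<And>x. x \<in> Ob A \<Longrightarrow> Q x x (One A x) = One B (P x)"
    and comp: "\<And>x y z \<alpha> \<beta>. \<lbrakk>x \<in> Ob A; y \<in> Ob A; z \<in> Ob A;
      \<alpha> \<in> Arr (Hom A x y); \<beta> \<in> Arr (Hom A y z)\<rbrakk> \<Longrightarrow>
      R x z (CompA A x y z \<beta> \<alpha>) = CompA B (P x) (P y) (P z) (R y z \<beta>) (R x y \<alpha>)"
  shows "two_functor A B (restrict_two_fun A P Q R)"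
proof -
  interpret A: two_category A by fact
  show ?thesis
  proof (rule two_functorI[OF A B])
    fix x y assume xy: "x \<in> Ob A" "y \<in> Ob A"
    interpret cat_functor "Hom A x y" "Hom B (P x) (P y)" "Q x y" "R x y"
      by (rule hom[OF xy])
    show "cat_functor (Hom A x y)
        (Hom B (FunO (restrict_two_fun A P Q R) x) (FunO (restrict_two_fun A P Q R) y))
        (Fun1 (restrict_two_fun A P Q R) x y) (Fun2 (restrict_two_fun A P Q R) x y)"
      using xy by (intro cat_functor.intro cat_functor_axioms.intro)
        (simp_all add: source.category_axioms target.category_axioms map_obj map_arr map_dom map_cod
          map_idn map_cmp)
  qed (simp_all add: ob one comp, auto simp: restrict_two_fun_def)
qed

text \<open>Each axiom equates two cells of one hom-category of \<open>D\<close>. Since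
  \<open>Q\<close> and \<open>R\<close> are injective there and commute with all operations, it
  holds as soon as its image does, and the image is an axiom of \<open>E\<close>. What cannot be
  reflected is closure of the carriers of \<open>D\<close>, hence the membership claims paired with
  the equations in the premises.\<close>

lemma two_category_reflect:
  fixes D :: "('o, 'm, 'c) twocat" and E :: "('p, 'n, 'd) twocat"
  assumes E: "two_category E"
    and ob: "\<And>x. x \<in> Ob D \<Longrightarrow> P x \<in> Ob E"
    and obj: "\<And>x y f. \<lbrakk>x \<in> Ob D; y \<in> Ob D; f \<in> Obj (Hom D x y)\<rbrakk> \<Longrightarrow> Q x y f \<in> Obj (Hom E (P x) (P y))"
    and arr: "\<And>x y \<alpha>. \<lbrakk>x \<in> Ob D; y \<in> Ob D; \<alpha> \<in> Arr (Hom D x y)\<rbrakk> \<Longrightarrow> R x y \<alpha> \<in> Arr (Hom E (P x) (P y))"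
    and inj_obj: "\<And>x y. \<lbrakk>x \<in> Ob D; y \<in> Ob D\<rbrakk> \<Longrightarrow> inj_on (Q x y) (Obj (Hom D x y))"
    and inj_arr: "\<And>x y. \<lbrakk>x \<in> Ob D; y \<in> Ob D\<rbrakk> \<Longrightarrow> inj_on (R x y) (Arr (Hom D x y))"
    and dom: "\<And>x y \<alpha>. \<lbrakk>x \<in> Ob D; y \<in> Ob D; \<alpha> \<in> Arr (Hom D x y)\<rbrakk> \<Longrightarrow>
      Dom (Hom D x y) \<alpha> \<in> Obj (Hom D x y) \<and>
      Dom (Hom E (P x) (P y)) (R x y \<alpha>) = Q x y (Dom (Hom D x y) \<alpha>)"
    and cod: "\<And>x y \<alpha>. \<lbrakk>x \<in> Ob D; y \<in> Ob D; \<alpha> \<in> Arr (Hom D x y)\<rbrakk> \<Longrightarrow>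
      Cod (Hom D x y) \<alpha> \<in> Obj (Hom D x y) \<and>
      Cod (Hom E (P x) (P y)) (R x y \<alpha>) = Q x y (Cod (Hom D x y) \<alpha>)"
    and idn: "\<And>x y f. \<lbrakk>x \<in> Ob D; y \<in> Ob D; f \<in> Obj (Hom D x y)\<rbrakk> \<Longrightarrow>
      Idn (Hom D x y) f \<in> Arr (Hom D x y) \<and>
      R x y (Idn (Hom D x y) f) = Idn (Hom E (P x) (P y)) (Q x y f)"
    and cmp: "\<And>x y \<alpha> \<beta>. \<lbrakk>x \<in> Ob D; y \<in> Ob D; \<alpha> \<in> Arr (Hom D x y); \<beta> \<in> Arr (Hom D x y);
      Dom (Hom D x y) \<beta> = Cod (Hom D x y) \<alpha>\<rbrakk> \<Longrightarrow>
      Cmp (Hom D x y) \<beta> \<alpha> \<in> Arr (Hom D x y) \<and>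
      R x y (Cmp (Hom D x y) \<beta> \<alpha>) = Cmp (Hom E (P x) (P y)) (R x y \<beta>) (R x y \<alpha>)"
    and one: "\<And>x. x \<in> Ob D \<Longrightarrow> One D x \<in> Obj (Hom D x x) \<and> Q x x (One D x) = One E (P x)"
    and compO: "\<And>x y z f g. \<lbrakk>x \<in> Ob D; y \<in> Ob D; z \<in> Ob D;
      f \<in> Obj (Hom D x y); g \<in> Obj (Hom D y z)\<rbrakk> \<Longrightarrow>
      CompO D x y z g f \<in> Obj (Hom D x z) \<and>
      Q x z (CompO D x y z g f) = CompO E (P x) (P y) (P z) (Q y z g) (Q x y f)"
    and compA: "\<And>x y z \<alpha> \<beta>. \<lbrakk>x \<in> Ob D; y \<in> Ob D; z \<in> Ob D;
      \<alpha> \<in> Arr (Hom D x y); \<beta> \<in> Arr (Hom D y z)\<rbrakk> \<Longrightarrow>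
      CompA D x y z \<beta> \<alpha> \<in> Arr (Hom D x z) \<and>
      R x z (CompA D x y z \<beta> \<alpha>) = CompA E (P x) (P y) (P z) (R y z \<beta>) (R x y \<alpha>)"
  shows "two_category D \<and> two_functor D E (restrict_two_fun D P Q R)"
proof -
  interpret E: two_category E by fact
  note [simp] = ob obj arr dom cod idn cmp one compO compA
  note eq_obj = inj_onD[OF inj_obj] and eq_arr = inj_onD[OF inj_arr]
  have hom: "category (Hom D x y)" if xy: "x \<in> Ob D" "y \<in> Ob D" for x y
  proof -
    interpret H: category "Hom E (P x) (P y)"
      using xy by (intro E.hom_category ob)
    note [simp] = xy
    \<comment> \<open>The premises do not state the endpoints of identities and composites of
      \<open>D\<close>; they are found by comparing, through the injective \<open>Q\<close>, with
      the endpoints of the images.\<close>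
    have [simp]: "Dom (Hom D x y) (Idn (Hom D x y) f) = f" "Cod (Hom D x y) (Idn (Hom D x y) f) = f"
      if "f \<in> Obj (Hom D x y)" for f
      using that dom[of x y "Idn (Hom D x y) f"] cod[of x y "Idn (Hom D x y) f"]
      by (auto intro!: eq_obj[of x y])
    have [simp]: "Dom (Hom D x y) (Cmp (Hom D x y) g f) = Dom (Hom D x y) f"
        "Cod (Hom D x y) (Cmp (Hom D x y) g f) = Cod (Hom D x y) g"
      if "f \<in> Arr (Hom D x y)" "g \<in> Arr (Hom D x y)" "Dom (Hom D x y) g = Cod (Hom D x y) f" for f g
      using that dom[of x y "Cmp (Hom D x y) g f"] cod[of x y "Cmp (Hom D x y) g f"]
      by (auto intro!: eq_obj[of x y])
    show ?thesis
    proof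
      show "Cmp (Hom D x y) (Idn (Hom D x y) (Cod (Hom D x y) f)) f = f"
        if "f \<in> Arr (Hom D x y)" for f
        using that H.cmp_idn_left[of "R x y f"] by (intro eq_arr[of x y]) simp_all
      show "Cmp (Hom D x y) f (Idn (Hom D x y) (Dom (Hom D x y) f)) = f"
        if "f \<in> Arr (Hom D x y)" for f
        using that H.cmp_idn_right[of "R x y f"] by (intro eq_arr[of x y]) simp_all
      show "Cmp (Hom D x y) (Cmp (Hom D x y) h g) f = Cmp (Hom D x y) h (Cmp (Hom D x y) g f)"
        if "f \<in> Arr (Hom D x y)" "g \<in> Arr (Hom D x y)" "h \<in> Arr (Hom D x y)"
          "Dom (Hom D x y) g = Cod (Hom D x y) f" "Dom (Hom D x y) h = Cod (Hom D x y) g" for f g h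
        using that by (intro eq_arr[of x y]) (simp_all add: H.cmp_assoc)
    qed simp_all
  qed
  have D: "two_category D"
  proof (rule two_category.intro)
    fix x y z assume [simp]: "x \<in> Ob D" "y \<in> Ob D" "z \<in> Ob D"
    show "cat_functor (prod_cat (Hom D y z) (Hom D x y)) (Hom D x z)
        (\<lambda>(g, f). CompO D x y z g f) (\<lambda>(\<beta>, \<alpha>). CompA D x y z \<beta> \<alpha>)"
    proof (intro cat_functor.intro cat_functor_axioms.intro)
      fix f assume f: "f \<in> Arr (prod_cat (Hom D y z) (Hom D x y))"
      obtain \<beta> \<alpha> where f_eq: "f = (\<beta>, \<alpha>)"
        by (cases f)
      have D: "Dom (Hom D x z) (CompA D x y z \<beta> \<alpha>) =
          CompO D x y z (Dom (Hom D y z) \<beta>) (Dom (Hom D x y) \<alpha>)"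
        using f dom[of x z "CompA D x y z \<beta> \<alpha>"] by (intro eq_obj[of x z]) (simp_all add: f_eq)
      have C: "Cod (Hom D x z) (CompA D x y z \<beta> \<alpha>) =
          CompO D x y z (Cod (Hom D y z) \<beta>) (Cod (Hom D x y) \<alpha>)"
        using f cod[of x z "CompA D x y z \<beta> \<alpha>"] by (intro eq_obj[of x z]) (simp_all add: f_eq)
      show "Dom (Hom D x z) (case f of (\<beta>, \<alpha>) \<Rightarrow> CompA D x y z \<beta> \<alpha>) =
          (case Dom (prod_cat (Hom D y z) (Hom D x y)) f of (g, f) \<Rightarrow> CompO D x y z g f)"
        "Cod (Hom D x z) (case f of (\<beta>, \<alpha>) \<Rightarrow> CompA D x y z \<beta> \<alpha>) =
          (case Cod (prod_cat (Hom D y z) (Hom D x y)) f of (g, f) \<Rightarrow> CompO D x y z g f)"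
        by (simp_all add: f_eq D C)
      fix g assume g: "g \<in> Arr (prod_cat (Hom D y z) (Hom D x y))"
        and gf: "Dom (prod_cat (Hom D y z) (Hom D x y)) g = Cod (prod_cat (Hom D y z) (Hom D x y)) f"
      obtain \<beta>' \<alpha>' where g_eq: "g = (\<beta>', \<alpha>')"
        by (cases g)
      have D': "Dom (Hom D x z) (CompA D x y z \<beta>' \<alpha>') =
          CompO D x y z (Dom (Hom D y z) \<beta>') (Dom (Hom D x y) \<alpha>')"
        using g dom[of x z "CompA D x y z \<beta>' \<alpha>'"] by (intro eq_obj[of x z]) (simp_all add: g_eq)
      show "(case Cmp (prod_cat (Hom D y z) (Hom D x y)) g f of (\<beta>, \<alpha>) \<Rightarrow> CompA D x y z \<beta> \<alpha>) =
        Cmp (Hom D x z) (case g of (\<beta>, \<alpha>) \<Rightarrow> CompA D x y z \<beta> \<alpha>)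
          (case f of (\<beta>, \<alpha>) \<Rightarrow> CompA D x y z \<beta> \<alpha>)"
        using f g gf by (intro eq_arr[of x z]) (simp_all add: f_eq g_eq C D')
    next
      fix a assume "a \<in> Obj (prod_cat (Hom D y z) (Hom D x y))"
      then show "(case Idn (prod_cat (Hom D y z) (Hom D x y)) a of (\<beta>, \<alpha>) \<Rightarrow> CompA D x y z \<beta> \<alpha>) =
          Idn (Hom D x z) (case a of (g, f) \<Rightarrow> CompO D x y z g f)"
        by (intro eq_arr[of x z]) auto
    qed (auto simp: hom category_prod_cat)
  next
    fix x y assume [simp]: "x \<in> Ob D" "y \<in> Ob D"
    show "CompO D x y y (One D y) f = f" if "f \<in> Obj (Hom D x y)" for f
      using that by (intro eq_obj[of x y]) simp_all
    show "CompO D x x y f (One D x) = f" if "f \<in> Obj (Hom D x y)" for f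
      using that by (intro eq_obj[of x y]) simp_all
    show "CompA D x y y (Idn (Hom D y y) (One D y)) \<alpha> = \<alpha>" if "\<alpha> \<in> Arr (Hom D x y)" for \<alpha>
      using that by (intro eq_arr[of x y]) simp_all
    show "CompA D x x y \<alpha> (Idn (Hom D x x) (One D x)) = \<alpha>" if "\<alpha> \<in> Arr (Hom D x y)" for \<alpha>
      using that by (intro eq_arr[of x y]) simp_all
  next
    fix w x y z assume [simp]: "w \<in> Ob D" "x \<in> Ob D" "y \<in> Ob D" "z \<in> Ob D"
    show "CompO D w x z (CompO D x y z h g) f = CompO D w y z h (CompO D w x y g f)"
      if "f \<in> Obj (Hom D w x)" "g \<in> Obj (Hom D x y)" "h \<in> Obj (Hom D y z)" for f g h
      using that by (intro eq_obj[of w z]) simp_all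
    show "CompA D w x z (CompA D x y z \<gamma> \<beta>) \<alpha> = CompA D w y z \<gamma> (CompA D w x y \<beta> \<alpha>)"
      if "\<alpha> \<in> Arr (Hom D w x)" "\<beta> \<in> Arr (Hom D x y)" "\<gamma> \<in> Arr (Hom D y z)" for \<alpha> \<beta> \<gamma>
      using that by (intro eq_arr[of w z]) simp_all
  qed (simp_all add: hom)
  have "two_functor D E (restrict_two_fun D P Q R)"
    by (intro two_functor_restrict cat_functor.intro cat_functor_axioms.intro)
      (simp_all add: D E hom E.hom_category)
  with D show ?thesis ..
qed


text \<open>Since \<open>F\<close> is bijective on 1-cells and on 2-cells, a choice of isomorphisms
  \<open>e b : F (g b) \<rightarrow> b\<close> determines a strict inverse 2-functor:
  \<open>G\<close> is the unique lift through \<open>F\<close> of conjugation by \<open>e\<close>.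
  The counit is \<open>e\<close> itself and the unit is the lift of its inverse; equations in
  \<open>D\<close> are checked after applying \<open>F\<close>.\<close>

lemma two_equivalentI:
  fixes D :: "('o, 'm, 'c) twocat" and E :: "('p, 'n, 'd) twocat"
  assumes F: "two_functor D E F"
    and bij_obj: "\<And>x y. \<lbrakk>x \<in> Ob D; y \<in> Ob D\<rbrakk> \<Longrightarrow>
      bij_betw (Fun1 F x y) (Obj (Hom D x y)) (Obj (Hom E (FunO F x) (FunO F y)))"
    and bij_arr: "\<And>x y. \<lbrakk>x \<in> Ob D; y \<in> Ob D\<rbrakk> \<Longrightarrow>
      bij_betw (Fun2 F x y) (Arr (Hom D x y)) (Arr (Hom E (FunO F x) (FunO F y)))"
    and ess: "\<And>b. b \<in> Ob E \<Longrightarrow> \<exists>a\<in>Ob D. \<exists>e. is_isomorphism E (FunO F a) b e"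
  shows "two_equivalent D E"
proof -
  interpret F: two_functor D E F by fact
  have inj_obj: "f = f'"
    if "Fun1 F x y f = Fun1 F x y f'" "x \<in> Ob D" "y \<in> Ob D" "f \<in> Obj (Hom D x y)" "f' \<in> Obj (Hom D x y)"
    for x y f f'
    using bij_betw_imp_inj_on[OF bij_obj[of x y]] that by (auto dest: inj_onD)
  have inj_arr: "f = f'"
    if "Fun2 F x y f = Fun2 F x y f'" "x \<in> Ob D" "y \<in> Ob D" "f \<in> Arr (Hom D x y)" "f' \<in> Arr (Hom D x y)"
    for x y f f'
    using bij_betw_imp_inj_on[OF bij_arr[of x y]] that by (auto dest: inj_onD)
  obtain g where g [simp]: "\<And>b. b \<in> Ob E \<Longrightarrow> g b \<in> Ob D"
    and "\<And>b. b \<in> Ob E \<Longrightarrow> \<exists>e. is_isomorphism E (FunO F (g b)) b e"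
    using ess by metis
  then obtain e e' where e [simp]: "\<And>b. b \<in> Ob E \<Longrightarrow> e b \<in> Obj (Hom E (FunO F (g b)) b)"
    and e' [simp]: "\<And>b. b \<in> Ob E \<Longrightarrow> e' b \<in> Obj (Hom E b (FunO F (g b)))"
    and e'_e: "\<And>b. b \<in> Ob E \<Longrightarrow> CompO E (FunO F (g b)) b (FunO F (g b)) (e' b) (e b) =
      One E (FunO F (g b))"
    and e_e': "\<And>b. b \<in> Ob E \<Longrightarrow> CompO E b (FunO F (g b)) b (e b) (e' b) = One E b"
    unfolding is_isomorphism_def by metis
  have [simp]: "CompO E w b (FunO F (g b)) (e' b) (CompO E w (FunO F (g b)) b (e b) h) = h"
    if "b \<in> Ob E" "w \<in> Ob E" "h \<in> Obj (Hom E w (FunO F (g b)))" for b w h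
    using that by (intro F.target.cancel(2)) (simp_all add: e'_e)
  have [simp]: "CompA E w b (FunO F (g b)) (Idn (Hom E b (FunO F (g b))) (e' b))
      (CompA E w (FunO F (g b)) b (Idn (Hom E (FunO F (g b)) b) (e b)) \<alpha>) = \<alpha>"
    if "b \<in> Ob E" "w \<in> Ob E" "\<alpha> \<in> Arr (Hom E w (FunO F (g b)))" for b w \<alpha>
    using that by (intro F.target.cancel(3)) (simp_all add: e'_e)
  have [simp]: "CompO E w (FunO F (g b)) b (e b) (CompO E w b (FunO F (g b)) (e' b) h) = h"
    if "b \<in> Ob E" "w \<in> Ob E" "h \<in> Obj (Hom E w b)" for b w h
    using that by (intro F.target.cancel(2)) (simp_all add: e_e')
  have [simp]: "CompA E w (FunO F (g b)) b (Idn (Hom E (FunO F (g b)) b) (e b))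
      (CompA E w b (FunO F (g b)) (Idn (Hom E b (FunO F (g b))) (e' b)) \<alpha>) = \<alpha>"
    if "b \<in> Ob E" "w \<in> Ob E" "\<alpha> \<in> Arr (Hom E w b)" for b w \<alpha>
    using that by (intro F.target.cancel(3)) (simp_all add: e_e')
  have idn_e_e' [simp]: "CompA E b (FunO F (g b)) b (Idn (Hom E (FunO F (g b)) b) (e b))
      (Idn (Hom E b (FunO F (g b))) (e' b)) = Idn (Hom E b b) (One E b)"
    if "b \<in> Ob E" for b
    using that by (intro F.target.cancel(1)) (simp_all add: e_e')
  have idn_e'_e [simp]: "CompA E (FunO F (g b)) b (FunO F (g b)) (Idn (Hom E b (FunO F (g b))) (e' b))
      (Idn (Hom E (FunO F (g b)) b) (e b)) = Idn (Hom E (FunO F (g b)) (FunO F (g b))) (One E (FunO F (g b)))"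
    if "b \<in> Ob E" for b
    using that by (intro F.target.cancel(1)) (simp_all add: e'_e)
  \<comment> \<open>\<open>Q b c f\<close> is the only 1-cell \<open>g b \<rightarrow> g c\<close>
    that \<open>F\<close> sends to \<open>e' c\<close> after \<open>f\<close> after
    \<open>e b\<close>; \<open>R\<close> does the same for 2-cells. In a composite the neighbouring
    factors \<open>e\<close> and \<open>e'\<close> cancel, which makes the lift functorial.\<close>
  define Q where "Q b c f = inv_into (Obj (Hom D (g b) (g c))) (Fun1 F (g b) (g c))
    (CompO E (FunO F (g b)) c (FunO F (g c)) (e' c) (CompO E (FunO F (g b)) b c f (e b)))" for b c f
  define R where "R b c \<alpha> = inv_into (Arr (Hom D (g b) (g c))) (Fun2 F (g b) (g c))
    (CompA E (FunO F (g b)) c (FunO F (g c)) (Idn (Hom E c (FunO F (g c))) (e' c))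
      (CompA E (FunO F (g b)) b c \<alpha> (Idn (Hom E (FunO F (g b)) b) (e b))))" for b c \<alpha>
  have Q [simp]: "Q b c f \<in> Obj (Hom D (g b) (g c))"
    "Fun1 F (g b) (g c) (Q b c f) =
      CompO E (FunO F (g b)) c (FunO F (g c)) (e' c) (CompO E (FunO F (g b)) b c f (e b))"
    if "b \<in> Ob E" "c \<in> Ob E" "f \<in> Obj (Hom E b c)" for b c f
    unfolding Q_def using that
    by (auto intro!: inv_into_into f_inv_into_f simp: bij_betw_imp_surj_on[OF bij_obj])
  have R [simp]: "R b c \<alpha> \<in> Arr (Hom D (g b) (g c))"
    "Fun2 F (g b) (g c) (R b c \<alpha>) =
      CompA E (FunO F (g b)) c (FunO F (g c)) (Idn (Hom E c (FunO F (g c))) (e' c))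
      (CompA E (FunO F (g b)) b c \<alpha> (Idn (Hom E (FunO F (g b)) b) (e b)))"
    if "b \<in> Ob E" "c \<in> Ob E" "\<alpha> \<in> Arr (Hom E b c)" for b c \<alpha>
    unfolding R_def using that
    by (auto intro!: inv_into_into f_inv_into_f simp: bij_betw_imp_surj_on[OF bij_arr])
  define G where "G = restrict_two_fun E g Q R"
  have G: "two_functor E D G"
    unfolding G_def
  proof (rule two_functor_restrict)
    fix b c assume [simp]: "b \<in> Ob E" "c \<in> Ob E"
    show "cat_functor (Hom E b c) (Hom D (g b) (g c)) (Q b c) (R b c)"
    proof (intro cat_functor.intro cat_functor_axioms.intro)
      fix f assume f [simp]: "f \<in> Arr (Hom E b c)"
      show "Dom (Hom D (g b) (g c)) (R b c f) = Q b c (Dom (Hom E b c) f)"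
        \<comment> \<open>\<open>R b c f\<close> is known only through its image, so its domain is
          found by computing the domain of the image in \<open>E\<close> and comparing the
          two.\<close>
        using F.fun_simps(3)[of "g b" "g c" "R b c f"]
        by (intro inj_obj[of "g b" "g c"]) (simp_all del: F.fun_simps(3))
      show "Cod (Hom D (g b) (g c)) (R b c f) = Q b c (Cod (Hom E b c) f)"
        using F.fun_simps(4)[of "g b" "g c" "R b c f"]
        by (intro inj_obj[of "g b" "g c"]) (simp_all del: F.fun_simps(4))
    next
      fix f h
      assume [simp]: "f \<in> Arr (Hom E b c)" "h \<in> Arr (Hom E b c)" "Dom (Hom E b c) h = Cod (Hom E b c) f"
      have [simp]: "Dom (Hom D (g b) (g c)) (R b c h) = Cod (Hom D (g b) (g c)) (R b c f)"
        using F.fun_simps(3)[of "g b" "g c" "R b c h"] F.fun_simps(4)[of "g b" "g c" "R b c f"]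
        by (intro inj_obj[of "g b" "g c"]) (simp_all del: F.fun_simps(3,4))
      show "R b c (Cmp (Hom E b c) h f) = Cmp (Hom D (g b) (g c)) (R b c h) (R b c f)"
        by (intro inj_arr[of "g b" "g c"]) simp_all
    next
      show "R b c (Idn (Hom E b c) f) = Idn (Hom D (g b) (g c)) (Q b c f)"
        if "f \<in> Obj (Hom E b c)" for f
        using that by (intro inj_arr[of "g b" "g c"]) simp_all
    qed (simp_all add: F.source.hom_category F.target.hom_category)
  next
    show "Q b b (One E b) = One D (g b)" if "b \<in> Ob E" for b
      using that by (intro inj_obj[of "g b" "g b"]) (simp_all add: e'_e)
    show "R a c (CompA E a b c \<beta> \<alpha>) = CompA D (g a) (g b) (g c) (R b c \<beta>) (R a b \<alpha>)"
      if "a \<in> Ob E" "b \<in> Ob E" "c \<in> Ob E" "\<alpha> \<in> Arr (Hom E a b)" "\<beta> \<in> Arr (Hom E b c)" for a b c \<alpha> \<beta>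
      using that by (intro inj_arr[of "g a" "g c"]) simp_all
  qed (simp_all add: F.source.two_category_axioms F.target.two_category_axioms)
  define \<epsilon> where "\<epsilon> = (\<lambda>b. if b \<in> Ob E then e b else undefined)"
  \<comment> \<open>The lifts \<theta> of \<open>e\<close> and \<eta> of \<open>e'\<close> at
    \<open>F x\<close> are mutually inverse because \<open>F\<close> is injective on 1-cells; \<eta>
    is the unit and \<theta> witnesses that it is invertible.\<close>
  define \<theta> where "\<theta> x = inv_into (Obj (Hom D (g (FunO F x)) x)) (Fun1 F (g (FunO F x)) x) (e (FunO F x))" for x
  define \<eta> where "\<eta> = (\<lambda>x. if x \<in> Ob D
    then inv_into (Obj (Hom D x (g (FunO F x)))) (Fun1 F x (g (FunO F x))) (e' (FunO F x)) else undefined)"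
  have [simp]: "\<theta> x \<in> Obj (Hom D (g (FunO F x)) x)" "Fun1 F (g (FunO F x)) x (\<theta> x) = e (FunO F x)"
    if "x \<in> Ob D" for x
    unfolding \<theta>_def using that
    by (auto intro!: inv_into_into f_inv_into_f simp: bij_betw_imp_surj_on[OF bij_obj])
  have [simp]: "\<eta> x \<in> Obj (Hom D x (g (FunO F x)))" "Fun1 F x (g (FunO F x)) (\<eta> x) = e' (FunO F x)"
    if "x \<in> Ob D" for x
    unfolding \<eta>_def using that
    by (auto intro!: inv_into_into f_inv_into_f simp: bij_betw_imp_surj_on[OF bij_obj])
  have "two_natural D D (id_two_fun D) (comp_two_fun D G F) \<eta>"
  proof (rule two_naturalI)
    show "two_functor D D (id_two_fun D)"
      by (rule two_functor_id) (rule F.source.two_category_axioms)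
    show "two_functor D D (comp_two_fun D G F)"
      by (rule two_functor_comp[OF F G])
    show "CompA D (FunO (id_two_fun D) x) (FunO (id_two_fun D) y) (FunO (comp_two_fun D G F) y)
        (Idn (Hom D (FunO (id_two_fun D) y) (FunO (comp_two_fun D G F) y)) (\<eta> y)) (Fun2 (id_two_fun D) x y \<mu>) =
      CompA D (FunO (id_two_fun D) x) (FunO (comp_two_fun D G F) x) (FunO (comp_two_fun D G F) y)
        (Fun2 (comp_two_fun D G F) x y \<mu>) (Idn (Hom D (FunO (id_two_fun D) x) (FunO (comp_two_fun D G F) x)) (\<eta> x))"
      if "x \<in> Ob D" "y \<in> Ob D" "\<mu> \<in> Arr (Hom D x y)" for x y \<mu>
      \<comment> \<open>After applying \<open>F\<close>, the right side is
        \<open>e' (F \<mu>) e\<close> followed on the right by \<open>e'\<close>; the last two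
        factors cancel and leave the left side.\<close>
      using that by (intro inj_arr[of x "g (FunO F y)"]) (simp_all add: G_def)
  qed (simp_all add: G_def, simp add: \<eta>_def)
  moreover have "is_isomorphism D (FunO (id_two_fun D) x) (FunO (comp_two_fun D G F) x) (\<eta> x)"
    if "x \<in> Ob D" for x
  proof -
    have "CompO D x (g (FunO F x)) x (\<theta> x) (\<eta> x) = One D x"
      using that by (intro inj_obj[of x x]) (simp_all add: e_e')
    moreover have "CompO D (g (FunO F x)) x (g (FunO F x)) (\<eta> x) (\<theta> x) = One D (g (FunO F x))"
      using that by (intro inj_obj[of "g (FunO F x)" "g (FunO F x)"]) (simp_all add: e'_e)
    ultimately show ?thesis
      unfolding is_isomorphism_def using that by (auto simp: G_def intro!: bexI[of _ "\<theta> x"])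
  qed
  moreover have "two_natural E E (comp_two_fun E F G) (id_two_fun E) \<epsilon>"
  proof (rule two_naturalI)
    show "two_functor E E (id_two_fun E)"
      by (rule two_functor_id) (rule F.target.two_category_axioms)
    show "two_functor E E (comp_two_fun E F G)"
      by (rule two_functor_comp[OF G F])
  qed (simp_all add: G_def \<epsilon>_def)
  moreover have "is_isomorphism E (FunO (comp_two_fun E F G) b) (FunO (id_two_fun E) b) (\<epsilon> b)"
    if "b \<in> Ob E" for b
    unfolding is_isomorphism_def using that
    by (auto simp: G_def \<epsilon>_def e_e' e'_e intro!: bexI[of _ "e' b"])
  ultimately show ?thesis
    unfolding two_equivalent_def two_natural_iso_def
    using F G F.source.two_category_axioms F.target.two_category_axioms by blast
qed

section \<open>Strict opposites\<close>

context contra_two_category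
begin

text \<open>A contravariant morphism with an inverse can be cancelled on either side, although
  whiskering with it changes the variance. The statement is one-sided, so that exchanging \<chi> and
  \<chi>' yields the remaining cancellations.\<close>

lemma whisker_inverse:
  assumes "x \<in> COb A" "x' \<in> COb A" "\<chi> \<in> Obj (CHom A Con x x')" "\<chi>' \<in> Obj (CHom A Con x' x)"
    and inv: "CCompO A Con Con x x' x \<chi>' \<chi> = COne A x"
  shows "CCompA A Con Con x x' x (Idn (CHom A Con x' x) \<chi>') (Idn (CHom A Con x x') \<chi>) =
      Idn (CHom A Cov x x) (COne A x)"
    and "\<lbrakk>w \<in> COb A; f \<in> Obj (CHom A v w x); t = Con \<odot> v\<rbrakk> \<Longrightarrow>
      CCompO A Con t w x' x \<chi>' (CCompO A Con v w x x' \<chi> f) = f"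
    and "\<lbrakk>w \<in> COb A; \<alpha> \<in> Arr (CHom A v w x); t = Con \<odot> v\<rbrakk> \<Longrightarrow>
      CCompA A Con t w x' x (Idn (CHom A Con x' x) \<chi>') (CCompA A Con v w x x' (Idn (CHom A Con x x') \<chi>) \<alpha>) = \<alpha>"
    and "\<lbrakk>y \<in> COb A; f \<in> Obj (CHom A v x y); t = v \<odot> Con\<rbrakk> \<Longrightarrow>
      CCompO A t Con x x' y (CCompO A v Con x' x y f \<chi>') \<chi> = f"
    and "\<lbrakk>y \<in> COb A; \<alpha> \<in> Arr (CHom A v x y); t = v \<odot> Con\<rbrakk> \<Longrightarrow>
      CCompA A t Con x x' y (CCompA A v Con x' x y \<alpha> (Idn (CHom A Con x' x) \<chi>')) (Idn (CHom A Con x x') \<chi>) = \<alpha>"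
proof -
  show *: "CCompA A Con Con x x' x (Idn (CHom A Con x' x) \<chi>') (Idn (CHom A Con x x') \<chi>) =
      Idn (CHom A Cov x x) (COne A x)"
    using assms comp_simps(5)[of x x' x Cov Con Con \<chi>' \<chi>] by simp
  show "CCompO A Con t w x' x \<chi>' (CCompO A Con v w x x' \<chi> f) = f"
    if "w \<in> COb A" "f \<in> Obj (CHom A v w x)" "t = Con \<odot> v"
    using assms that assocs(1)[of w x x' x Cov Con Con f v \<chi> \<chi>'] by simp
  show "CCompA A Con t w x' x (Idn (CHom A Con x' x) \<chi>') (CCompA A Con v w x x' (Idn (CHom A Con x x') \<chi>) \<alpha>) = \<alpha>"
    if "w \<in> COb A" "\<alpha> \<in> Arr (CHom A v w x)" "t = Con \<odot> v"
    using assms(1-4) * that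
      assocs(2)[of w x x' x Cov Con Con \<alpha> v "Idn (CHom A Con x x') \<chi>" "Idn (CHom A Con x' x) \<chi>'"]
    by simp
  show "CCompO A t Con x x' y (CCompO A v Con x' x y f \<chi>') \<chi> = f"
    if "y \<in> COb A" "f \<in> Obj (CHom A v x y)" "t = v \<odot> Con"
    using assms that by simp
  show "CCompA A t Con x x' y (CCompA A v Con x' x y \<alpha> (Idn (CHom A Con x' x) \<chi>')) (Idn (CHom A Con x x') \<chi>) = \<alpha>"
    if "y \<in> COb A" "\<alpha> \<in> Arr (CHom A v x y)" "t = v \<odot> Con"
    using assms(1-4) * that by simp
qed

text \<open>The outer argument of a composition is covariant for every variance; only the inner one
  is twisted. Precomposition therefore never reverses 2-cells, and the identity of \<open>h\<close>
  composes with itself in the same way with or without the twist.\<close>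

lemma whisker_functor:
  assumes "x \<in> COb A" "y \<in> COb A" "z \<in> COb A" "h \<in> Obj (CHom A w x y)" "t = v \<odot> w"
  shows "cat_functor (CHom A v y z) (CHom A t x z)
    (\<lambda>f. CCompO A v w x y z f h) (\<lambda>\<mu>. CCompA A v w x y z \<mu> (Idn (CHom A w x y) h))"
proof (intro cat_functor.intro cat_functor_axioms.intro)
  fix f g assume "f \<in> Arr (CHom A v y z)" "g \<in> Arr (CHom A v y z)"
    "Dom (CHom A v y z) g = Cod (CHom A v y z) f"
  moreover have "Cmp (var_cat v (CHom A w x y)) (Idn (CHom A w x y) h) (Idn (CHom A w x y) h) =
      Idn (CHom A w x y) h"
    using assms by (cases v) simp_all
  ultimately show "CCompA A v w x y z (Cmp (CHom A v y z) g f) (Idn (CHom A w x y) h) =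
      Cmp (CHom A t x z) (CCompA A v w x y z g (Idn (CHom A w x y) h))
        (CCompA A v w x y z f (Idn (CHom A w x y) h))"
    using assms interchange[of x y z t v w f g "Idn (CHom A w x y) h" "Idn (CHom A w x y) h"] by simp
qed (use assms in \<open>simp_all add: hom_category\<close>)

text \<open>The inverse functor is precomposition with \<chi>'.\<close>

lemma whisker_isomorphism:
  assumes "x \<in> COb A" "x' \<in> COb A" "\<chi> \<in> Obj (CHom A Con x x')" "\<chi>' \<in> Obj (CHom A Con x' x)"
    and inv: "CCompO A Con Con x x' x \<chi>' \<chi> = COne A x" "CCompO A Con Con x' x x' \<chi> \<chi>' = COne A x'"
    and "y \<in> COb A" "t = v \<odot> Con"
  shows "cat_isomorphism (CHom A v x' y) (CHom A t x y)
    (\<lambda>f. CCompO A v Con x x' y f \<chi>) (\<lambda>\<mu>. CCompA A v Con x x' y \<mu> (Idn (CHom A Con x x') \<chi>))"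
  unfolding cat_isomorphism_def
proof (intro conjI exI)
  show "cat_functor (CHom A v x' y) (CHom A t x y)
    (\<lambda>f. CCompO A v Con x x' y f \<chi>) (\<lambda>\<mu>. CCompA A v Con x x' y \<mu> (Idn (CHom A Con x x') \<chi>))"
    using assms by (intro whisker_functor) simp_all
  show "cat_functor (CHom A t x y) (CHom A v x' y)
    (\<lambda>f. CCompO A t Con x' x y f \<chi>') (\<lambda>\<mu>. CCompA A t Con x' x y \<mu> (Idn (CHom A Con x' x) \<chi>'))"
    using assms by (intro whisker_functor) simp_all
qed (use assms whisker_inverse[of x x' \<chi> \<chi>'] whisker_inverse[of x' x \<chi>' \<chi>] in auto)

lemma strict_oppositeI:
  assumes "x \<in> COb A" "x' \<in> COb A" "\<chi> \<in> Obj (CHom A Con x x')" "\<chi>' \<in> Obj (CHom A Con x' x)"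
    and "CCompO A Con Con x x' x \<chi>' \<chi> = COne A x" "CCompO A Con Con x' x x' \<chi> \<chi>' = COne A x'"
  shows "strict_opposite A x x' \<chi>"
  unfolding strict_opposite_def using assms by (auto intro!: whisker_isomorphism)

text \<open>The inverse is the preimage of the identity of \<open>x\<close> under the second
  isomorphism of categories, taken at \<open>y = x\<close>. It is a left inverse by construction; it
  is a right inverse because \<chi> \<chi>' \<chi> = \<chi> and precomposition with \<chi> is
  injective on covariant endomorphisms of \<open>x'\<close>.\<close>

lemma strict_oppositeE:
  assumes "strict_opposite A x x' \<chi>" "x \<in> COb A"
  obtains \<chi>' where "x' \<in> COb A" "\<chi> \<in> Obj (CHom A Con x x')" "\<chi>' \<in> Obj (CHom A Con x' x)"
    "CCompO A Con Con x x' x \<chi>' \<chi> = COne A x" "CCompO A Con Con x' x x' \<chi> \<chi>' = COne A x'"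
proof -
  have [simp]: "x' \<in> COb A" "\<chi> \<in> Obj (CHom A Con x x')" "x \<in> COb A"
    using assms by (simp_all add: strict_opposite_def)
  have "cat_isomorphism (CHom A Con x' x) (CHom A Cov x x) (\<lambda>f. CCompO A Con Con x x' x f \<chi>)
      (\<lambda>\<mu>. CCompA A Con Con x x' x \<mu> (Idn (CHom A Con x x') \<chi>))"
    using assms by (simp add: strict_opposite_def)
  then obtain \<chi>' where \<chi>' [simp]: "\<chi>' \<in> Obj (CHom A Con x' x)"
    and inv: "CCompO A Con Con x x' x \<chi>' \<chi> = COne A x"
    unfolding cat_isomorphism_def
    by (metis (no_types, lifting) \<open>x \<in> COb A\<close> cat_functor.map_obj one_obj)
  have "cat_isomorphism (CHom A Cov x' x') (CHom A Con x x') (\<lambda>f. CCompO A Cov Con x x' x' f \<chi>)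
      (\<lambda>\<mu>. CCompA A Cov Con x x' x' \<mu> (Idn (CHom A Con x x') \<chi>))"
    using assms by (simp add: strict_opposite_def)
  then have "inj_on (\<lambda>f. CCompO A Cov Con x x' x' f \<chi>) (Obj (CHom A Cov x' x'))"
    unfolding cat_isomorphism_def by (metis (no_types, lifting) inj_onI)
  moreover have "CCompO A Cov Con x x' x' (CCompO A Con Con x' x x' \<chi> \<chi>') \<chi> =
      CCompO A Cov Con x x' x' (COne A x') \<chi>"
    by (simp add: inv)
  ultimately have "CCompO A Con Con x' x x' \<chi> \<chi>' = COne A x'"
    by (rule inj_onD) simp_all
  with inv show ?thesis
    by (intro that) simp_all
qed

end

section \<open>From strong duality involutions to contravariance\<close>

lemma co_simps [simp]:
  "Ob (co A) = Ob A" "Hom (co A) x y = op_cat (Hom A x y)" "One (co A) = One A"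
  "CompO (co A) = CompO A" "CompA (co A) = CompA A"
  by (simp_all add: co_def)

text \<open>The action on \<open>A\<close> of the group of variances, in which \<open>Con\<close> acts by \<open>(-)\<degree>\<close>, and the
  comparison \<open>dcmp A v w x : x\<^sup>v\<^sup>w \<rightarrow> (x\<^sup>w)\<^sup>v\<close>.\<close>

fun dob :: "('o, 'm, 'c) dual_twocat \<Rightarrow> variance \<Rightarrow> 'o \<Rightarrow> 'o" where
  "dob A Cov x = x"
| "dob A Con x = FunO (Inv A) x"

fun dmap1 :: "('o, 'm, 'c) dual_twocat \<Rightarrow> variance \<Rightarrow> 'o \<Rightarrow> 'o \<Rightarrow> 'm \<Rightarrow> 'm" where
  "dmap1 A Cov x y f = f"
| "dmap1 A Con x y f = Fun1 (Inv A) x y f"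

fun dmap2 :: "('o, 'm, 'c) dual_twocat \<Rightarrow> variance \<Rightarrow> 'o \<Rightarrow> 'o \<Rightarrow> 'c \<Rightarrow> 'c" where
  "dmap2 A Cov x y \<alpha> = \<alpha>"
| "dmap2 A Con x y \<alpha> = Fun2 (Inv A) x y \<alpha>"

fun dcmp :: "('o, 'm, 'c) dual_twocat \<Rightarrow> variance \<Rightarrow> variance \<Rightarrow> 'o \<Rightarrow> 'm" where
  "dcmp A Con Con x = Dunit A x"
| "dcmp A Cov w x = One (Und A) (dob A w x)"
| "dcmp A Con Cov x = One (Und A) (FunO (Inv A) x)"

lemma dcmp_Cov [simp]: "dcmp A v Cov x = One (Und A) (dob A v x)"
  by (cases v) simp_all

text \<open>One formula gives all four compositions: \<open>g : y^v \<rightarrow> z\<close> and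
  \<open>f : x^w \<rightarrow> y\<close> compose to \<open>g\<close> after \<open>f^v\<close> after
  \<open>dcmp A v w x\<close>. The last factor differs from an identity only when both morphisms are
  contravariant.\<close>

definition contra_of :: "('o, 'm, 'c) dual_twocat \<Rightarrow> ('o, 'm, 'c) contra_twocat" where
  "contra_of A = \<lparr>
     COb = Ob (Und A),
     CHom = (\<lambda>v x y. Hom (Und A) (dob A v x) y),
     COne = One (Und A),
     CCompO = (\<lambda>v w x y z g f. CompO (Und A) (dob A (v \<odot> w) x) (dob A v y) z g
       (CompO (Und A) (dob A (v \<odot> w) x) (dob A v (dob A w x)) (dob A v y)
         (dmap1 A v (dob A w x) y f) (dcmp A v w x))),
     CCompA = (\<lambda>v w x y z \<beta> \<alpha>. CompA (Und A) (dob A (v \<odot> w) x) (dob A v y) z \<beta>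
       (CompA (Und A) (dob A (v \<odot> w) x) (dob A v (dob A w x)) (dob A v y)
         (dmap2 A v (dob A w x) y \<alpha>)
         (Idn (Hom (Und A) (dob A (v \<odot> w) x) (dob A v (dob A w x))) (dcmp A v w x))))\<rparr>"

lemma contra_of_simps [simp]:
  "COb (contra_of A) = Ob (Und A)"
  "CHom (contra_of A) v x y = Hom (Und A) (dob A v x) y"
  "COne (contra_of A) = One (Und A)"
  "CCompO (contra_of A) v w x y z g f = CompO (Und A) (dob A (v \<odot> w) x) (dob A v y) z g
       (CompO (Und A) (dob A (v \<odot> w) x) (dob A v (dob A w x)) (dob A v y)
         (dmap1 A v (dob A w x) y f) (dcmp A v w x))"
  "CCompA (contra_of A) v w x y z \<beta> \<alpha> = CompA (Und A) (dob A (v \<odot> w) x) (dob A v y) z \<beta>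
       (CompA (Und A) (dob A (v \<odot> w) x) (dob A v (dob A w x)) (dob A v y)
         (dmap2 A v (dob A w x) y \<alpha>)
         (Idn (Hom (Und A) (dob A (v \<odot> w) x) (dob A v (dob A w x))) (dcmp A v w x)))"
  by (simp_all add: contra_of_def)

locale strong_dual =
  fixes A :: "('o, 'm, 'c) dual_twocat"
  assumes strong_duality: "strong_duality A"
begin

sublocale two_category "Und A"
  using strong_duality by (simp add: strong_duality_def)

sublocale Inv: two_functor "co (Und A)" "Und A" "Inv A"
  using strong_duality by (simp add: strong_duality_def)

sublocale Dunit: two_natural "Und A" "Und A" "id_two_fun (Und A)"
    "comp_two_fun (Und A) (Inv A) (Inv A)" "Dunit A"
  using strong_duality by (simp add: strong_duality_def two_natural_iso_def)

lemma Inv_ob [simp]: "x \<in> Ob (Und A) \<Longrightarrow> FunO (Inv A) x \<in> Ob (Und A)"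
  using Inv.fun_ob by simp

text \<open>As a 2-functor out of \<open>co\<close>, \<open>Inv A\<close> has its laws in opposite
  hom-categories; here they are moved to \<open>Und A\<close>, with 2-cells reversed and 1-cells
  not.\<close>

lemma Inv_simps [simp]:
  assumes "x \<in> Ob (Und A)" "y \<in> Ob (Und A)"
  shows "\<alpha> \<in> Arr (Hom (Und A) x y) \<Longrightarrow>
      Dom (Hom (Und A) (FunO (Inv A) x) (FunO (Inv A) y)) (Fun2 (Inv A) x y \<alpha>) =
      Fun1 (Inv A) x y (Cod (Hom (Und A) x y) \<alpha>)"
    and "\<alpha> \<in> Arr (Hom (Und A) x y) \<Longrightarrow>
      Cod (Hom (Und A) (FunO (Inv A) x) (FunO (Inv A) y)) (Fun2 (Inv A) x y \<alpha>) =
      Fun1 (Inv A) x y (Dom (Hom (Und A) x y) \<alpha>)"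
    and "f \<in> Obj (Hom (Und A) x y) \<Longrightarrow> Fun2 (Inv A) x y (Idn (Hom (Und A) x y) f) =
      Idn (Hom (Und A) (FunO (Inv A) x) (FunO (Inv A) y)) (Fun1 (Inv A) x y f)"
    and "\<lbrakk>\<alpha> \<in> Arr (Hom (Und A) x y); \<beta> \<in> Arr (Hom (Und A) x y);
      Dom (Hom (Und A) x y) \<beta> = Cod (Hom (Und A) x y) \<alpha>\<rbrakk> \<Longrightarrow>
      Fun2 (Inv A) x y (Cmp (Hom (Und A) x y) \<beta> \<alpha>) =
      Cmp (Hom (Und A) (FunO (Inv A) x) (FunO (Inv A) y)) (Fun2 (Inv A) x y \<alpha>) (Fun2 (Inv A) x y \<beta>)"
    and "\<lbrakk>z \<in> Ob (Und A); f \<in> Obj (Hom (Und A) x y); g \<in> Obj (Hom (Und A) y z)\<rbrakk> \<Longrightarrow>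
      Fun1 (Inv A) x z (CompO (Und A) x y z g f) = CompO (Und A) (FunO (Inv A) x) (FunO (Inv A) y)
        (FunO (Inv A) z) (Fun1 (Inv A) y z g) (Fun1 (Inv A) x y f)"
    and "\<lbrakk>z \<in> Ob (Und A); \<alpha> \<in> Arr (Hom (Und A) x y); \<beta> \<in> Arr (Hom (Und A) y z)\<rbrakk> \<Longrightarrow>
      Fun2 (Inv A) x z (CompA (Und A) x y z \<beta> \<alpha>) = CompA (Und A) (FunO (Inv A) x) (FunO (Inv A) y)
        (FunO (Inv A) z) (Fun2 (Inv A) y z \<beta>) (Fun2 (Inv A) x y \<alpha>)"
  using assms Inv.fun_simps[of x y] Inv.fun_comp_obj[of x y z]
    Inv.fun_comp_arr[of x y z] by simp_all

lemma Inv_one [simp]: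
  "x \<in> Ob (Und A) \<Longrightarrow> Fun1 (Inv A) x x (One (Und A) x) = One (Und A) (FunO (Inv A) x)"
  using Inv.fun_one[of x] by simp

lemma dob [simp]: "x \<in> Ob (Und A) \<Longrightarrow> dob A v x \<in> Ob (Und A)"
  by (cases v) simp_all

lemma dmap_simps [simp]:
  assumes "x \<in> Ob (Und A)" "y \<in> Ob (Und A)"
  shows "f \<in> Obj (Hom (Und A) x y) \<Longrightarrow> dmap1 A v x y f \<in> Obj (Hom (Und A) (dob A v x) (dob A v y))"
    and "\<alpha> \<in> Arr (Hom (Und A) x y) \<Longrightarrow> dmap2 A v x y \<alpha> \<in> Arr (Hom (Und A) (dob A v x) (dob A v y))"
    and "\<alpha> \<in> Arr (Hom (Und A) x y) \<Longrightarrow>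
      Dom (Hom (Und A) (dob A v x) (dob A v y)) (dmap2 A v x y \<alpha>) =
      dmap1 A v x y (Dom (var_cat v (Hom (Und A) x y)) \<alpha>)"
    and "\<alpha> \<in> Arr (Hom (Und A) x y) \<Longrightarrow>
      Cod (Hom (Und A) (dob A v x) (dob A v y)) (dmap2 A v x y \<alpha>) =
      dmap1 A v x y (Cod (var_cat v (Hom (Und A) x y)) \<alpha>)"
    and "f \<in> Obj (Hom (Und A) x y) \<Longrightarrow> dmap2 A v x y (Idn (Hom (Und A) x y) f) =
      Idn (Hom (Und A) (dob A v x) (dob A v y)) (dmap1 A v x y f)"
    and "\<lbrakk>\<alpha> \<in> Arr (Hom (Und A) x y); \<beta> \<in> Arr (Hom (Und A) x y);
      Dom (var_cat v (Hom (Und A) x y)) \<beta> = Cod (var_cat v (Hom (Und A) x y)) \<alpha>\<rbrakk> \<Longrightarrow>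
      dmap2 A v x y (Cmp (var_cat v (Hom (Und A) x y)) \<beta> \<alpha>) =
      Cmp (Hom (Und A) (dob A v x) (dob A v y)) (dmap2 A v x y \<beta>) (dmap2 A v x y \<alpha>)"
    and "\<lbrakk>z \<in> Ob (Und A); f \<in> Obj (Hom (Und A) x y); g \<in> Obj (Hom (Und A) y z)\<rbrakk> \<Longrightarrow>
      dmap1 A v x z (CompO (Und A) x y z g f) =
      CompO (Und A) (dob A v x) (dob A v y) (dob A v z) (dmap1 A v y z g) (dmap1 A v x y f)"
    and "\<lbrakk>z \<in> Ob (Und A); \<alpha> \<in> Arr (Hom (Und A) x y); \<beta> \<in> Arr (Hom (Und A) y z)\<rbrakk> \<Longrightarrow>
      dmap2 A v x z (CompA (Und A) x y z \<beta> \<alpha>) =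
      CompA (Und A) (dob A v x) (dob A v y) (dob A v z) (dmap2 A v y z \<beta>) (dmap2 A v x y \<alpha>)"
  using assms Inv.fun_simps(1,2)[of x y] by (cases v; simp)+

lemma dmap1_one [simp]:
  "x \<in> Ob (Und A) \<Longrightarrow> dmap1 A v x x (One (Und A) x) = One (Und A) (dob A v x)"
  by (cases v) simp_all

lemma Dunit_obj [simp]:
  "x \<in> Ob (Und A) \<Longrightarrow> Dunit A x \<in> Obj (Hom (Und A) x (FunO (Inv A) (FunO (Inv A) x)))"
  using Dunit.cpt_obj[of x] by simp

lemma dcmp_obj [simp]:
  "x \<in> Ob (Und A) \<Longrightarrow> t = v \<odot> w \<Longrightarrow>
    dcmp A v w x \<in> Obj (Hom (Und A) (dob A t x) (dob A v (dob A w x)))"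
  by (cases v; cases w) simp_all

text \<open>For \<open>v = w = Con\<close> this is naturality of the unit; in the other cases both
  comparisons are identities.\<close>

lemma dcmp_natural [simp]:
  assumes "x \<in> Ob (Und A)" "y \<in> Ob (Und A)" "\<mu> \<in> Arr (Hom (Und A) x y)" "t = v \<odot> w"
  shows "CompA (Und A) (dob A t x) (dob A t y) (dob A v (dob A w y))
      (Idn (Hom (Und A) (dob A t y) (dob A v (dob A w y))) (dcmp A v w y)) (dmap2 A t x y \<mu>) =
    CompA (Und A) (dob A t x) (dob A v (dob A w x)) (dob A v (dob A w y))
      (dmap2 A v (dob A w x) (dob A w y) (dmap2 A w x y \<mu>))
      (Idn (Hom (Und A) (dob A t x) (dob A v (dob A w x))) (dcmp A v w x))"
proof -
  have "CompA (Und A) x y (FunO (Inv A) (FunO (Inv A) y))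
      (Idn (Hom (Und A) y (FunO (Inv A) (FunO (Inv A) y))) (Dunit A y)) \<mu> =
    CompA (Und A) x (FunO (Inv A) (FunO (Inv A) x)) (FunO (Inv A) (FunO (Inv A) y))
      (Fun2 (Inv A) (FunO (Inv A) x) (FunO (Inv A) y) (Fun2 (Inv A) x y \<mu>))
      (Idn (Hom (Und A) x (FunO (Inv A) (FunO (Inv A) x))) (Dunit A x))"
    using Dunit.naturality_arr[of x y \<mu>] assms by simp
  then show ?thesis
    using assms Inv.fun_simps(1,2)[of x y] by (cases v; cases w) simp_all
qed

lemma dcmp_natural_assoc [simp]:
  assumes "x \<in> Ob (Und A)" "y \<in> Ob (Und A)" "\<mu> \<in> Arr (Hom (Und A) x y)" "t = v \<odot> w"
    "a \<in> Ob (Und A)" "\<nu> \<in> Arr (Hom (Und A) a (dob A t x))"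
  shows "CompA (Und A) a (dob A t y) (dob A v (dob A w y))
      (Idn (Hom (Und A) (dob A t y) (dob A v (dob A w y))) (dcmp A v w y))
      (CompA (Und A) a (dob A t x) (dob A t y) (dmap2 A t x y \<mu>) \<nu>) =
    CompA (Und A) a (dob A v (dob A w x)) (dob A v (dob A w y))
      (dmap2 A v (dob A w x) (dob A w y) (dmap2 A w x y \<mu>))
      (CompA (Und A) a (dob A t x) (dob A v (dob A w x))
      (Idn (Hom (Und A) (dob A t x) (dob A v (dob A w x))) (dcmp A v w x)) \<nu>)"
  using assms assoc_arr[of a "dob A t x" "dob A t y" "dob A v (dob A w y)" \<nu> "dmap2 A t x y \<mu>"
      "Idn (Hom (Und A) (dob A t y) (dob A v (dob A w y))) (dcmp A v w y)"]
  by (simp del: assoc_arr) simp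

lemma Dunit_Inv:
  "x \<in> Ob (Und A) \<Longrightarrow> Dunit A (FunO (Inv A) x) =
    Fun1 (Inv A) x (FunO (Inv A) (FunO (Inv A) x)) (Dunit A x)"
  using strong_duality by (simp add: strong_duality_def)

text \<open>This is the condition that associativity of \<open>contra_of\<close> imposes on the
  comparisons. For three contravariant signs it says that the unit at \<open>x^o\<close> is the
  involution applied to the unit at \<open>x\<close>; in the other seven cases enough comparisons
  are identities for the unit laws to decide it.\<close>

lemma dcmp_cocycle:
  assumes "x \<in> Ob (Und A)"
  shows "CompO (Und A) (dob A (u \<odot> (v \<odot> w)) x) (dob A (u \<odot> v) (dob A w x)) (dob A u (dob A v (dob A w x)))
      (dcmp A u v (dob A w x)) (dcmp A (u \<odot> v) w x) =
    CompO (Und A) (dob A (u \<odot> (v \<odot> w)) x) (dob A u (dob A (v \<odot> w) x)) (dob A u (dob A v (dob A w x)))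
      (dmap1 A u (dob A (v \<odot> w) x) (dob A v (dob A w x)) (dcmp A v w x)) (dcmp A u (v \<odot> w) x)"
  using assms Inv.fun_simps(1,2) by (cases u; cases v; cases w) (simp_all add: Dunit_Inv)

lemma dcmp_cocycle_arr:
  assumes "x \<in> Ob (Und A)" "t = u \<odot> v" "s = u \<odot> (v \<odot> w)"
  shows "CompA (Und A) (dob A s x) (dob A t (dob A w x)) (dob A u (dob A v (dob A w x)))
      (Idn (Hom (Und A) (dob A t (dob A w x)) (dob A u (dob A v (dob A w x)))) (dcmp A u v (dob A w x)))
      (Idn (Hom (Und A) (dob A s x) (dob A t (dob A w x))) (dcmp A t w x)) =
    CompA (Und A) (dob A s x) (dob A u (dob A (v \<odot> w) x)) (dob A u (dob A v (dob A w x)))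
      (Idn (Hom (Und A) (dob A u (dob A (v \<odot> w) x)) (dob A u (dob A v (dob A w x))))
        (dmap1 A u (dob A (v \<odot> w) x) (dob A v (dob A w x)) (dcmp A v w x)))
      (Idn (Hom (Und A) (dob A s x) (dob A u (dob A (v \<odot> w) x))) (dcmp A u (v \<odot> w) x))"
  using assms arg_cong[OF dcmp_cocycle[of x u v w],
      of "Idn (Hom (Und A) (dob A s x) (dob A u (dob A v (dob A w x))))"] by simp

lemma Dunit_inverse:
  assumes "x \<in> Ob (Und A)"
  obtains d where "d \<in> Obj (Hom (Und A) (FunO (Inv A) (FunO (Inv A) x)) x)"
    "CompO (Und A) x (FunO (Inv A) (FunO (Inv A) x)) x d (Dunit A x) = One (Und A) x"
    "CompO (Und A) (FunO (Inv A) (FunO (Inv A) x)) x (FunO (Inv A) (FunO (Inv A) x)) (Dunit A x) d =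
      One (Und A) (FunO (Inv A) (FunO (Inv A) x))"
proof -
  have "is_isomorphism (Und A) x (FunO (Inv A) (FunO (Inv A) x)) (Dunit A x)"
    using strong_duality assms by (auto simp: strong_duality_def two_natural_iso_def)
  then show ?thesis
    unfolding is_isomorphism_def by (auto intro: that)
qed

lemma contra_two_category_contra_of: "contra_two_category (contra_of A)"
proof (rule contra_two_categoryI)
  fix v w x y z assume "x \<in> COb (contra_of A)" "y \<in> COb (contra_of A)" "z \<in> COb (contra_of A)"
  then have [simp]: "x \<in> Ob (Und A)" "y \<in> Ob (Und A)" "z \<in> Ob (Und A)"
    by simp_all
  show "cat_functor (prod_cat (CHom (contra_of A) v y z) (var_cat v (CHom (contra_of A) w x y)))
        (CHom (contra_of A) (v \<odot> w) x z)
        (\<lambda>(g, f). CCompO (contra_of A) v w x y z g f) (\<lambda>(\<beta>, \<alpha>). CCompA (contra_of A) v w x y z \<beta> \<alpha>)"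
    by (intro cat_functor.intro cat_functor_axioms.intro)
      (auto simp: hom_category category_prod_cat category_var_cat)
next
  show "CCompA (contra_of A) (u \<odot> v) w a b d (CCompA (contra_of A) u v b c d \<gamma> \<beta>) \<alpha> =
      CCompA (contra_of A) u (v \<odot> w) a c d \<gamma> (CCompA (contra_of A) v w a b c \<beta> \<alpha>)"
    if "a \<in> COb (contra_of A)" "b \<in> COb (contra_of A)" "c \<in> COb (contra_of A)" "d \<in> COb (contra_of A)"
      "\<alpha> \<in> Arr (CHom (contra_of A) w a b)" "\<beta> \<in> Arr (CHom (contra_of A) v b c)"
      "\<gamma> \<in> Arr (CHom (contra_of A) u c d)" for u v w a b c d \<alpha> \<beta> \<gamma>
    \<comment> \<open>Naturality moves the comparison to the right of \<alpha>; what then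
      distinguishes the two sides is the two composites of comparisons in the cocycle
      equation.\<close>
    using that by (simp add: dcmp_cocycle_arr)
qed (auto simp: hom_category)

sublocale C: contra_two_category "contra_of A"
  by (rule contra_two_category_contra_of)

text \<open>The identity of \<open>x^o\<close>, read as a contravariant morphism
  \<open>x \<rightarrow> x^o\<close>, has as inverse the inverse
  \<open>d : x^oo \<rightarrow> x\<close> of the unit, read as a contravariant morphism
  \<open>x^o \<rightarrow> x\<close>.\<close>

lemma has_strict_opposites_contra_of: "has_strict_opposites (contra_of A)"
  unfolding has_strict_opposites_def
proof (intro ballI exI)
  fix x assume "x \<in> COb (contra_of A)"
  then have [simp]: "x \<in> Ob (Und A)"
    by simp
  obtain d where [simp]: "d \<in> Obj (Hom (Und A) (FunO (Inv A) (FunO (Inv A) x)) x)"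
    and d: "CompO (Und A) x (FunO (Inv A) (FunO (Inv A) x)) x d (Dunit A x) = One (Und A) x"
    "CompO (Und A) (FunO (Inv A) (FunO (Inv A) x)) x (FunO (Inv A) (FunO (Inv A) x)) (Dunit A x) d =
      One (Und A) (FunO (Inv A) (FunO (Inv A) x))"
    by (rule Dunit_inverse[of x]) simp_all
  show "strict_opposite (contra_of A) x (FunO (Inv A) x) (One (Und A) (FunO (Inv A) x))"
  proof (rule C.strict_oppositeI[where \<chi>' = d])
    show "CCompO (contra_of A) Con Con (FunO (Inv A) x) x (FunO (Inv A) x)
        (One (Und A) (FunO (Inv A) x)) d = COne (contra_of A) (FunO (Inv A) x)"
      \<comment> \<open>The composite unfolds to \<open>d^o\<close> after the unit at
        \<open>x^o\<close>. That unit is the involution applied to \<open>Dunit A x\<close>, so the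
        whole is the involution applied to \<open>d\<close> after \<open>Dunit A x\<close>, an
        identity.\<close>
      using arg_cong[OF d(1), of "Fun1 (Inv A) x x"] Inv.fun_simps(1) by (simp add: Dunit_Inv)
  qed (simp_all add: d)
qed

end

section \<open>From duality 2-functors to 2-functors preserving contravariance\<close>

fun dcns :: "('p, 'n, 'd) dual_twocat \<Rightarrow> ('o, 'm, 'c, 'p, 'n, 'd) dual_fun \<Rightarrow> variance \<Rightarrow> 'o \<Rightarrow> 'n" where
  "dcns B F Cov x = One (Und B) (FunO (Fun F) x)"
| "dcns B F Con x = Cns F x"

definition contra_fun_of :: "('o, 'm, 'c) dual_twocat \<Rightarrow> ('p, 'n, 'd) dual_twocat \<Rightarrow>
    ('o, 'm, 'c, 'p, 'n, 'd) dual_fun \<Rightarrow> ('o, 'm, 'c, 'p, 'n, 'd) contra_fun" where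
  "contra_fun_of A B F = \<lparr>
     CFunO = FunO (Fun F),
     CFun1 = (\<lambda>v x y f. if x \<in> Ob (Und A) \<and> y \<in> Ob (Und A) \<and> f \<in> Obj (Hom (Und A) (dob A v x) y)
       then CompO (Und B) (dob B v (FunO (Fun F) x)) (FunO (Fun F) (dob A v x)) (FunO (Fun F) y)
         (Fun1 (Fun F) (dob A v x) y f) (dcns B F v x)
       else undefined),
     CFun2 = (\<lambda>v x y \<alpha>. if x \<in> Ob (Und A) \<and> y \<in> Ob (Und A) \<and> \<alpha> \<in> Arr (Hom (Und A) (dob A v x) y)
       then CompA (Und B) (dob B v (FunO (Fun F) x)) (FunO (Fun F) (dob A v x)) (FunO (Fun F) y)
         (Fun2 (Fun F) (dob A v x) y \<alpha>)
         (Idn (Hom (Und B) (dob B v (FunO (Fun F) x)) (FunO (Fun F) (dob A v x))) (dcns B F v x))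
       else undefined)\<rparr>"

lemma contra_fun_of_simps [simp]:
  "CFunO (contra_fun_of A B F) = FunO (Fun F)"
  "\<lbrakk>x \<in> Ob (Und A); y \<in> Ob (Und A); f \<in> Obj (Hom (Und A) (dob A v x) y)\<rbrakk> \<Longrightarrow>
    CFun1 (contra_fun_of A B F) v x y f =
    CompO (Und B) (dob B v (FunO (Fun F) x)) (FunO (Fun F) (dob A v x)) (FunO (Fun F) y)
      (Fun1 (Fun F) (dob A v x) y f) (dcns B F v x)"
  "\<lbrakk>x \<in> Ob (Und A); y \<in> Ob (Und A); \<alpha> \<in> Arr (Hom (Und A) (dob A v x) y)\<rbrakk> \<Longrightarrow>
    CFun2 (contra_fun_of A B F) v x y \<alpha> =
    CompA (Und B) (dob B v (FunO (Fun F) x)) (FunO (Fun F) (dob A v x)) (FunO (Fun F) y)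
      (Fun2 (Fun F) (dob A v x) y \<alpha>)
      (Idn (Hom (Und B) (dob B v (FunO (Fun F) x)) (FunO (Fun F) (dob A v x))) (dcns B F v x))"
  by (simp_all add: contra_fun_of_def)

text \<open>The constraint of a duality 2-functor is recovered as the image of the universal
  contravariant morphism \<open>x \<rightarrow> x\<degree>\<close>, which is the identity of \<open>x\<degree>\<close>.\<close>

definition dual_fun_of :: "('o, 'm, 'c) dual_twocat \<Rightarrow>
    ('o, 'm, 'c, 'p, 'n, 'd) contra_fun \<Rightarrow> ('o, 'm, 'c, 'p, 'n, 'd) dual_fun" where
  "dual_fun_of A H = \<lparr>
     Fun = \<lparr>FunO = CFunO H, Fun1 = CFun1 H Cov, Fun2 = CFun2 H Cov\<rparr>,
     Cns = (\<lambda>x. if x \<in> Ob (Und A)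
       then CFun1 H Con x (FunO (Inv A) x) (One (Und A) (FunO (Inv A) x)) else undefined)\<rparr>"

lemma dual_fun_of_simps [simp]:
  "FunO (Fun (dual_fun_of A H)) = CFunO H"
  "Fun1 (Fun (dual_fun_of A H)) = CFun1 H Cov"
  "Fun2 (Fun (dual_fun_of A H)) = CFun2 H Cov"
  "x \<in> Ob (Und A) \<Longrightarrow>
    Cns (dual_fun_of A H) x = CFun1 H Con x (FunO (Inv A) x) (One (Und A) (FunO (Inv A) x))"
  "x \<notin> Ob (Und A) \<Longrightarrow> Cns (dual_fun_of A H) x = undefined"
  by (simp_all add: dual_fun_of_def)

lemma op_cat_op_cat: "op_cat (op_cat C) = C"
  by (cases C) (simp add: op_cat_def)

lemma co_co: "co (co A) = A"
  by (cases A) (simp add: co_def op_cat_op_cat)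

lemma two_category_co: "two_category A \<Longrightarrow> two_category (co A)"
proof -
  assume "two_category A"
  then interpret two_category A .
  show ?thesis
    by (intro two_category.intro cat_functor.intro cat_functor_axioms.intro)
      (auto simp: hom_category category_op_cat category_prod_cat)
qed

lemma two_functor_co: "two_functor A B F \<Longrightarrow> two_functor (co A) (co B) F"
proof -
  assume "two_functor A B F"
  then interpret two_functor A B F .
  show ?thesis
    by (intro two_functor.intro two_functor_axioms.intro two_category_co cat_functor.intro
        cat_functor_axioms.intro source.two_category_axioms target.two_category_axioms)
      (simp_all add: source.hom_category target.hom_category category_op_cat ext_ob ext_1 ext_2)
qed

locale dual_functor = A: strong_dual A + B: strong_dual B
  for A :: "('o, 'm, 'c) dual_twocat" and B :: "('p, 'n, 'd) dual_twocat" +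
  fixes F :: "('o, 'm, 'c, 'p, 'n, 'd) dual_fun"
  assumes duality_functor: "duality_functor A B F"
begin

sublocale F: two_functor "Und A" "Und B" "Fun F"
  using duality_functor by (simp add: duality_functor_def)

sublocale Cns: two_natural "co (Und A)" "Und B" "comp_two_fun (co (Und A)) (Inv B) (Fun F)"
    "comp_two_fun (co (Und A)) (Fun F) (Inv A)" "Cns F"
  using duality_functor by (simp add: duality_functor_def two_natural_iso_def)

lemma Cns_obj [simp]:
  "x \<in> Ob (Und A) \<Longrightarrow> Cns F x \<in> Obj (Hom (Und B) (FunO (Inv B) (FunO (Fun F) x)) (FunO (Fun F) (FunO (Inv A) x)))"
  using Cns.cpt_obj[of x] by simp

lemma dcns_obj [simp]:
  "x \<in> Ob (Und A) \<Longrightarrow>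
    dcns B F v x \<in> Obj (Hom (Und B) (dob B v (FunO (Fun F) x)) (FunO (Fun F) (dob A v x)))"
  by (cases v) simp_all

lemma dcns_natural [simp]:
  assumes "x \<in> Ob (Und A)" "y \<in> Ob (Und A)" "\<mu> \<in> Arr (Hom (Und A) x y)"
  shows "CompA (Und B) (dob B v (FunO (Fun F) x)) (dob B v (FunO (Fun F) y)) (FunO (Fun F) (dob A v y))
      (Idn (Hom (Und B) (dob B v (FunO (Fun F) y)) (FunO (Fun F) (dob A v y))) (dcns B F v y))
      (dmap2 B v (FunO (Fun F) x) (FunO (Fun F) y) (Fun2 (Fun F) x y \<mu>)) =
    CompA (Und B) (dob B v (FunO (Fun F) x)) (FunO (Fun F) (dob A v x)) (FunO (Fun F) (dob A v y))
      (Fun2 (Fun F) (dob A v x) (dob A v y) (dmap2 A v x y \<mu>))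
      (Idn (Hom (Und B) (dob B v (FunO (Fun F) x)) (FunO (Fun F) (dob A v x))) (dcns B F v x))"
  using assms Cns.naturality_arr[of x y \<mu>] by (cases v) simp_all

lemma dcns_natural_assoc [simp]:
  assumes "x \<in> Ob (Und A)" "y \<in> Ob (Und A)" "\<mu> \<in> Arr (Hom (Und A) x y)"
    "a \<in> Ob (Und B)" "\<nu> \<in> Arr (Hom (Und B) a (dob B v (FunO (Fun F) x)))"
  shows "CompA (Und B) a (dob B v (FunO (Fun F) y)) (FunO (Fun F) (dob A v y))
      (Idn (Hom (Und B) (dob B v (FunO (Fun F) y)) (FunO (Fun F) (dob A v y))) (dcns B F v y))
      (CompA (Und B) a (dob B v (FunO (Fun F) x)) (dob B v (FunO (Fun F) y))
        (dmap2 B v (FunO (Fun F) x) (FunO (Fun F) y) (Fun2 (Fun F) x y \<mu>)) \<nu>) =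
    CompA (Und B) a (FunO (Fun F) (dob A v x)) (FunO (Fun F) (dob A v y))
      (Fun2 (Fun F) (dob A v x) (dob A v y) (dmap2 A v x y \<mu>))
      (CompA (Und B) a (dob B v (FunO (Fun F) x)) (FunO (Fun F) (dob A v x))
        (Idn (Hom (Und B) (dob B v (FunO (Fun F) x)) (FunO (Fun F) (dob A v x))) (dcns B F v x)) \<nu>)"
  using assms B.assoc_arr[of a "dob B v (FunO (Fun F) x)" "dob B v (FunO (Fun F) y)"
      "FunO (Fun F) (dob A v y)" \<nu> "dmap2 B v (FunO (Fun F) x) (FunO (Fun F) y) (Fun2 (Fun F) x y \<mu>)"
      "Idn (Hom (Und B) (dob B v (FunO (Fun F) y)) (FunO (Fun F) (dob A v y))) (dcns B F v y)"]
  by (simp del: B.assoc_arr) simp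

lemma Cns_coherence:
  "x \<in> Ob (Und A) \<Longrightarrow>
    Fun1 (Fun F) x (FunO (Inv A) (FunO (Inv A) x)) (Dunit A x) =
    CompO (Und B) (FunO (Fun F) x) (FunO (Inv B) (FunO (Fun F) (FunO (Inv A) x)))
      (FunO (Fun F) (FunO (Inv A) (FunO (Inv A) x))) (Cns F (FunO (Inv A) x))
      (CompO (Und B) (FunO (Fun F) x) (FunO (Inv B) (FunO (Inv B) (FunO (Fun F) x)))
        (FunO (Inv B) (FunO (Fun F) (FunO (Inv A) x)))
        (Fun1 (Inv B) (FunO (Inv B) (FunO (Fun F) x)) (FunO (Fun F) (FunO (Inv A) x)) (Cns F x))
        (Dunit B (FunO (Fun F) x)))"
  using duality_functor by (simp add: duality_functor_def Let_def)

text \<open>Two ways of comparing \<open>(F x)^(v w)\<close> with \<open>F ((x^w)^v)\<close>, whose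
  equality is what preservation of the four compositions requires. For \<open>v = w = Con\<close> it
  is the axiom relating the constraint to the units; the other cases are unit laws.\<close>

lemma dcns_coherence:
  assumes "x \<in> Ob (Und A)"
  shows "CompO (Und B) (dob B (v \<odot> w) (FunO (Fun F) x)) (FunO (Fun F) (dob A (v \<odot> w) x))
      (FunO (Fun F) (dob A v (dob A w x)))
      (Fun1 (Fun F) (dob A (v \<odot> w) x) (dob A v (dob A w x)) (dcmp A v w x)) (dcns B F (v \<odot> w) x) =
    CompO (Und B) (dob B (v \<odot> w) (FunO (Fun F) x)) (dob B v (FunO (Fun F) (dob A w x)))
      (FunO (Fun F) (dob A v (dob A w x))) (dcns B F v (dob A w x))
      (CompO (Und B) (dob B (v \<odot> w) (FunO (Fun F) x)) (dob B v (dob B w (FunO (Fun F) x)))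
        (dob B v (FunO (Fun F) (dob A w x)))
        (dmap1 B v (dob B w (FunO (Fun F) x)) (FunO (Fun F) (dob A w x)) (dcns B F w x))
        (dcmp B v w (FunO (Fun F) x)))"
  using assms B.Inv.fun_simps(1) by (cases v; cases w) (simp_all add: Cns_coherence)

lemma dcns_coherence_arr:
  assumes "x \<in> Ob (Und A)" "t = v \<odot> w"
  shows "CompA (Und B) (dob B t (FunO (Fun F) x)) (FunO (Fun F) (dob A t x))
      (FunO (Fun F) (dob A v (dob A w x)))
      (Idn (Hom (Und B) (FunO (Fun F) (dob A t x)) (FunO (Fun F) (dob A v (dob A w x))))
        (Fun1 (Fun F) (dob A t x) (dob A v (dob A w x)) (dcmp A v w x)))
      (Idn (Hom (Und B) (dob B t (FunO (Fun F) x)) (FunO (Fun F) (dob A t x))) (dcns B F t x)) =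
    CompA (Und B) (dob B t (FunO (Fun F) x)) (dob B v (FunO (Fun F) (dob A w x)))
      (FunO (Fun F) (dob A v (dob A w x)))
      (Idn (Hom (Und B) (dob B v (FunO (Fun F) (dob A w x))) (FunO (Fun F) (dob A v (dob A w x))))
        (dcns B F v (dob A w x)))
      (CompA (Und B) (dob B t (FunO (Fun F) x)) (dob B v (dob B w (FunO (Fun F) x)))
        (dob B v (FunO (Fun F) (dob A w x)))
        (Idn (Hom (Und B) (dob B v (dob B w (FunO (Fun F) x))) (dob B v (FunO (Fun F) (dob A w x))))
          (dmap1 B v (dob B w (FunO (Fun F) x)) (FunO (Fun F) (dob A w x)) (dcns B F w x)))
        (Idn (Hom (Und B) (dob B t (FunO (Fun F) x)) (dob B v (dob B w (FunO (Fun F) x))))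
          (dcmp B v w (FunO (Fun F) x))))"
  using assms arg_cong[OF dcns_coherence[of x v w],
      of "Idn (Hom (Und B) (dob B t (FunO (Fun F) x)) (FunO (Fun F) (dob A v (dob A w x))))"] by simp

lemma contra_functor_contra_fun_of:
  "contra_functor (contra_of A) (contra_of B) (contra_fun_of A B F)"
proof (rule contra_functorI)
  fix v x y assume "x \<in> COb (contra_of A)" "y \<in> COb (contra_of A)"
  then have [simp]: "x \<in> Ob (Und A)" "y \<in> Ob (Und A)"
    by simp_all
  show "cat_functor (CHom (contra_of A) v x y)
      (CHom (contra_of B) v (CFunO (contra_fun_of A B F) x) (CFunO (contra_fun_of A B F) y))
      (CFun1 (contra_fun_of A B F) v x y) (CFun2 (contra_fun_of A B F) v x y)"
    by (intro cat_functor.intro cat_functor_axioms.intro)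
      (simp_all add: A.hom_category B.hom_category)
next
  show "CFun2 (contra_fun_of A B F) (v \<odot> w) x z (CCompA (contra_of A) v w x y z \<beta> \<alpha>) =
      CCompA (contra_of B) v w (CFunO (contra_fun_of A B F) x) (CFunO (contra_fun_of A B F) y)
        (CFunO (contra_fun_of A B F) z) (CFun2 (contra_fun_of A B F) v y z \<beta>)
        (CFun2 (contra_fun_of A B F) w x y \<alpha>)"
    if "x \<in> COb (contra_of A)" "y \<in> COb (contra_of A)" "z \<in> COb (contra_of A)"
      "\<alpha> \<in> Arr (CHom (contra_of A) w x y)" "\<beta> \<in> Arr (CHom (contra_of A) v y z)" for v w x y z \<alpha> \<beta>
    \<comment> \<open>Naturality moves the constraint past the inner cell, and coherence matches the
      comparisons that remain on the two sides.\<close>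
    using that by (simp add: dcns_coherence_arr)
qed (fact A.contra_two_category_contra_of B.contra_two_category_contra_of | simp
    | auto simp: contra_fun_of_def F.ext_ob)+

sublocale C: contra_functor "contra_of A" "contra_of B" "contra_fun_of A B F"
  by (rule contra_functor_contra_fun_of)

text \<open>The identity of \<open>x^o\<close> goes to \<open>F\<close> of an identity after the
  constraint, that is, to the constraint itself. The case splits serve equality of whole functions:
  off the carriers all values are \<open>undefined\<close>.\<close>

lemma dual_fun_of_contra_fun_of: "dual_fun_of A (contra_fun_of A B F) = F"
proof -
  have "CFun1 (contra_fun_of A B F) Cov x y f = Fun1 (Fun F) x y f" for x y f
    by (cases "x \<in> Ob (Und A) \<and> y \<in> Ob (Und A) \<and> f \<in> Obj (Hom (Und A) x y)")
      (auto simp: F.ext_1 contra_fun_of_def)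
  moreover have "CFun2 (contra_fun_of A B F) Cov x y \<alpha> = Fun2 (Fun F) x y \<alpha>" for x y \<alpha>
    by (cases "x \<in> Ob (Und A) \<and> y \<in> Ob (Und A) \<and> \<alpha> \<in> Arr (Hom (Und A) x y)")
      (auto simp: F.ext_2 contra_fun_of_def)
  moreover have "Cns (dual_fun_of A (contra_fun_of A B F)) x = Cns F x" for x
    by (cases "x \<in> Ob (Und A)") (simp_all add: Cns.ext_cpt)
  ultimately show ?thesis
    by (intro dual_fun.equality two_fun.equality) (simp_all add: fun_eq_iff)
qed

end

section \<open>From 2-functors preserving contravariance back to duality 2-functors\<close>

locale contra_functor_dual = A: strong_dual A + B: strong_dual B +
    H: contra_functor "contra_of A" "contra_of B" H
  for A :: "('o, 'm, 'c) dual_twocat" and B :: "('p, 'n, 'd) dual_twocat"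
    and H :: "('o, 'm, 'c, 'p, 'n, 'd) contra_fun"
begin

abbreviation "K \<equiv> dual_fun_of A H"
abbreviation "\<chi> x \<equiv> One (Und A) (FunO (Inv A) x)"

lemma H_ob [simp]: "x \<in> Ob (Und A) \<Longrightarrow> CFunO H x \<in> Ob (Und B)"
  using H.fun_ob by simp

text \<open>Hom-categories of \<open>contra_of\<close> unfold to hom-categories at
  \<open>dob A v x\<close>, which evaluates further once \<open>v\<close> is concrete; the functor
  laws are restated for each sign in that evaluated form.\<close>

lemmas H_Cov [simp] = H.fun_simps(1-4,7,8)[where v = Cov, simplified]
lemmas H_Con [simp] = H.fun_simps(1-4,7,8)[where v = Con, simplified]
lemmas H_one [simp] = H.fun_one[simplified]

lemma two_functor_Fun: "two_functor (Und A) (Und B) (Fun K)"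
proof (rule two_functorI)
  show "cat_functor (Hom (Und A) x y) (Hom (Und B) (FunO (Fun K) x) (FunO (Fun K) y))
      (Fun1 (Fun K) x y) (Fun2 (Fun K) x y)" if "x \<in> Ob (Und A)" "y \<in> Ob (Und A)" for x y
    using H.fun_hom[of x y Cov] that by simp
  show "Fun2 (Fun K) x z (CompA (Und A) x y z \<beta> \<alpha>) =
      CompA (Und B) (FunO (Fun K) x) (FunO (Fun K) y) (FunO (Fun K) z) (Fun2 (Fun K) y z \<beta>) (Fun2 (Fun K) x y \<alpha>)"
    if "x \<in> Ob (Und A)" "y \<in> Ob (Und A)" "z \<in> Ob (Und A)"
      "\<alpha> \<in> Arr (Hom (Und A) x y)" "\<beta> \<in> Arr (Hom (Und A) y z)" for x y z \<alpha> \<beta>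
    using that H.fun_comp_arr[of x y z \<alpha> Cov \<beta> Cov] by simp
qed (auto simp: A.two_category_axioms B.two_category_axioms intro: H.ext_ob H.ext_1 H.ext_2)

sublocale K: two_functor "Und A" "Und B" "Fun K"
  by (rule two_functor_Fun)

text \<open>A contravariant \<open>f : x \<rightarrow> y\<close> is the covariant
  \<open>f : x^o \<rightarrow> y\<close> after the contravariant \<open>\<chi> x\<close>, and
  \<open>H\<close> preserves this composite. So \<open>H\<close> on contravariant cells is
  determined by its covariant part and by the images of the \<open>\<chi> x\<close>.\<close>

lemma CFun_Con:
  assumes "x \<in> Ob (Und A)" "y \<in> Ob (Und A)"
  shows "f \<in> Obj (Hom (Und A) (FunO (Inv A) x) y) \<Longrightarrow> CFun1 H Con x y f =
      CompO (Und B) (FunO (Inv B) (CFunO H x)) (CFunO H (FunO (Inv A) x)) (CFunO H y)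
        (CFun1 H Cov (FunO (Inv A) x) y f) (CFun1 H Con x (FunO (Inv A) x) (\<chi> x))"
    and "\<alpha> \<in> Arr (Hom (Und A) (FunO (Inv A) x) y) \<Longrightarrow> CFun2 H Con x y \<alpha> =
      CompA (Und B) (FunO (Inv B) (CFunO H x)) (CFunO H (FunO (Inv A) x)) (CFunO H y)
        (CFun2 H Cov (FunO (Inv A) x) y \<alpha>)
        (Idn (Hom (Und B) (FunO (Inv B) (CFunO H x)) (CFunO H (FunO (Inv A) x)))
          (CFun1 H Con x (FunO (Inv A) x) (\<chi> x)))"
  using assms H.fun_comp_obj[of x "FunO (Inv A) x" y "\<chi> x" Con f Cov]
    H.fun_comp_arr[of x "FunO (Inv A) x" y "Idn (Hom (Und A) (FunO (Inv A) x) (FunO (Inv A) x)) (\<chi> x)" Con \<alpha> Cov]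
  by simp_all

lemma Cns_two_natural:
  "two_natural (co (Und A)) (Und B) (comp_two_fun (co (Und A)) (Inv B) (Fun K))
    (comp_two_fun (co (Und A)) (Fun K) (Inv A)) (Cns K)"
proof (rule two_naturalI)
  show "two_functor (co (Und A)) (Und B) (comp_two_fun (co (Und A)) (Inv B) (Fun K))"
    by (rule two_functor_comp[OF two_functor_co[OF two_functor_Fun] B.Inv.two_functor_axioms])
  show "two_functor (co (Und A)) (Und B) (comp_two_fun (co (Und A)) (Fun K) (Inv A))"
    by (rule two_functor_comp[OF A.Inv.two_functor_axioms two_functor_Fun])
  fix x y \<mu> assume "x \<in> Ob (co (Und A))" "y \<in> Ob (co (Und A))" "\<mu> \<in> Arr (Hom (co (Und A)) x y)"
  then have [simp]: "x \<in> Ob (Und A)" "y \<in> Ob (Und A)" "\<mu> \<in> Arr (Hom (Und A) x y)"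
    by simp_all
  have [simp]: "Fun2 (Inv A) x y \<mu> \<in> Arr (Hom (Und A) (FunO (Inv A) x) (FunO (Inv A) y))"
    "Fun2 (Inv B) (CFunO H x) (CFunO H y) (CFun2 H Cov x y \<mu>) \<in>
      Arr (Hom (Und B) (FunO (Inv B) (CFunO H x)) (FunO (Inv B) (CFunO H y)))"
    using A.Inv.fun_simps(2)[of x y \<mu>] B.Inv.fun_simps(2)[of "CFunO H x" "CFunO H y" "CFun2 H Cov x y \<mu>"]
    by simp_all
  show "CompA (Und B) (FunO (comp_two_fun (co (Und A)) (Inv B) (Fun K)) x)
      (FunO (comp_two_fun (co (Und A)) (Inv B) (Fun K)) y)
      (FunO (comp_two_fun (co (Und A)) (Fun K) (Inv A)) y)
      (Idn (Hom (Und B) (FunO (comp_two_fun (co (Und A)) (Inv B) (Fun K)) y)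
        (FunO (comp_two_fun (co (Und A)) (Fun K) (Inv A)) y)) (Cns K y))
      (Fun2 (comp_two_fun (co (Und A)) (Inv B) (Fun K)) x y \<mu>) =
    CompA (Und B) (FunO (comp_two_fun (co (Und A)) (Inv B) (Fun K)) x)
      (FunO (comp_two_fun (co (Und A)) (Fun K) (Inv A)) x)
      (FunO (comp_two_fun (co (Und A)) (Fun K) (Inv A)) y)
      (Fun2 (comp_two_fun (co (Und A)) (Fun K) (Inv A)) x y \<mu>)
      (Idn (Hom (Und B) (FunO (comp_two_fun (co (Und A)) (Inv B) (Fun K)) x)
        (FunO (comp_two_fun (co (Und A)) (Fun K) (Inv A)) x)) (Cns K x))"
    \<comment> \<open>The contravariant 2-cell given by \<open>\<mu>^o\<close> arises both as
      \<open>\<chi> y\<close> after \<mu> and as the covariant \<open>\<mu>^o\<close> after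
      \<open>\<chi> x\<close>. Applying \<open>H\<close> to the two factorisations gives the two
      sides.\<close>
    using H.fun_comp_arr[of x y "FunO (Inv A) y" \<mu> Cov
        "Idn (Hom (Und A) (FunO (Inv A) y) (FunO (Inv A) y)) (\<chi> y)" Con]
      CFun_Con(2)[of x "FunO (Inv A) y" "Fun2 (Inv A) x y \<mu>"]
    by simp
qed simp_all

text \<open>\<open>H\<close> preserves composites, so it carries the contravariant inverse
  \<open>d\<close> of \<open>\<chi> x\<close> to a contravariant inverse of the constraint. The
  remaining work turns an inverse for the composition of \<open>contra_of B\<close> into an inverse
  in \<open>Und B\<close>, where the unit and the involution intervene.\<close>

lemma Cns_isomorphism:
  assumes [simp]: "x \<in> Ob (Und A)"
  shows "is_isomorphism (Und B) (FunO (Inv B) (CFunO H x)) (CFunO H (FunO (Inv A) x)) (Cns K x)"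
proof -
  let ?x = "FunO (Inv A) x"
  obtain d where [simp]: "d \<in> Obj (Hom (Und A) (FunO (Inv A) ?x) x)"
    and d: "CompO (Und A) x (FunO (Inv A) ?x) x d (Dunit A x) = One (Und A) x"
    "CompO (Und A) (FunO (Inv A) ?x) x (FunO (Inv A) ?x) (Dunit A x) d = One (Und A) (FunO (Inv A) ?x)"
    by (rule A.Dunit_inverse[of x]) simp_all
  let ?C = "contra_of B" and ?c = "CFun1 H Con x ?x (\<chi> x)" and ?c' = "CFun1 H Con ?x x d"
  have c [simp]: "?c \<in> Obj (CHom ?C Con (CFunO H x) (CFunO H ?x))"
    and c' [simp]: "?c' \<in> Obj (CHom ?C Con (CFunO H ?x) (CFunO H x))"
    by simp_all
  have cd: "CCompO (contra_of A) Con Con ?x x ?x (\<chi> x) d = One (Und A) ?x"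
    using arg_cong[OF d(1), of "Fun1 (Inv A) x x"] A.Inv.fun_simps(1) by (simp add: A.Dunit_Inv)
  have dc: "CCompO (contra_of A) Con Con x ?x x d (\<chi> x) = One (Und A) x"
    using d by simp
  have cc': "CCompO ?C Con Con (CFunO H ?x) (CFunO H x) (CFunO H ?x) ?c ?c' = One (Und B) (CFunO H ?x)"
    using H.fun_comp_obj[of ?x x ?x d Con "\<chi> x" Con] cd by (simp del: contra_of_simps(4))
  have c'c: "CCompO ?C Con Con (CFunO H x) (CFunO H ?x) (CFunO H x) ?c' ?c = One (Und B) (CFunO H x)"
    using H.fun_comp_obj[of x ?x x "\<chi> x" Con d Con] dc by (simp del: contra_of_simps(4))
  let ?X = "CFunO H x" and ?X' = "CFunO H ?x" and ?D = "FunO (Inv B)"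
  define g where "g = Fun1 (Inv B) (?D ?X') ?X ?c'"
  have g [simp]: "g \<in> Obj (Hom (Und B) (?D (?D ?X')) (?D ?X))"
    using B.Inv.fun_simps(1)[of "?D ?X'" ?X ?c'] c' by (simp add: g_def)
  \<comment> \<open>The transpose of \<open>?c'\<close>: the involution applied to
    \<open>?c' : (H (x^o))^o \<rightarrow> H x\<close>, after the unit at \<open>H (x^o)\<close>.
    With this choice \<open>?c\<close> after \<open>e\<close> is exactly the composite of
    \<open>?c\<close> and \<open>?c'\<close> in \<open>contra_of B\<close>.\<close>
  define e where "e = CompO (Und B) ?X' (?D (?D ?X')) (?D ?X) g (Dunit B ?X')"
  have e: "e \<in> Obj (Hom (Und B) ?X' (?D ?X))"
    by (simp add: e_def)
  have ce: "CompO (Und B) ?X' (?D ?X) ?X' ?c e = One (Und B) ?X'"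
    using cc' by (simp add: e_def g_def)
  have nat: "CompO (Und B) (?D ?X) ?X' (?D (?D ?X')) (Dunit B ?X') ?c =
      CompO (Und B) (?D ?X) (?D (?D (?D ?X))) (?D (?D ?X'))
        (Fun1 (Inv B) (?D (?D ?X)) (?D ?X') (Fun1 (Inv B) (?D ?X) ?X' ?c)) (Dunit B (?D ?X))"
    using B.Dunit.naturality_obj[of "?D ?X" ?X' ?c] c by simp
  have "CompO (Und B) (?D ?X) ?X' (?D ?X) e ?c =
      CompO (Und B) (?D ?X) (?D (?D ?X')) (?D ?X) g
        (CompO (Und B) (?D ?X) ?X' (?D (?D ?X')) (Dunit B ?X') ?c)"
    using c by (simp add: e_def)
  \<comment> \<open>Naturality has moved the unit to \<open>(H x)^o\<close>, where it is the
    involution applied to the unit at \<open>H x\<close>. All factors then lie under the involution,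
    and inside it stands the composite of \<open>?c'\<close> and \<open>?c\<close> in
    \<open>contra_of B\<close>.\<close>
  also have "\<dots> = Fun1 (Inv B) ?X ?X (CompO (Und B) ?X (?D ?X') ?X ?c'
      (CompO (Und B) ?X (?D (?D ?X)) (?D ?X') (Fun1 (Inv B) (?D ?X) ?X' ?c) (Dunit B ?X)))"
    unfolding nat using c c' B.Inv.fun_simps(1) by (simp add: B.Dunit_Inv g_def)
  also have "\<dots> = One (Und B) (?D ?X)"
    using c'c by simp
  finally show ?thesis
    unfolding is_isomorphism_def using c e ce by auto
qed

lemma duality_functor_dual_fun_of: "duality_functor A B K"
  unfolding duality_functor_def two_natural_iso_def Let_def
proof (intro conjI ballI two_functor_Fun Cns_two_natural)
  fix x assume "x \<in> Ob (co (Und A))"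
  then show "is_isomorphism (Und B) (FunO (comp_two_fun (co (Und A)) (Inv B) (Fun K)) x)
      (FunO (comp_two_fun (co (Und A)) (Fun K) (Inv A)) x) (Cns K x)"
    using Cns_isomorphism[of x] by simp
next
  fix x assume "x \<in> Ob (Und A)"
  then show "CompO (Und B) (FunO (Fun K) x) (FunO (Inv B) (FunO (Fun K) (FunO (Inv A) x)))
      (FunO (Fun K) (FunO (Inv A) (FunO (Inv A) x))) (Cns K (FunO (Inv A) x))
      (CompO (Und B) (FunO (Fun K) x) (FunO (Inv B) (FunO (Inv B) (FunO (Fun K) x)))
        (FunO (Inv B) (FunO (Fun K) (FunO (Inv A) x)))
        (Fun1 (Inv B) (FunO (Inv B) (FunO (Fun K) x)) (FunO (Fun K) (FunO (Inv A) x)) (Cns K x))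
        (Dunit B (FunO (Fun K) x))) =
      Fun1 (Fun K) x (FunO (Inv A) (FunO (Inv A) x)) (Dunit A x)"
    \<comment> \<open>In \<open>contra_of A\<close> the unit at \<open>x\<close> is the composite of
      the contravariant \<open>\<chi> x\<close> and \<open>\<chi> (x^o)\<close>, so the axiom is
      preservation of this composite.\<close>
    using H.fun_comp_obj[of x "FunO (Inv A) x" "FunO (Inv A) (FunO (Inv A) x)" "\<chi> x" Con
        "\<chi> (FunO (Inv A) x)" Con] by simp
qed

sublocale K: dual_functor A B K
  by (intro dual_functor.intro dual_functor_axioms.intro A.strong_dual_axioms B.strong_dual_axioms
      duality_functor_dual_fun_of)

text \<open>For \<open>Cov\<close> the comparison is an identity; for \<open>Con\<close> the
  equation is the factorisation \<open>CFun_Con\<close>.\<close>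

lemma contra_fun_of_dual_fun_of: "contra_fun_of A B K = H"
proof (rule contra_fun_eqI[OF K.contra_functor_contra_fun_of H.contra_functor_axioms])
  show "CFun1 (contra_fun_of A B K) v x y f = CFun1 H v x y f"
    if "x \<in> COb (contra_of A)" "y \<in> COb (contra_of A)" "f \<in> Obj (CHom (contra_of A) v x y)" for v x y f
    using that CFun_Con(1)[of x y f] by (cases v) simp_all
  show "CFun2 (contra_fun_of A B K) v x y \<alpha> = CFun2 H v x y \<alpha>"
    if "x \<in> COb (contra_of A)" "y \<in> COb (contra_of A)" "\<alpha> \<in> Arr (CHom (contra_of A) v x y)" for v x y \<alpha>
    using that CFun_Con(2)[of x y \<alpha>] by (cases v) simp_all
qed simp

end

text \<open>A duality 2-functor acts on a contravariant cell by acting on a cell out of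
  \<open>x^o\<close> and precomposing the constraint. The naturality square at such a cell is
  therefore an ordinary one pasted with the compatibility of \<alpha> with the constraints.
  Conversely, naturality at the contravariant morphism \<open>x \<rightarrow> x^o\<close> is that
  compatibility.\<close>

lemma duality_natural_iff_contra_natural:
  fixes A :: "('o, 'm, 'c) dual_twocat" and B :: "('p, 'n, 'd) dual_twocat"
  assumes "dual_functor A B F" "dual_functor A B F'"
  shows "duality_natural A B F F' \<alpha> \<longleftrightarrow>
    contra_natural (contra_of A) (contra_of B) (contra_fun_of A B F) (contra_fun_of A B F') \<alpha>"
proof -
  interpret F: dual_functor A B F by fact
  interpret F': dual_functor A B F' by fact
  show ?thesis
  proof
    assume N: "duality_natural A B F F' \<alpha>"
    then interpret N: two_natural "Und A" "Und B" "Fun F" "Fun F'" \<alpha>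
      by (simp add: duality_natural_def)
    have cns: "CompO (Und B) (FunO (Inv B) (FunO (Fun F) x)) (FunO (Fun F) (FunO (Inv A) x))
        (FunO (Fun F') (FunO (Inv A) x)) (\<alpha> (FunO (Inv A) x)) (Cns F x) =
      CompO (Und B) (FunO (Inv B) (FunO (Fun F) x)) (FunO (Inv B) (FunO (Fun F') x))
        (FunO (Fun F') (FunO (Inv A) x)) (Cns F' x)
        (Fun1 (Inv B) (FunO (Fun F) x) (FunO (Fun F') x) (\<alpha> x))" if "x \<in> Ob (Und A)" for x
      using N that by (simp add: duality_natural_def Let_def)
    note [simp] = N.cpt_obj
    show "contra_natural (contra_of A) (contra_of B) (contra_fun_of A B F) (contra_fun_of A B F') \<alpha>"
    proof (rule contra_naturalI[OF F.contra_functor_contra_fun_of F'.contra_functor_contra_fun_of])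
      fix v x y \<mu>
      assume "x \<in> COb (contra_of A)" "y \<in> COb (contra_of A)" "\<mu> \<in> Arr (CHom (contra_of A) v x y)"
      then have [simp]: "x \<in> Ob (Und A)" "y \<in> Ob (Und A)" "\<mu> \<in> Arr (Hom (Und A) (dob A v x) y)"
        by simp_all
      define i where "i = Idn (Hom (Und B) (dob B v (FunO (Fun F) x)) (FunO (Fun F) (dob A v x))) (dcns B F v x)"
      have [simp]: "i \<in> Arr (Hom (Und B) (dob B v (FunO (Fun F) x)) (FunO (Fun F) (dob A v x)))"
        by (simp add: i_def)
      \<comment> \<open>Compatibility with the constraints for either sign; for \<open>Cov\<close>
        both sides reduce to \<open>\<alpha> x\<close>. Fact \<open>2\<close> restates it for
        identity 2-cells, and \<open>3\<close> is the naturality square at \<mu> preceded by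
        \<open>i\<close>, so that the two can be pasted.\<close>
      have 1: "CompO (Und B) (dob B v (FunO (Fun F) x)) (FunO (Fun F) (dob A v x)) (FunO (Fun F') (dob A v x))
          (\<alpha> (dob A v x)) (dcns B F v x) =
        CompO (Und B) (dob B v (FunO (Fun F) x)) (dob B v (FunO (Fun F') x)) (FunO (Fun F') (dob A v x))
          (dcns B F' v x) (dmap1 B v (FunO (Fun F) x) (FunO (Fun F') x) (\<alpha> x))"
        by (cases v) (simp_all add: cns)
      have 2: "CompA (Und B) (dob B v (FunO (Fun F) x)) (FunO (Fun F) (dob A v x)) (FunO (Fun F') (dob A v x))
          (Idn (Hom (Und B) (FunO (Fun F) (dob A v x)) (FunO (Fun F') (dob A v x))) (\<alpha> (dob A v x))) i =
        CompA (Und B) (dob B v (FunO (Fun F) x)) (dob B v (FunO (Fun F') x)) (FunO (Fun F') (dob A v x))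
          (Idn (Hom (Und B) (dob B v (FunO (Fun F') x)) (FunO (Fun F') (dob A v x))) (dcns B F' v x))
          (Idn (Hom (Und B) (dob B v (FunO (Fun F) x)) (dob B v (FunO (Fun F') x)))
            (dmap1 B v (FunO (Fun F) x) (FunO (Fun F') x) (\<alpha> x)))"
        using arg_cong[OF 1, of "Idn (Hom (Und B) (dob B v (FunO (Fun F) x)) (FunO (Fun F') (dob A v x)))"]
        by (simp add: i_def)
      have 3: "CompA (Und B) (dob B v (FunO (Fun F) x)) (FunO (Fun F) y) (FunO (Fun F') y)
          (Idn (Hom (Und B) (FunO (Fun F) y) (FunO (Fun F') y)) (\<alpha> y))
          (CompA (Und B) (dob B v (FunO (Fun F) x)) (FunO (Fun F) (dob A v x)) (FunO (Fun F) y)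
            (Fun2 (Fun F) (dob A v x) y \<mu>) i) =
        CompA (Und B) (dob B v (FunO (Fun F) x)) (FunO (Fun F') (dob A v x)) (FunO (Fun F') y)
          (Fun2 (Fun F') (dob A v x) y \<mu>)
          (CompA (Und B) (dob B v (FunO (Fun F) x)) (FunO (Fun F) (dob A v x)) (FunO (Fun F') (dob A v x))
          (Idn (Hom (Und B) (FunO (Fun F) (dob A v x)) (FunO (Fun F') (dob A v x))) (\<alpha> (dob A v x))) i)"
        by (simp add: N.naturality_arr flip: F.B.assoc_arr)
      show "CCompA (contra_of B) Cov v (CFunO (contra_fun_of A B F) x) (CFunO (contra_fun_of A B F) y)
          (CFunO (contra_fun_of A B F') y)
          (Idn (CHom (contra_of B) Cov (CFunO (contra_fun_of A B F) y) (CFunO (contra_fun_of A B F') y)) (\<alpha> y))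
          (CFun2 (contra_fun_of A B F) v x y \<mu>) =
        CCompA (contra_of B) v Cov (CFunO (contra_fun_of A B F) x) (CFunO (contra_fun_of A B F') x)
          (CFunO (contra_fun_of A B F') y) (CFun2 (contra_fun_of A B F') v x y \<mu>)
          (Idn (CHom (contra_of B) Cov (CFunO (contra_fun_of A B F) x) (CFunO (contra_fun_of A B F') x)) (\<alpha> x))"
        using 3 unfolding 2 by (simp add: i_def)
    qed (simp_all add: N.ext_cpt)
  next
    assume "contra_natural (contra_of A) (contra_of B) (contra_fun_of A B F) (contra_fun_of A B F') \<alpha>"
    then interpret N: contra_natural "contra_of A" "contra_of B" "contra_fun_of A B F" "contra_fun_of A B F'" \<alpha> .
    have [simp]: "\<alpha> x \<in> Obj (Hom (Und B) (FunO (Fun F) x) (FunO (Fun F') x))" if "x \<in> Ob (Und A)" for x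
      using N.cpt_obj[of x] that by simp
    have "two_natural (Und A) (Und B) (Fun F) (Fun F') \<alpha>"
    proof (rule two_naturalI[OF F.F.two_functor_axioms F'.F.two_functor_axioms])
      show "CompA (Und B) (FunO (Fun F) x) (FunO (Fun F) y) (FunO (Fun F') y)
          (Idn (Hom (Und B) (FunO (Fun F) y) (FunO (Fun F') y)) (\<alpha> y)) (Fun2 (Fun F) x y \<mu>) =
        CompA (Und B) (FunO (Fun F) x) (FunO (Fun F') x) (FunO (Fun F') y)
          (Fun2 (Fun F') x y \<mu>) (Idn (Hom (Und B) (FunO (Fun F) x) (FunO (Fun F') x)) (\<alpha> x))"
        if "x \<in> Ob (Und A)" "y \<in> Ob (Und A)" "\<mu> \<in> Arr (Hom (Und A) x y)" for x y \<mu>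
        using N.naturality_arr[of x y \<mu> Cov] that by simp
    qed (simp_all add: N.ext_cpt)
    moreover have "CompO (Und B) (FunO (Inv B) (FunO (Fun F) x)) (FunO (Fun F) (FunO (Inv A) x))
        (FunO (Fun F') (FunO (Inv A) x)) (\<alpha> (FunO (Inv A) x)) (Cns F x) =
      CompO (Und B) (FunO (Inv B) (FunO (Fun F) x)) (FunO (Inv B) (FunO (Fun F') x))
        (FunO (Fun F') (FunO (Inv A) x)) (Cns F' x)
        (Fun1 (Inv B) (FunO (Fun F) x) (FunO (Fun F') x) (\<alpha> x))" if "x \<in> Ob (Und A)" for x
      using N.naturality_obj[of x "FunO (Inv A) x" "One (Und A) (FunO (Inv A) x)" Con] that
        F.B.Inv.fun_simps(1)[of "FunO (Fun F) x" "FunO (Fun F') x" "\<alpha> x"] by simp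
    ultimately show "duality_natural A B F F' \<alpha>"
      by (simp add: duality_natural_def Let_def F.duality_functor F'.duality_functor)
  qed
qed

section \<open>The 2-functor from dualities to contravariance\<close>

lemma dual_functorI: "strong_duality A \<Longrightarrow> strong_duality B \<Longrightarrow> duality_functor A B F \<Longrightarrow> dual_functor A B F"
  by (intro dual_functor.intro strong_dual.intro dual_functor_axioms.intro)

lemma contra_functor_dualI:
  "strong_duality A \<Longrightarrow> strong_duality B \<Longrightarrow> contra_functor (contra_of A) (contra_of B) H \<Longrightarrow>
    contra_functor_dual A B H"
  by (intro contra_functor_dual.intro strong_dual.intro)

lemma id_dual_fun_eq:
  assumes "strong_duality A"
  shows "id_dual_fun A = dual_fun_of A (id_contra_fun (contra_of A))"
proof -
  interpret strong_dual A
    using assms by (rule strong_dual.intro)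
  show ?thesis
    by (intro dual_fun.equality two_fun.equality)
      (auto simp: fun_eq_iff id_dual_fun_def id_two_fun_def id_contra_fun_def dual_fun_of_def)
qed

text \<open>The composite functor sends the universal \<open>x \<rightarrow> x^o\<close> to
  \<open>G\<close> of the constraint of \<open>F\<close> after the constraint of \<open>G\<close>,
  which is how the composite constraint is defined. In this form the duality axioms of the composite
  come from \<open>duality_functor_dual_fun_of\<close>, without manipulating constraints.\<close>

lemma comp_dual_fun_eq:
  assumes "dual_functor A B F" "dual_functor B C G"
  shows "comp_dual_fun A B C G F =
    dual_fun_of A (comp_contra_fun (contra_of A) (contra_fun_of B C G) (contra_fun_of A B F))"
proof -
  interpret F: dual_functor A B F by fact
  interpret G: dual_functor B C G by fact
  show ?thesis
    by (intro dual_fun.equality two_fun.equality)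
      (auto simp: fun_eq_iff comp_dual_fun_def comp_two_fun_def comp_contra_fun_def dual_fun_of_def Let_def)
qed

definition contra_transf_of :: "('o, 'm, 'c) dual_twocat \<Rightarrow> ('p, 'n, 'd) dual_twocat \<Rightarrow>
    (('o, 'm, 'c, 'p, 'n, 'd) dual_fun, 'o, 'n) transf \<Rightarrow>
    (('o, 'm, 'c, 'p, 'n, 'd) contra_fun, 'o, 'n) transf" where
  "contra_transf_of A B \<alpha> =
    \<lparr>Src = contra_fun_of A B (Src \<alpha>), Tgt = contra_fun_of A B (Tgt \<alpha>), Cpt = Cpt \<alpha>\<rparr>"

lemma contra_transf_of_simps [simp]:
  "Src (contra_transf_of A B \<alpha>) = contra_fun_of A B (Src \<alpha>)"
  "Tgt (contra_transf_of A B \<alpha>) = contra_fun_of A B (Tgt \<alpha>)"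
  "Cpt (contra_transf_of A B \<alpha>) = Cpt \<alpha>"
  by (simp_all add: contra_transf_of_def)

lemma bij_betw_contra_fun_of:
  assumes "strong_duality A" "strong_duality B"
  shows "bij_betw (contra_fun_of A B) {F. duality_functor A B F}
    {H. contra_functor (contra_of A) (contra_of B) H}"
proof (rule bij_betw_byWitness[where f' = "dual_fun_of A"])
  show "\<forall>F\<in>{F. duality_functor A B F}. dual_fun_of A (contra_fun_of A B F) = F"
    using dual_functor.dual_fun_of_contra_fun_of[OF dual_functorI[OF assms]] by blast
  show "\<forall>H\<in>{H. contra_functor (contra_of A) (contra_of B) H}. contra_fun_of A B (dual_fun_of A H) = H"
    using contra_functor_dual.contra_fun_of_dual_fun_of[OF contra_functor_dualI[OF assms]] by blast
  show "contra_fun_of A B ` {F. duality_functor A B F} \<subseteq> {H. contra_functor (contra_of A) (contra_of B) H}"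
    using dual_functor.contra_functor_contra_fun_of[OF dual_functorI[OF assms]] by blast
  show "dual_fun_of A ` {H. contra_functor (contra_of A) (contra_of B) H} \<subseteq> {F. duality_functor A B F}"
    using contra_functor_dual.duality_functor_dual_fun_of[OF contra_functor_dualI[OF assms]] by blast
qed

lemma duality_natural_iff:
  assumes "strong_duality A" "strong_duality B"
  shows "duality_natural A B F F' \<alpha> \<longleftrightarrow> duality_functor A B F \<and> duality_functor A B F' \<and>
    contra_natural (contra_of A) (contra_of B) (contra_fun_of A B F) (contra_fun_of A B F') \<alpha>"
  using duality_natural_iff_contra_natural[OF dual_functorI[OF assms] dual_functorI[OF assms], of F F' \<alpha>]
  by (auto simp: duality_natural_def)

text \<open>A 2-cell records its two ends, and these are matched by the bijection on 1-cells; its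
  components stay the same, and \<open>duality_natural_iff\<close> says that they satisfy the same
  conditions.\<close>

lemma bij_betw_contra_transf_of:
  assumes "strong_duality A" "strong_duality B"
  shows "bij_betw (contra_transf_of A B) (Arr (duality_hom A B)) (Arr (contra_hom (contra_of A) (contra_of B)))"
  unfolding bij_betw_def
proof
  note bij = bij_betw_contra_fun_of[OF assms]
  show "inj_on (contra_transf_of A B) (Arr (duality_hom A B))"
  proof (rule inj_onI)
    fix \<alpha> \<beta> assume "\<alpha> \<in> Arr (duality_hom A B)" "\<beta> \<in> Arr (duality_hom A B)"
      and eq: "contra_transf_of A B \<alpha> = contra_transf_of A B \<beta>"
    then have "{Src \<alpha>, Src \<beta>, Tgt \<alpha>, Tgt \<beta>} \<subseteq> {F. duality_functor A B F}"
      by (simp add: duality_hom_def duality_natural_iff[OF assms])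
    then show "\<alpha> = \<beta>"
      using eq bij_betw_imp_inj_on[OF bij] unfolding contra_transf_of_def inj_on_def
      by (intro transf_eqI) auto
  qed
  show "contra_transf_of A B ` Arr (duality_hom A B) = Arr (contra_hom (contra_of A) (contra_of B))"
  proof (intro equalityI subsetI)
    fix \<beta> assume "\<beta> \<in> Arr (contra_hom (contra_of A) (contra_of B))"
    then have \<beta>: "contra_natural (contra_of A) (contra_of B) (Src \<beta>) (Tgt \<beta>) (Cpt \<beta>)"
      by simp
    then interpret contra_natural "contra_of A" "contra_of B" "Src \<beta>" "Tgt \<beta>" "Cpt \<beta>" .
    obtain F F' where F: "duality_functor A B F" "Src \<beta> = contra_fun_of A B F"
      and F': "duality_functor A B F'" "Tgt \<beta> = contra_fun_of A B F'"
      using bij_betw_imp_surj_on[OF bij] F.contra_functor_axioms F'.contra_functor_axioms by blast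
    show "\<beta> \<in> contra_transf_of A B ` Arr (duality_hom A B)"
      by (rule image_eqI[of _ _ "\<lparr>Src = F, Tgt = F', Cpt = Cpt \<beta>\<rparr>"])
        (use \<beta> F F' in \<open>auto simp: duality_hom_def duality_natural_iff[OF assms] contra_transf_of_def\<close>)
  qed (auto simp: duality_hom_def duality_natural_iff[OF assms])
qed

lemma duality_hom_simps [simp]:
  "Obj (duality_hom A B) = {F. duality_functor A B F}"
  "\<alpha> \<in> Arr (duality_hom A B) \<longleftrightarrow> duality_natural A B (Src \<alpha>) (Tgt \<alpha>) (Cpt \<alpha>)"
  "Dom (duality_hom A B) = Src" "Cod (duality_hom A B) = Tgt"
  "Src (Idn (duality_hom A B) F) = F" "Tgt (Idn (duality_hom A B) F) = F"
  "Cpt (Idn (duality_hom A B) F) = (\<lambda>x. if x \<in> Ob (Und A) then One (Und B) (FunO (Fun F) x) else undefined)"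
  "Src (Cmp (duality_hom A B) \<beta> \<alpha>) = Src \<alpha>" "Tgt (Cmp (duality_hom A B) \<beta> \<alpha>) = Tgt \<beta>"
  "Cpt (Cmp (duality_hom A B) \<beta> \<alpha>) = (\<lambda>x. if x \<in> Ob (Und A)
      then CompO (Und B) (FunO (Fun (Src \<alpha>)) x) (FunO (Fun (Tgt \<alpha>)) x) (FunO (Fun (Tgt \<beta>)) x)
        (Cpt \<beta> x) (Cpt \<alpha> x)
      else undefined)"
  by (simp_all add: duality_hom_def)

lemma duality_TwoCat_simps [simp]:
  "Ob duality_TwoCat = {A. strong_duality A}"
  "Hom duality_TwoCat = duality_hom" "One duality_TwoCat = id_dual_fun"
  "CompO duality_TwoCat = comp_dual_fun"
  "Src (CompA duality_TwoCat A B C \<beta> \<alpha>) = comp_dual_fun A B C (Src \<beta>) (Src \<alpha>)"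
  "Tgt (CompA duality_TwoCat A B C \<beta> \<alpha>) = comp_dual_fun A B C (Tgt \<beta>) (Tgt \<alpha>)"
  "Cpt (CompA duality_TwoCat A B C \<beta> \<alpha>) = (\<lambda>x. if x \<in> Ob (Und A)
         then let a = FunO (Fun (Src \<alpha>)) x; a' = FunO (Fun (Tgt \<alpha>)) x in
           CompO (Und C)
             (FunO (Fun (Src \<beta>)) a) (FunO (Fun (Src \<beta>)) a') (FunO (Fun (Tgt \<beta>)) a')
             (Cpt \<beta> a') (Fun1 (Fun (Src \<beta>)) a a' (Cpt \<alpha> x))
         else undefined)"
  by (simp_all add: duality_TwoCat_def)

lemma contra_fun_of_id:
  assumes "strong_duality A"
  shows "duality_functor A A (id_dual_fun A)"
    and "contra_fun_of A A (id_dual_fun A) = id_contra_fun (contra_of A)"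
proof -
  interpret strong_dual A
    using assms by (rule strong_dual.intro)
  interpret contra_functor_dual A A "id_contra_fun (contra_of A)"
    by (intro contra_functor_dualI assms contra_functor_id C.contra_two_category_axioms)
  show "duality_functor A A (id_dual_fun A)"
    and "contra_fun_of A A (id_dual_fun A) = id_contra_fun (contra_of A)"
    by (simp_all add: id_dual_fun_eq[OF assms] duality_functor_dual_fun_of contra_fun_of_dual_fun_of)
qed

lemma contra_fun_of_comp:
  assumes "strong_duality A" "strong_duality B" "strong_duality C"
    and "duality_functor A B F" "duality_functor B C G"
  shows "duality_functor A C (comp_dual_fun A B C G F)"
    and "contra_fun_of A C (comp_dual_fun A B C G F) =
      comp_contra_fun (contra_of A) (contra_fun_of B C G) (contra_fun_of A B F)"
proof -
  interpret F: dual_functor A B F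
    using assms by (intro dual_functorI)
  interpret G: dual_functor B C G
    using assms by (intro dual_functorI)
  interpret contra_functor_dual A C "comp_contra_fun (contra_of A) (contra_fun_of B C G) (contra_fun_of A B F)"
    by (intro contra_functor_dualI assms contra_functor_comp[OF
          F.contra_functor_contra_fun_of G.contra_functor_contra_fun_of])
  show "duality_functor A C (comp_dual_fun A B C G F)"
    and "contra_fun_of A C (comp_dual_fun A B C G F) =
      comp_contra_fun (contra_of A) (contra_fun_of B C G) (contra_fun_of A B F)"
    by (simp_all add: comp_dual_fun_eq[OF F.dual_functor_axioms G.dual_functor_axioms]
        duality_functor_dual_fun_of contra_fun_of_dual_fun_of)
qed

lemma contra_transf_of_idn:
  assumes "strong_duality A" "strong_duality B" "duality_functor A B F"
  shows "contra_transf_of A B (Idn (duality_hom A B) F) =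
    Idn (contra_hom (contra_of A) (contra_of B)) (contra_fun_of A B F)"
  by (rule transf_eqI) simp_all

lemma contra_transf_of_cmp:
  assumes "strong_duality A" "strong_duality B"
    and "\<alpha> \<in> Arr (duality_hom A B)" "\<beta> \<in> Arr (duality_hom A B)" "Src \<beta> = Tgt \<alpha>"
  shows "contra_transf_of A B (Cmp (duality_hom A B) \<beta> \<alpha>) =
    Cmp (contra_hom (contra_of A) (contra_of B)) (contra_transf_of A B \<beta>) (contra_transf_of A B \<alpha>)"
proof (rule transf_eqI)
  interpret A: strong_dual A + B: strong_dual B
    using assms by (simp_all add: strong_dual.intro)
  interpret \<alpha>: two_natural "Und A" "Und B" "Fun (Src \<alpha>)" "Fun (Tgt \<alpha>)" "Cpt \<alpha>"
    using assms by (simp add: duality_natural_def)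
  interpret \<beta>: two_natural "Und A" "Und B" "Fun (Tgt \<alpha>)" "Fun (Tgt \<beta>)" "Cpt \<beta>"
    using assms by (simp add: duality_natural_def)
  show "Cpt (contra_transf_of A B (Cmp (duality_hom A B) \<beta> \<alpha>)) x =
    Cpt (Cmp (contra_hom (contra_of A) (contra_of B)) (contra_transf_of A B \<beta>) (contra_transf_of A B \<alpha>)) x" for x
    \<comment> \<open>Covariant composition in \<open>contra_of\<close> inserts an identity
      comparison, and the unit law that removes it asks for components in the right
      hom-category.\<close>
    by (simp add: \<alpha>.cpt_obj \<beta>.cpt_obj)
qed simp_all

lemma contra_transf_of_hcomp:
  assumes "strong_duality A" "strong_duality B" "strong_duality C"
    and "\<alpha> \<in> Arr (duality_hom A B)" "\<beta> \<in> Arr (duality_hom B C)"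
  shows "contra_transf_of A C (CompA duality_TwoCat A B C \<beta> \<alpha>) =
    CompA contra_TwoCat (contra_of A) (contra_of B) (contra_of C) (contra_transf_of B C \<beta>) (contra_transf_of A B \<alpha>)"
proof (rule transf_eqI)
  interpret C: strong_dual C
    using assms by (simp add: strong_dual.intro)
  have funs: "duality_functor A B (Src \<alpha>)" "duality_functor A B (Tgt \<alpha>)"
    "duality_functor B C (Src \<beta>)" "duality_functor B C (Tgt \<beta>)"
    using assms by (simp_all add: duality_natural_def)
  interpret \<alpha>: two_natural "Und A" "Und B" "Fun (Src \<alpha>)" "Fun (Tgt \<alpha>)" "Cpt \<alpha>"
    using assms by (simp add: duality_natural_def)
  interpret \<beta>: two_natural "Und B" "Und C" "Fun (Src \<beta>)" "Fun (Tgt \<beta>)" "Cpt \<beta>"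
    using assms by (simp add: duality_natural_def)
  show "Src (contra_transf_of A C (CompA duality_TwoCat A B C \<beta> \<alpha>)) =
      Src (CompA contra_TwoCat (contra_of A) (contra_of B) (contra_of C) (contra_transf_of B C \<beta>) (contra_transf_of A B \<alpha>))"
    "Tgt (contra_transf_of A C (CompA duality_TwoCat A B C \<beta> \<alpha>)) =
      Tgt (CompA contra_TwoCat (contra_of A) (contra_of B) (contra_of C) (contra_transf_of B C \<beta>) (contra_transf_of A B \<alpha>))"
    by (simp_all add: contra_fun_of_comp assms funs)
  show "Cpt (contra_transf_of A C (CompA duality_TwoCat A B C \<beta> \<alpha>)) x =
      Cpt (CompA contra_TwoCat (contra_of A) (contra_of B) (contra_of C) (contra_transf_of B C \<beta>) (contra_transf_of A B \<alpha>)) x" for x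
    by (simp add: \<alpha>.cpt_obj \<beta>.cpt_obj Let_def)
qed

text \<open>Both conclusions come from \<open>two_category_reflect\<close>. What has to be supplied
  is closure of the duality side under its operations, and for 2-cells this too is transported from
  the contravariance side.\<close>

lemma
  fixes D :: "(('o, 'm, 'c) dual_twocat, ('o, 'm, 'c, 'o, 'm, 'c) dual_fun,
    (('o, 'm, 'c, 'o, 'm, 'c) dual_fun, 'o, 'm) transf) twocat"
  defines "D \<equiv> duality_TwoCat"
  shows two_category_duality_TwoCat: "two_category D"
    and two_functor_contra_of:
      "two_functor D contra_TwoCat (restrict_two_fun D contra_of contra_fun_of contra_transf_of)"
proof -
  \<comment> \<open>A 2-cell belongs to the duality side exactly when its ends and its image belong
    to the respective carriers; closure under identities and both compositions is then inherited
    from \<open>contra_TwoCat\<close>.\<close>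
  have mem: "\<alpha> \<in> Arr (duality_hom A B) \<longleftrightarrow> duality_functor A B (Src \<alpha>) \<and> duality_functor A B (Tgt \<alpha>) \<and>
      contra_transf_of A B \<alpha> \<in> Arr (contra_hom (contra_of A) (contra_of B))"
    if "strong_duality A" "strong_duality B"
    for A B :: "('o, 'm, 'c) dual_twocat" and \<alpha>
    using duality_natural_iff[OF that] by simp
  note E = two_category_contra_TwoCat[where ?'o = 'o and ?'m = 'm and ?'c = 'c]
  have ob: "contra_of A \<in> Ob contra_TwoCat" if "strong_duality A" for A :: "('o, 'm, 'c) dual_twocat"
    using strong_dual.contra_two_category_contra_of strong_dual.has_strict_opposites_contra_of that
    by (auto simp: strong_dual_def)
  have cat: "category (contra_hom (contra_of A) (contra_of B))" for A B :: "('o, 'm, 'c) dual_twocat"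
    by (rule category_contra_hom)
  have obj: "contra_functor (contra_of A) (contra_of B) (contra_fun_of A B F)"
    if "strong_duality A" "strong_duality B" "duality_functor A B F" for A B :: "('o, 'm, 'c) dual_twocat" and F
    using bij_betw_contra_fun_of[OF that(1,2)] that(3) by (auto simp: bij_betw_def)
  have arr: "contra_transf_of A B \<alpha> \<in> Arr (contra_hom (contra_of A) (contra_of B))"
    if "strong_duality A" "strong_duality B" "\<alpha> \<in> Arr (duality_hom A B)" for A B :: "('o, 'm, 'c) dual_twocat" and \<alpha>
    using mem[OF that(1,2)] that(3) by blast
  have dom: "duality_functor A B (Src \<alpha>)" "duality_functor A B (Tgt \<alpha>)"
    if "strong_duality A" "strong_duality B" "\<alpha> \<in> Arr (duality_hom A B)" for A B :: "('o, 'm, 'c) dual_twocat" and \<alpha>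
    using mem[OF that(1,2)] that(3) by blast+
  have idn: "Idn (duality_hom A B) F \<in> Arr (duality_hom A B)"
    if "strong_duality A" "strong_duality B" "duality_functor A B F" for A B :: "('o, 'm, 'c) dual_twocat" and F
    using that obj[OF that] category.idn_arr[OF cat, of "contra_fun_of A B F" A B]
    unfolding mem[OF that(1,2)] by (simp add: contra_transf_of_idn del: contra_hom_simps(2))
  have cmp: "Cmp (duality_hom A B) \<beta> \<alpha> \<in> Arr (duality_hom A B)"
    if "strong_duality A" "strong_duality B" "\<alpha> \<in> Arr (duality_hom A B)" "\<beta> \<in> Arr (duality_hom A B)" "Src \<beta> = Tgt \<alpha>"
    for A B :: "('o, 'm, 'c) dual_twocat" and \<alpha> \<beta>
    using that(5) category.cmp_arr[OF cat arr[OF that(1,2,3)] arr[OF that(1,2,4)]]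
      dom(1)[OF that(1,2,3)] dom(2)[OF that(1,2,4)]
    unfolding mem[OF that(1,2)] by (simp add: contra_transf_of_cmp[OF that] del: contra_hom_simps(2))
  have hcomp: "CompA duality_TwoCat A B C \<beta> \<alpha> \<in> Arr (duality_hom A C)"
    if "strong_duality A" "strong_duality B" "strong_duality C" "\<alpha> \<in> Arr (duality_hom A B)" "\<beta> \<in> Arr (duality_hom B C)"
    for A B C :: "('o, 'm, 'c) dual_twocat" and \<alpha> \<beta>
    using two_category.comp_simps(2)[OF E ob[OF that(1)] ob[OF that(2)] ob[OF that(3)],
        of "contra_transf_of B C \<beta>" "contra_transf_of A B \<alpha>"]
      arr[OF that(1,2,4)] arr[OF that(2,3,5)] contra_fun_of_comp(1)[OF that(1-3)]
      dom[OF that(1,2,4)] dom[OF that(2,3,5)]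
    unfolding mem[OF that(1,3)] by (simp add: contra_transf_of_hcomp[OF that] del: contra_hom_simps(2))
  have "two_category D \<and>
      two_functor D contra_TwoCat (restrict_two_fun D contra_of contra_fun_of contra_transf_of)"
    unfolding D_def
  proof (rule two_category_reflect[OF E])
    fix A B :: "('o, 'm, 'c) dual_twocat"
    assume "A \<in> Ob duality_TwoCat" "B \<in> Ob duality_TwoCat"
    then have AB: "strong_duality A" "strong_duality B"
      by simp_all
    show "contra_of A \<in> Ob contra_TwoCat"
      by (rule ob[OF AB(1)])
    show "One duality_TwoCat A \<in> Obj (Hom duality_TwoCat A A) \<and>
        contra_fun_of A A (One duality_TwoCat A) = One contra_TwoCat (contra_of A)"
      using contra_fun_of_id[OF AB(1)] by simp
    show "inj_on (contra_fun_of A B) (Obj (Hom duality_TwoCat A B))"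
      using bij_betw_imp_inj_on[OF bij_betw_contra_fun_of[OF AB]] by simp
    show "inj_on (contra_transf_of A B) (Arr (Hom duality_TwoCat A B))"
      using bij_betw_imp_inj_on[OF bij_betw_contra_transf_of[OF AB]] by simp
    {
      fix F assume F: "F \<in> Obj (Hom duality_TwoCat A B)"
      show "contra_fun_of A B F \<in> Obj (Hom contra_TwoCat (contra_of A) (contra_of B))"
        using obj[OF AB, of F] F by simp
      show "Idn (Hom duality_TwoCat A B) F \<in> Arr (Hom duality_TwoCat A B) \<and>
          contra_transf_of A B (Idn (Hom duality_TwoCat A B) F) =
          Idn (Hom contra_TwoCat (contra_of A) (contra_of B)) (contra_fun_of A B F)"
        using idn[OF AB, of F] contra_transf_of_idn[OF AB, of F] F
        by (simp del: duality_hom_simps(2))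
    }
    fix \<alpha> assume "\<alpha> \<in> Arr (Hom duality_TwoCat A B)"
    then have \<alpha>: "\<alpha> \<in> Arr (duality_hom A B)"
      by (simp del: duality_hom_simps(2))
    show "contra_transf_of A B \<alpha> \<in> Arr (Hom contra_TwoCat (contra_of A) (contra_of B))"
      using arr[OF AB \<alpha>] by (simp del: contra_hom_simps(2))
    show "Dom (Hom duality_TwoCat A B) \<alpha> \<in> Obj (Hom duality_TwoCat A B) \<and>
        Dom (Hom contra_TwoCat (contra_of A) (contra_of B)) (contra_transf_of A B \<alpha>) =
        contra_fun_of A B (Dom (Hom duality_TwoCat A B) \<alpha>)"
      using dom[OF AB \<alpha>] by simp
    show "Cod (Hom duality_TwoCat A B) \<alpha> \<in> Obj (Hom duality_TwoCat A B) \<and>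
        Cod (Hom contra_TwoCat (contra_of A) (contra_of B)) (contra_transf_of A B \<alpha>) =
        contra_fun_of A B (Cod (Hom duality_TwoCat A B) \<alpha>)"
      using dom[OF AB \<alpha>] by simp
    fix \<beta> assume "\<beta> \<in> Arr (Hom duality_TwoCat A B)"
      "Dom (Hom duality_TwoCat A B) \<beta> = Cod (Hom duality_TwoCat A B) \<alpha>"
    then show "Cmp (Hom duality_TwoCat A B) \<beta> \<alpha> \<in> Arr (Hom duality_TwoCat A B) \<and>
        contra_transf_of A B (Cmp (Hom duality_TwoCat A B) \<beta> \<alpha>) =
        Cmp (Hom contra_TwoCat (contra_of A) (contra_of B)) (contra_transf_of A B \<beta>) (contra_transf_of A B \<alpha>)"
      using cmp[OF AB \<alpha>, of \<beta>] contra_transf_of_cmp[OF AB \<alpha>, of \<beta>] by (simp del: duality_hom_simps(2))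
  next
    fix A B C :: "('o, 'm, 'c) dual_twocat"
    assume "A \<in> Ob duality_TwoCat" "B \<in> Ob duality_TwoCat" "C \<in> Ob duality_TwoCat"
    then have ABC: "strong_duality A" "strong_duality B" "strong_duality C"
      by simp_all
    show "CompO duality_TwoCat A B C G F \<in> Obj (Hom duality_TwoCat A C) \<and>
        contra_fun_of A C (CompO duality_TwoCat A B C G F) =
        CompO contra_TwoCat (contra_of A) (contra_of B) (contra_of C) (contra_fun_of B C G) (contra_fun_of A B F)"
      if "F \<in> Obj (Hom duality_TwoCat A B)" "G \<in> Obj (Hom duality_TwoCat B C)" for F G
      using contra_fun_of_comp[OF ABC, of F G] that by simp
    show "CompA duality_TwoCat A B C \<beta> \<alpha> \<in> Arr (Hom duality_TwoCat A C) \<and>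
        contra_transf_of A C (CompA duality_TwoCat A B C \<beta> \<alpha>) =
        CompA contra_TwoCat (contra_of A) (contra_of B) (contra_of C) (contra_transf_of B C \<beta>) (contra_transf_of A B \<alpha>)"
      if "\<alpha> \<in> Arr (Hom duality_TwoCat A B)" "\<beta> \<in> Arr (Hom duality_TwoCat B C)" for \<alpha> \<beta>
      using hcomp[OF ABC, of \<alpha> \<beta>] contra_transf_of_hcomp[OF ABC, of \<alpha> \<beta>] that
      by (simp del: duality_hom_simps(2))
  qed
  then show "two_category D"
    and "two_functor D contra_TwoCat (restrict_two_fun D contra_of contra_fun_of contra_transf_of)"
    by simp_all
qed

section \<open>From strict opposites to a strong duality involution\<close>

text \<open>Opposites enter as chosen invertible contravariant morphisms. With the inverses \<chi>'
  as part of the data, verifications become cancellations of neighbouring \<chi> and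
  \<chi>'.\<close>

locale contra_opposites = contra_two_category A
  for A :: "('o, 'm, 'c) contra_twocat" +
  fixes opp :: "'o \<Rightarrow> 'o" and \<chi> \<chi>' :: "'o \<Rightarrow> 'm"
  assumes opp [simp]: "x \<in> COb A \<Longrightarrow> opp x \<in> COb A"
    and \<chi> [simp]: "x \<in> COb A \<Longrightarrow> \<chi> x \<in> Obj (CHom A Con x (opp x))"
    and \<chi>' [simp]: "x \<in> COb A \<Longrightarrow> \<chi>' x \<in> Obj (CHom A Con (opp x) x)"
    and \<chi>'_\<chi> [simp]: "x \<in> COb A \<Longrightarrow> CCompO A Con Con x (opp x) x (\<chi>' x) (\<chi> x) = COne A x"
    and \<chi>_\<chi>' [simp]: "x \<in> COb A \<Longrightarrow> CCompO A Con Con (opp x) x (opp x) (\<chi> x) (\<chi>' x) = COne A (opp x)"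
begin

lemma cancel [simp]:
  assumes "x \<in> COb A"
  shows "CCompA A Con Con x (opp x) x (Idn (CHom A Con (opp x) x) (\<chi>' x)) (Idn (CHom A Con x (opp x)) (\<chi> x)) =
      Idn (CHom A Cov x x) (COne A x)"
    and "CCompA A Con Con (opp x) x (opp x) (Idn (CHom A Con x (opp x)) (\<chi> x)) (Idn (CHom A Con (opp x) x) (\<chi>' x)) =
      Idn (CHom A Cov (opp x) (opp x)) (COne A (opp x))"
    and "\<lbrakk>w \<in> COb A; f \<in> Obj (CHom A v w x); t = Con \<odot> v\<rbrakk> \<Longrightarrow>
      CCompO A Con t w (opp x) x (\<chi>' x) (CCompO A Con v w x (opp x) (\<chi> x) f) = f"
    and "\<lbrakk>w \<in> COb A; f \<in> Obj (CHom A v w (opp x)); t = Con \<odot> v\<rbrakk> \<Longrightarrow>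
      CCompO A Con t w x (opp x) (\<chi> x) (CCompO A Con v w (opp x) x (\<chi>' x) f) = f"
    and "\<lbrakk>w \<in> COb A; \<alpha> \<in> Arr (CHom A v w x); t = Con \<odot> v\<rbrakk> \<Longrightarrow>
      CCompA A Con t w (opp x) x (Idn (CHom A Con (opp x) x) (\<chi>' x))
        (CCompA A Con v w x (opp x) (Idn (CHom A Con x (opp x)) (\<chi> x)) \<alpha>) = \<alpha>"
    and "\<lbrakk>w \<in> COb A; \<alpha> \<in> Arr (CHom A v w (opp x)); t = Con \<odot> v\<rbrakk> \<Longrightarrow>
      CCompA A Con t w x (opp x) (Idn (CHom A Con x (opp x)) (\<chi> x))
        (CCompA A Con v w (opp x) x (Idn (CHom A Con (opp x) x) (\<chi>' x)) \<alpha>) = \<alpha>"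
  using assms whisker_inverse(1,2,3)[of x "opp x" "\<chi> x" "\<chi>' x"]
    whisker_inverse(1,2,3)[of "opp x" x "\<chi>' x" "\<chi> x"] by simp_all

definition cov :: "('o, 'm, 'c) twocat" where
  "cov = \<lparr>Ob = COb A, Hom = CHom A Cov, One = COne A, CompO = CCompO A Cov Cov,
    CompA = CCompA A Cov Cov\<rparr>"

lemma cov_simps [simp]:
  "Ob cov = COb A" "Hom cov = CHom A Cov" "One cov = COne A" "CompO cov = CCompO A Cov Cov"
  "CompA cov = CCompA A Cov Cov"
  by (simp_all add: cov_def)

lemma two_category_cov: "two_category cov"
  using comp_functor[where v = Cov and w = Cov] by (intro two_category.intro) (simp_all add: hom_category)

definition inv1 :: "'o \<Rightarrow> 'o \<Rightarrow> 'm \<Rightarrow> 'm" where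
  "inv1 x y f = CCompO A Con Con (opp x) y (opp y) (\<chi> y) (CCompO A Cov Con (opp x) x y f (\<chi>' x))"

text \<open>Composing with the contravariant \<open>\<chi> y\<close> on the outside reverses
  2-cells, composing with \<open>\<chi>' x\<close> on the inside does not; hence a 2-functor out of
  \<open>co cov\<close>.\<close>

definition inv2 :: "'o \<Rightarrow> 'o \<Rightarrow> 'c \<Rightarrow> 'c" where
  "inv2 x y \<alpha> = CCompA A Con Con (opp x) y (opp y) (Idn (CHom A Con y (opp y)) (\<chi> y))
    (CCompA A Cov Con (opp x) x y \<alpha> (Idn (CHom A Con (opp x) x) (\<chi>' x)))"

definition dual_of :: "('o, 'm, 'c) dual_twocat" where
  "dual_of = \<lparr>Und = cov, Inv = restrict_two_fun (co cov) opp inv1 inv2,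
    Dunit = (\<lambda>x. if x \<in> COb A then CCompO A Con Con x (opp x) (opp (opp x)) (\<chi> (opp x)) (\<chi> x)
      else undefined)\<rparr>"

lemma dual_of_simps [simp]:
  "Und dual_of = cov" "Inv dual_of = restrict_two_fun (co cov) opp inv1 inv2"
  "x \<in> COb A \<Longrightarrow> Dunit dual_of x = CCompO A Con Con x (opp x) (opp (opp x)) (\<chi> (opp x)) (\<chi> x)"
  by (simp_all add: dual_of_def)

lemma two_functor_inv: "two_functor (co cov) cov (restrict_two_fun (co cov) opp inv1 inv2)"
proof (rule two_functor_restrict)
  show "cat_functor (Hom (co cov) x y) (Hom cov (opp x) (opp y)) (inv1 x y) (inv2 x y)"
    if "x \<in> Ob (co cov)" "y \<in> Ob (co cov)" for x y
  proof (intro cat_functor.intro cat_functor_axioms.intro)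
    fix f g assume "f \<in> Arr (Hom (co cov) x y)" "g \<in> Arr (Hom (co cov) x y)"
      "Dom (Hom (co cov) x y) g = Cod (Hom (co cov) x y) f"
    then show "inv2 x y (Cmp (Hom (co cov) x y) g f) = Cmp (Hom cov (opp x) (opp y)) (inv2 x y g) (inv2 x y f)"
      \<comment> \<open>One instance of interchange for each whiskering. The composite in
        \<open>co cov\<close> is \<open>f\<close> after \<open>g\<close> in \<open>A\<close>; the
        inner whiskering keeps this order and the outer one reverses it.\<close>
      using that interchange[of "opp x" x y Con Cov Con g f "Idn (CHom A Con (opp x) x) (\<chi>' x)"
          "Idn (CHom A Con (opp x) x) (\<chi>' x)"]
        interchange[of "opp x" y "opp y" Cov Con Con "Idn (CHom A Con y (opp y)) (\<chi> y)"
          "Idn (CHom A Con y (opp y)) (\<chi> y)"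
          "CCompA A Cov Con (opp x) x y f (Idn (CHom A Con (opp x) x) (\<chi>' x))"
          "CCompA A Cov Con (opp x) x y g (Idn (CHom A Con (opp x) x) (\<chi>' x))"]
      by (simp add: inv2_def)
  qed (use that in \<open>simp_all add: inv1_def inv2_def hom_category category_op_cat\<close>)
qed (simp_all add: inv1_def inv2_def two_category_cov two_category_co)

text \<open>\<open>f^oo\<close> is \<open>f\<close> conjugated by the composites of
  \<open>\<chi> x\<close> and \<open>\<chi> (opp x)\<close>, which makes these composites natural.
  The axiom on the unit holds because the unit at \<open>opp x\<close> is the composite of
  \<open>\<chi> (opp x)\<close> and \<open>\<chi> (opp (opp x))\<close>, and the involution applied
  to the unit at \<open>x\<close> reduces to the same composite once \<open>\<chi> x\<close> cancels
  against \<open>\<chi>' x\<close>.\<close>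

lemma strong_duality_dual_of: "strong_duality dual_of"
  unfolding strong_duality_def two_natural_iso_def
proof (intro conjI ballI)
  show "two_category (Und dual_of)"
    by (simp add: two_category_cov)
  show inv: "two_functor (co (Und dual_of)) (Und dual_of) (Inv dual_of)"
    by (simp add: two_functor_inv)
  show "two_natural (Und dual_of) (Und dual_of) (id_two_fun (Und dual_of))
      (comp_two_fun (Und dual_of) (Inv dual_of) (Inv dual_of)) (Dunit dual_of)"
  proof (rule two_naturalI)
    show "two_functor (Und dual_of) (Und dual_of) (id_two_fun (Und dual_of))"
      by (simp add: two_functor_id two_category_cov)
    show "two_functor (Und dual_of) (Und dual_of) (comp_two_fun (Und dual_of) (Inv dual_of) (Inv dual_of))"
      using two_functor_comp[OF two_functor_co[OF inv] inv] by (simp add: co_co)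
  qed (simp_all add: inv2_def, simp add: dual_of_def)
next
  fix x assume "x \<in> Ob (Und dual_of)"
  then have [simp]: "x \<in> COb A"
    by simp
  show "is_isomorphism (Und dual_of) (FunO (id_two_fun (Und dual_of)) x)
      (FunO (comp_two_fun (Und dual_of) (Inv dual_of) (Inv dual_of)) x) (Dunit dual_of x)"
    unfolding is_isomorphism_def
    by (auto intro!: bexI[of _ "CCompO A Con Con (opp (opp x)) (opp x) x (\<chi>' x) (\<chi>' (opp x))"])
  show "Dunit dual_of (FunO (Inv dual_of) x) =
      Fun1 (Inv dual_of) x (FunO (Inv dual_of) (FunO (Inv dual_of) x)) (Dunit dual_of x)"
    by (simp add: inv1_def)
qed

sublocale D: strong_dual dual_of
  by (rule strong_dual.intro) (rule strong_duality_dual_of)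

section \<open>Isomorphism of the generated 2-category with contravariance with the given
  one\<close>

fun opm :: "variance \<Rightarrow> 'o \<Rightarrow> 'm" where
  "opm Cov x = COne A x"
| "opm Con x = \<chi> x"

fun opm' :: "variance \<Rightarrow> 'o \<Rightarrow> 'm" where
  "opm' Cov x = COne A x"
| "opm' Con x = \<chi>' x"

definition from_contra_of :: "('o, 'm, 'c, 'o, 'm, 'c) contra_fun" where
  "from_contra_of = \<lparr>
     CFunO = (\<lambda>x. if x \<in> COb A then x else undefined),
     CFun1 = (\<lambda>v x y f. if x \<in> COb A \<and> y \<in> COb A \<and> f \<in> Obj (CHom (contra_of dual_of) v x y)
       then CCompO A Cov v x (dob dual_of v x) y f (opm v x) else undefined),
     CFun2 = (\<lambda>v x y \<alpha>. if x \<in> COb A \<and> y \<in> COb A \<and> \<alpha> \<in> Arr (CHom (contra_of dual_of) v x y)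
       then CCompA A Cov v x (dob dual_of v x) y \<alpha> (Idn (CHom A v x (dob dual_of v x)) (opm v x))
       else undefined)\<rparr>"

text \<open>Precomposition with the inverse \<open>x^v \<rightarrow> x\<close>, itself of variance
  \<open>v\<close>. Since \<open>v \<odot> v = Cov\<close>, the result is covariant, as the
  hom-categories of \<open>contra_of dual_of\<close> require.\<close>

definition to_contra_of :: "('o, 'm, 'c, 'o, 'm, 'c) contra_fun" where
  "to_contra_of = \<lparr>
     CFunO = (\<lambda>x. if x \<in> COb A then x else undefined),
     CFun1 = (\<lambda>v x y f. if x \<in> COb A \<and> y \<in> COb A \<and> f \<in> Obj (CHom A v x y)
       then CCompO A v v (dob dual_of v x) x y f (opm' v x) else undefined),
     CFun2 = (\<lambda>v x y \<alpha>. if x \<in> COb A \<and> y \<in> COb A \<and> \<alpha> \<in> Arr (CHom A v x y)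
       then CCompA A v v (dob dual_of v x) x y \<alpha> (Idn (CHom A v (dob dual_of v x) x) (opm' v x))
       else undefined)\<rparr>"

lemma from_contra_of_simps [simp]:
  "x \<in> COb A \<Longrightarrow> CFunO from_contra_of x = x"
  "\<lbrakk>x \<in> COb A; y \<in> COb A; f \<in> Obj (CHom A Cov (dob dual_of v x) y)\<rbrakk> \<Longrightarrow>
    CFun1 from_contra_of v x y f = CCompO A Cov v x (dob dual_of v x) y f (opm v x)"
  "\<lbrakk>x \<in> COb A; y \<in> COb A; \<alpha> \<in> Arr (CHom A Cov (dob dual_of v x) y)\<rbrakk> \<Longrightarrow>
    CFun2 from_contra_of v x y \<alpha> =
      CCompA A Cov v x (dob dual_of v x) y \<alpha> (Idn (CHom A v x (dob dual_of v x)) (opm v x))"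
  by (simp_all add: from_contra_of_def)

lemma to_contra_of_simps [simp]:
  "x \<in> COb A \<Longrightarrow> CFunO to_contra_of x = x"
  "\<lbrakk>x \<in> COb A; y \<in> COb A; f \<in> Obj (CHom A v x y)\<rbrakk> \<Longrightarrow>
    CFun1 to_contra_of v x y f = CCompO A v v (dob dual_of v x) x y f (opm' v x)"
  "\<lbrakk>x \<in> COb A; y \<in> COb A; \<alpha> \<in> Arr (CHom A v x y)\<rbrakk> \<Longrightarrow>
    CFun2 to_contra_of v x y \<alpha> =
      CCompA A v v (dob dual_of v x) x y \<alpha> (Idn (CHom A v (dob dual_of v x) x) (opm' v x))"
  by (simp_all add: to_contra_of_def)

lemma contra_functor_from_contra_of: "contra_functor (contra_of dual_of) A from_contra_of"
proof (rule contra_functorI)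
  show "cat_functor (CHom (contra_of dual_of) v x y) (CHom A v (CFunO from_contra_of x) (CFunO from_contra_of y))
      (CFun1 from_contra_of v x y) (CFun2 from_contra_of v x y)"
    if "x \<in> COb (contra_of dual_of)" "y \<in> COb (contra_of dual_of)" for v x y
  proof -
    have xy [simp]: "x \<in> COb A" "y \<in> COb A"
      using that by simp_all
    have [simp]: "dob dual_of v x \<in> COb A" "opm v x \<in> Obj (CHom A v x (dob dual_of v x))"
      by (cases v; simp)+
    interpret W: cat_functor "CHom A Cov (dob dual_of v x) y" "CHom A v x y"
      "\<lambda>f. CCompO A Cov v x (dob dual_of v x) y f (opm v x)"
      "\<lambda>\<alpha>. CCompA A Cov v x (dob dual_of v x) y \<alpha> (Idn (CHom A v x (dob dual_of v x)) (opm v x))"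
      by (rule whisker_functor) simp_all
    show ?thesis
      by (intro cat_functor.intro cat_functor_axioms.intro)
        (simp_all add: hom_category W.map_cmp)
  qed
  show "CFun2 from_contra_of (v \<odot> w) x z (CCompA (contra_of dual_of) v w x y z \<beta> \<alpha>) =
      CCompA A v w (CFunO from_contra_of x) (CFunO from_contra_of y) (CFunO from_contra_of z)
        (CFun2 from_contra_of v y z \<beta>) (CFun2 from_contra_of w x y \<alpha>)"
    if "x \<in> COb (contra_of dual_of)" "y \<in> COb (contra_of dual_of)" "z \<in> COb (contra_of dual_of)"
      "\<alpha> \<in> Arr (CHom (contra_of dual_of) w x y)" "\<beta> \<in> Arr (CHom (contra_of dual_of) v y z)"
    for v w x y z \<alpha> \<beta>
    \<comment> \<open>Everything rests on \<open>f^o\<close> after \<chi> being \<chi> after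
      \<open>f\<close>, since \<chi>' in \<open>inv2\<close> cancels. When both cells are
      contravariant, \<open>f\<close> starts at \<open>opp x\<close>, and the \<chi> cancelled there
      is the outer factor of the unit.\<close>
    using that by (cases v; cases w) (simp_all add: inv2_def)
qed (fact contra_two_category_axioms D.contra_two_category_contra_of | simp
    | auto simp: from_contra_of_def)+

lemma contra_functor_to_contra_of: "contra_functor A (contra_of dual_of) to_contra_of"
proof (rule contra_functorI)
  show "cat_functor (CHom A v x y) (CHom (contra_of dual_of) v (CFunO to_contra_of x) (CFunO to_contra_of y))
      (CFun1 to_contra_of v x y) (CFun2 to_contra_of v x y)"
    if xy [simp]: "x \<in> COb A" "y \<in> COb A" for v x y
  proof -
    have [simp]: "dob dual_of v x \<in> COb A" "opm' v x \<in> Obj (CHom A v (dob dual_of v x) x)" "v \<odot> v = Cov"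
      by (cases v; simp)+
    interpret W: cat_functor "CHom A v x y" "CHom A Cov (dob dual_of v x) y"
      "\<lambda>f. CCompO A v v (dob dual_of v x) x y f (opm' v x)"
      "\<lambda>\<alpha>. CCompA A v v (dob dual_of v x) x y \<alpha> (Idn (CHom A v (dob dual_of v x) x) (opm' v x))"
      by (rule whisker_functor) simp_all
    show ?thesis
      by (intro cat_functor.intro cat_functor_axioms.intro)
        (simp_all add: hom_category W.map_cmp)
  qed
  show "CFun2 to_contra_of (v \<odot> w) x z (CCompA A v w x y z \<beta> \<alpha>) =
      CCompA (contra_of dual_of) v w (CFunO to_contra_of x) (CFunO to_contra_of y) (CFunO to_contra_of z)
        (CFun2 to_contra_of v y z \<beta>) (CFun2 to_contra_of w x y \<alpha>)"
    if "x \<in> COb A" "y \<in> COb A" "z \<in> COb A" "\<alpha> \<in> Arr (CHom A w x y)" "\<beta> \<in> Arr (CHom A v y z)"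
    for v w x y z \<alpha> \<beta>
    using that by (cases v; cases w) (simp_all add: inv2_def)
qed (fact contra_two_category_axioms D.contra_two_category_contra_of | simp
    | auto simp: to_contra_of_def)+

text \<open>The two functors precompose with \<open>opm\<close> and with its inverse
  \<open>opm'\<close>, which cancel for either sign.\<close>

lemma isomorphism_contra_of_dual_of:
  "is_isomorphism contra_TwoCat (contra_of dual_of) A from_contra_of"
proof -
  have "comp_contra_fun (contra_of dual_of) to_contra_of from_contra_of = id_contra_fun (contra_of dual_of)"
  proof (rule contra_fun_eqI[OF contra_functor_comp[OF contra_functor_from_contra_of
          contra_functor_to_contra_of] contra_functor_id[OF D.contra_two_category_contra_of]])
    show "CFun1 (comp_contra_fun (contra_of dual_of) to_contra_of from_contra_of) v x y f =
        CFun1 (id_contra_fun (contra_of dual_of)) v x y f"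
      if "x \<in> COb (contra_of dual_of)" "y \<in> COb (contra_of dual_of)"
        "f \<in> Obj (CHom (contra_of dual_of) v x y)" for v x y f
      using that by (cases v) simp_all
    show "CFun2 (comp_contra_fun (contra_of dual_of) to_contra_of from_contra_of) v x y \<alpha> =
        CFun2 (id_contra_fun (contra_of dual_of)) v x y \<alpha>"
      if "x \<in> COb (contra_of dual_of)" "y \<in> COb (contra_of dual_of)"
        "\<alpha> \<in> Arr (CHom (contra_of dual_of) v x y)" for v x y \<alpha>
      using that by (cases v) simp_all
  qed simp
  moreover have "comp_contra_fun A from_contra_of to_contra_of = id_contra_fun A"
  proof (rule contra_fun_eqI[OF contra_functor_comp[OF contra_functor_to_contra_of
          contra_functor_from_contra_of] contra_functor_id[OF contra_two_category_axioms]])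
    show "CFun1 (comp_contra_fun A from_contra_of to_contra_of) v x y f = CFun1 (id_contra_fun A) v x y f"
      if "x \<in> COb A" "y \<in> COb A" "f \<in> Obj (CHom A v x y)" for v x y f
      using that by (cases v) simp_all
    show "CFun2 (comp_contra_fun A from_contra_of to_contra_of) v x y \<alpha> = CFun2 (id_contra_fun A) v x y \<alpha>"
      if "x \<in> COb A" "y \<in> COb A" "\<alpha> \<in> Arr (CHom A v x y)" for v x y \<alpha>
      using that by (cases v) simp_all
  qed simp
  ultimately show ?thesis
    unfolding is_isomorphism_def
    using contra_functor_from_contra_of contra_functor_to_contra_of by auto
qed

end

lemma contra_of_essentially_surjective:
  fixes A :: "('o, 'm, 'c) contra_twocat"
  assumes "contra_two_category A" "has_strict_opposites A"
  shows "\<exists>D H. strong_duality D \<and> is_isomorphism contra_TwoCat (contra_of D) A H"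
proof -
  interpret contra_two_category A by fact
  \<comment> \<open>Universality is first traded for invertibility, so that opposites, universal
    morphisms and their inverses can be chosen together as functions on objects.\<close>
  have "\<forall>x\<in>COb A. \<exists>x' \<chi> \<chi>'. x' \<in> COb A \<and> \<chi> \<in> Obj (CHom A Con x x') \<and> \<chi>' \<in> Obj (CHom A Con x' x) \<and>
      CCompO A Con Con x x' x \<chi>' \<chi> = COne A x \<and> CCompO A Con Con x' x x' \<chi> \<chi>' = COne A x'"
    using assms(2) strict_oppositeE unfolding has_strict_opposites_def by metis
  then obtain opp \<chi> \<chi>' where "\<forall>x\<in>COb A. opp x \<in> COb A \<and> \<chi> x \<in> Obj (CHom A Con x (opp x)) \<and>
      \<chi>' x \<in> Obj (CHom A Con (opp x) x) \<and> CCompO A Con Con x (opp x) x (\<chi>' x) (\<chi> x) = COne A x \<and>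
      CCompO A Con Con (opp x) x (opp x) (\<chi> x) (\<chi>' x) = COne A (opp x)"
    by metis
  then interpret contra_opposites A opp \<chi> \<chi>'
    by unfold_locales auto
  show ?thesis
    using strong_duality_dual_of isomorphism_contra_of_dual_of by blast
qed

theorem theorem4p11:
  shows "two_equivalent
    (duality_TwoCat ::
      (('o, 'm, 'c) dual_twocat,
       ('o, 'm, 'c, 'o, 'm, 'c) dual_fun,
       (('o, 'm, 'c, 'o, 'm, 'c) dual_fun, 'o, 'm) transf) twocat)
    (contra_TwoCat ::
      (('o, 'm, 'c) contra_twocat,
       ('o, 'm, 'c, 'o, 'm, 'c) contra_fun,
       (('o, 'm, 'c, 'o, 'm, 'c) contra_fun, 'o, 'm) transf) twocat)"
proof (rule two_equivalentI[OF two_functor_contra_of])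
  fix A B :: "('o, 'm, 'c) dual_twocat"
  assume "A \<in> Ob duality_TwoCat" "B \<in> Ob duality_TwoCat"
  then have AB: "strong_duality A" "strong_duality B"
    by simp_all
  let ?F = "restrict_two_fun duality_TwoCat contra_of contra_fun_of contra_transf_of"
  show "bij_betw (Fun1 ?F A B) (Obj (Hom duality_TwoCat A B)) (Obj (Hom contra_TwoCat (FunO ?F A) (FunO ?F B)))"
    \<comment> \<open>\<open>restrict_two_fun\<close> agrees with \<open>contra_fun_of\<close> on
      the carrier only, hence the passage through \<open>bij_betw_cong\<close>.\<close>
    using bij_betw_contra_fun_of[OF AB] AB by (subst bij_betw_cong[where g = "contra_fun_of A B"]) simp_all
  show "bij_betw (Fun2 ?F A B) (Arr (Hom duality_TwoCat A B)) (Arr (Hom contra_TwoCat (FunO ?F A) (FunO ?F B)))"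
    using bij_betw_contra_transf_of[OF AB] AB
    by (subst bij_betw_cong[where g = "contra_transf_of A B"])
      (simp_all del: contra_hom_simps(2) duality_hom_simps(2))
next
  fix A :: "('o, 'm, 'c) contra_twocat"
  assume "A \<in> Ob contra_TwoCat"
  then show "\<exists>D\<in>Ob duality_TwoCat. \<exists>H. is_isomorphism contra_TwoCat
      (FunO (restrict_two_fun duality_TwoCat contra_of contra_fun_of contra_transf_of) D) A H"
    using contra_of_essentially_surjective[of A] by auto
qed

end
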